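(* (i) Let $-1<p<0$. There exist origin-symmetric convex bodies $K$ and $L$ in $\mathbb{R}^4$ such that $\Gamma^*_pK\subset\Gamma^*_pL$, but $\mathrm{vol}(L)>\mathrm{vol}(K)$. (ii) Let $0<p<1$. There exist origin-symmetric convex bodies $K$ and $L$ in $\mathbb{R}^3$ such that $\Gamma^*_pK\subset\Gamma^*_pL$, but $\mathrm{vol}(L)>\mathrm{vol}(K)$.
   Context: A convex body is a compact convex set with non-empty interior in $\mathbb{R}^n$; $\mathrm{vol}$ denotes $n$-dimensional Lebesgue measure, and $(x,\xi)$ is the standard inner product. Polar $p$-centroid body: for $p>-1$, $p\ne 0$, the polar $p$-centroid body $\Gamma^*_pK$ of $K$ is the (possibly non-convex) body $\Gamma_p^*K=\{\xi:\|\xi\|_{\Gamma^*_pK}\le 1\}$ whose Minkowski functional is $$\|\xi\|_{\Gamma^*_p K}=\left(\frac{1}{\mathrm{vol}(K)}\int_K|(x,\xi)|^p\,dx\right)^{1/p},\quad \xi\in\mathbb{R}^n\setminus\{0\}.$$ *)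

theory Defs
  imports "HOL-Analysis.Analysis"
begin

definition convex_body :: "'a::euclidean_space set \<Rightarrow> bool" where
  "convex_body K \<longleftrightarrow> compact K \<and> convex K \<and> interior K \<noteq> {}"

definition origin_symmetric :: "'a::euclidean_space set \<Rightarrow> bool" where
  "origin_symmetric K \<longleftrightarrow> uminus ` K = K"

abbreviation vol :: "'a::euclidean_space set \<Rightarrow> real" where
  "vol K \<equiv> measure lebesgue K"

text \<open>
  The integral formula is used for nonzero arguments; at the origin a Minkowski functional is 0.
  For a convex body \<open>K\<close>, \<open>p > -1\<close> and \<open>\<xi> \<noteq> 0\<close> the integrand is integrable over \<open>K\<close>, so the default value
  of the Bochner integral plays no role. For negative \<open>p\<close> the convention \<open>0 powr p = 0\<close> only affects
  the null set of those \<open>x\<close> that are orthogonal to \<open>\<xi>\<close>.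
\<close>

definition polar_centroid_functional :: "real \<Rightarrow> 'a::euclidean_space set \<Rightarrow> 'a \<Rightarrow> real" where
  "polar_centroid_functional p K \<xi> =
     (if \<xi> = 0 then 0
      else ((1 / vol K) * (LINT x:K|lebesgue. \<bar>x \<bullet> \<xi>\<bar> powr p)) powr (1 / p))"

definition polar_centroid_body :: "real \<Rightarrow> 'a::euclidean_space set \<Rightarrow> 'a set" where
  "polar_centroid_body p K = {\<xi>. polar_centroid_functional p K \<xi> \<le> 1}"

end

theory Submission
  imports Defs
begin

text \<open>
  Write \<open>(x, t)\<close> for the points of the space, where \<open>x\<close> lies in a hyperplane of dimension \<open>k\<close>
  (\<open>k = 3\<close> for negative \<open>p\<close>, \<open>k = 2\<close> for positive \<open>p\<close>). The body \<open>K\<close> is a cylinder over a ball, and \<open>L\<close> is the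
  slightly tilted cylinder \<open>\<bar>x\<bar> ^ k \<le> 1 + \<epsilon> * (1 / 2 - \<bar>t\<bar>)\<close>, \<open>\<bar>t\<bar> \<le> 1\<close>.

  To first order in \<open>\<epsilon>\<close>, tilting moves mass of the lateral surface from large \<open>\<bar>t\<bar>\<close> to small
  \<open>\<bar>t\<bar>\<close>. The integral of \<open>\<bar>x \<bullet> \<xi> + s\<bar> powr p\<close> over the unit sphere \<open>\<bar>x\<bar> = 1\<close> is strictly monotone in \<open>\<bar>s\<bar>\<close>,
  increasing for \<open>p > 0\<close> and decreasing for \<open>p < 0\<close>; hence tilting strictly improves the average of
  \<open>\<bar>x \<bullet> \<xi> + t * \<eta>\<bar> powr p\<close> in every direction \<open>(\<xi>, \<eta>)\<close> with \<open>\<eta> \<noteq> 0\<close>. The improvement degenerates only at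
  \<open>\<eta> = 0\<close>, where it is restored by making the cylinder \<open>K\<close> wider by a factor \<open>1 + O(\<epsilon>\<^sup>2)\<close> and
  flatter by so much that its volume drops below that of \<open>L\<close>.

  For the sphere in dimension 3 the monotonicity is elementary, since \<open>x \<bullet> \<xi>\<close> is uniformly distributed.
  For the circle it follows from the identity \<open>cos u + cos v = 2 * cos ((u + v) / 2) * cos ((u - v) / 2)\<close>, which
  turns the integral into an autocorrelation of the function \<open>\<bar>cos (u / 2)\<bar> powr p\<close>.
\<close>

section \<open>Integrals over half-open intervals\<close>

text \<open>The sign of \<open>p\<close> dictates the dimension. On the circle, polarization would
  make the autocorrelation largest at shift 0 for either sign of \<open>p\<close>: replacing
  \<open>p\<close> by a negative exponent flips both factors of the polarized product. So wherever
  the integral converges it would still increase with \<bar>s\<bar> \<le> 1, while a decrease is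
  required. On the 2-sphere the projection onto a line is uniform, and the integral is that of
  \<bar>x\<bar> powr p over a window which leaves the singularity at 0 as \<bar>s\<bar> grows. The
  k-th power of the radius is the natural variable: layers have mass linear in it, so the tilt
  preserves the volume exactly, and convexity survives because a power of a norm is convex. The
  obstacle is uniformity. One \<epsilon> must serve all directions, but the gain of order \<epsilon>
  fades as \<eta> tends to 0, whereas the second order error does not. Near \<eta> = 0 the integrand
  hardly depends on the height t, so flattening is almost free there, while widening by 1 + \<kappa>
  gains a fixed multiple of \<kappa>. Hence height can pay for radius.\<close>

lemma set_integrable_powr_from_0:
  fixes a c :: real
  assumes "- 1 < a" "0 \<le> c"
  shows "set_integrable lborel {0<..c} (\<lambda>y. y powr a)"
proof -
  have "(\<lambda>y. y powr a) absolutely_integrable_on {0<..c}"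
    by (intro nonnegative_absolutely_integrable_1 integrable_on_powr_from_0' assms) auto
  then show ?thesis
    unfolding set_integrable_def by (subst (asm) integrable_completion) auto
qed

lemma set_integrable_bounded_by:
  fixes f g :: "'a \<Rightarrow> real"
  assumes "set_integrable M A g" "f \<in> borel_measurable M" "A \<in> sets M"
    and "\<And>x. x \<in> A \<Longrightarrow> \<bar>f x\<bar> \<le> g x"
  shows "set_integrable M A f"
  using assms(1)
proof (rule set_integrable_bound)
  show "set_borel_measurable M A f"
    using assms(2,3) unfolding set_borel_measurable_def by measurable
  show "AE x in M. x \<in> A \<longrightarrow> norm (f x) \<le> norm (g x)"
    using assms(4) by (intro AE_I2) force
qed

lemma set_integral_nonneg_real:
  fixes f :: "'a \<Rightarrow> real"
  assumes "\<And>x. 0 \<le> f x"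
  shows "0 \<le> (LINT x:A|M. f x)"
  unfolding set_lebesgue_integral_def
  using assms by (intro Bochner_Integration.integral_nonneg) simp

lemma set_integral_Ioc_const:
  fixes a b c :: real
  assumes "a \<le> b"
  shows "(LINT y:{a<..b}|lborel. c) = (b - a) * c"
  using assms by (simp add: set_integral_const)

lemma set_integrable_Ioc_const: "set_integrable lborel {a<..b} (\<lambda>_. c::real)" for a b :: real
  unfolding set_integrable_def by (cases "a \<le> b") (auto intro!: integrable_real_mult_indicator)

text \<open>Half-open intervals are glued without overlap, so no null set has to be discussed; they
  also leave out 0, where \<open>powr\<close> takes its conventional value.\<close>

lemma set_integral_Ioc_split:
  fixes f :: "real \<Rightarrow> real"
  assumes "a \<le> b" "b \<le> c" "set_integrable lborel {a<..c} f"
  shows "(LINT y:{a<..c}|lborel. f y) = (LINT y:{a<..b}|lborel. f y) + (LINT y:{b<..c}|lborel. f y)"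
proof -
  have "{a<..c} = {a<..b} \<union> {b<..c}"
    using assms by auto
  moreover have "set_integrable lborel {a<..b} f" "set_integrable lborel {b<..c} f"
    by (rule set_integrable_subset[OF assms(3)]; use assms in auto)+
  ultimately show ?thesis
    using set_integral_Un[of "{a<..b}" "{b<..c}" lborel f] by auto
qed

lemma set_integral_Ioc_scale:
  fixes f :: "real \<Rightarrow> real"
  assumes "0 < c"
  shows "(LINT y:{0<..c * b}|lborel. f y) = c * (LINT y:{0<..b}|lborel. f (c * y))"
proof -
  have "indicator {0<..c * b} (c * y) = (indicator {0<..b} y :: real)" for y
    using assms by (auto simp: indicator_def zero_less_mult_iff mult_le_cancel_left)
  then show ?thesis
    unfolding set_lebesgue_integral_def
    using assms by (subst lborel_integral_real_affine[where c = c and t = 0]) auto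
qed

section \<open>First order comparison of the tilted cylinder with a cylinder\<close>

text \<open>
  Think of \<open>e r s\<close> as the integral of \<open>\<bar>x \<bullet> \<xi> + s\<bar> powr p\<close> over the unit sphere in the
  \<open>k\<close>-dimensional hyperplane, where \<open>r\<close> is the norm of \<open>\<xi>\<close>. In the variable \<open>y = \<bar>x\<bar> ^ k\<close> the
  measure of a shell is linear, so that \<open>shell Y r s\<close> is, up to a constant, the integral over the
  ball \<open>\<bar>x\<bar> ^ k \<le> Y\<close>. The pair \<open>(0, 0)\<close> is excluded in \<open>e_mono\<close> because of \<open>0 powr p = 0\<close>.
\<close>

locale shell_kernel =
  fixes p :: real and k :: nat and e :: "real \<Rightarrow> real \<Rightarrow> real"
  assumes p: "p \<noteq> 0" "\<bar>p\<bar> < 1"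
    and k: "2 \<le> k"
    and e_meas [measurable]: "(\<lambda>(r, s). e r s) \<in> borel_measurable (borel \<Otimes>\<^sub>M borel)"
    and e_nonneg: "0 \<le> e r s"
    and e_hom: "\<lbrakk>0 < c; 0 \<le> r; 0 \<le> s\<rbrakk> \<Longrightarrow> e (c * r) (c * s) = c powr p * e r s"
    and e_mono: "\<lbrakk>0 \<le> r; 0 \<le> s; s \<le> s'; 0 < r \<or> 0 < s\<rbrakk> \<Longrightarrow> sgn p * e r s \<le> sgn p * e r s'"
    and e_bound: "\<exists>C. \<forall>r s. 0 \<le> r \<and> 0 \<le> s \<and> max r s = 1 \<longrightarrow> e r s \<le> C"
    and e_gap: "0 < d \<Longrightarrow> \<exists>c>0. \<forall>r s. 0 \<le> r \<and> d \<le> s \<and> max r s = 1 \<longrightarrow>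
                  c \<le> sgn p * (e r (3 / 4 * s) - e r (1 / 4 * s))"
    and e_cont0: "\<exists>C q. 0 < q \<and> (\<forall>r s. 0 < r \<and> r \<le> 1 \<and> 0 \<le> s \<longrightarrow>
                    sgn p * (e r s - e r 0) \<le> C * s powr q / r)"
    and e_pos: "0 < e 1 0"
begin

section \<open>Domination and integrability, uniformly in the direction\<close>

definition shell :: "real \<Rightarrow> real \<Rightarrow> real \<Rightarrow> real" where
  "shell Y r s = (LINT y:{0<..Y}|lborel. e (y powr (1 / k) * r) s)"

lemma e_meas' [measurable (raw)]:
  assumes [measurable]: "f \<in> borel_measurable M" "g \<in> borel_measurable M"
  shows "(\<lambda>x. e (f x) (g x)) \<in> borel_measurable M"
  using measurable_compose[of "\<lambda>x. (f x, g x)" M "borel \<Otimes>\<^sub>M borel", OF _ e_meas] by simp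

lemma shell_meas [measurable]:
  assumes [measurable]: "Y \<in> borel_measurable borel"
  shows "(\<lambda>t. shell (Y t) r (t * s)) \<in> borel_measurable borel"
  unfolding shell_def set_lebesgue_integral_def indicator_def greaterThanAtMost_iff
  by measurable

text \<open>Dividing by \<open>max r s\<close> reduces this to the normalized pairs of
  \<open>e_bound\<close> by homogeneity.\<close>

lemma e_le_max:
  obtains C where "0 < C"
    and "\<And>r s. \<lbrakk>0 \<le> r; 0 \<le> s; 0 < r \<or> 0 < s\<rbrakk> \<Longrightarrow> e r s \<le> C * max r s powr p"
proof -
  obtain C where C: "\<And>r s. \<lbrakk>0 \<le> r; 0 \<le> s; max r s = 1\<rbrakk> \<Longrightarrow> e r s \<le> C"
    using e_bound by blast
  have "e r s \<le> max 1 C * max r s powr p" if "0 \<le> r" "0 \<le> s" "0 < r \<or> 0 < s" for r s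
  proof -
    define m where "m = max r s"
    have m: "0 < m" "max (r / m) (s / m) = 1"
      using that by (auto simp: m_def max_def field_simps)
    have "e r s = m powr p * e (r / m) (s / m)"
      using e_hom[of m "r / m" "s / m"] m that by simp
    also have "\<dots> \<le> m powr p * max 1 C"
      using C[of "r / m" "s / m"] m that by (intro mult_left_mono) auto
    finally show ?thesis
      by (simp add: m_def mult.commute)
  qed
  with that[of "max 1 C"] show ?thesis
    by simp
qed

lemma powr_inverse_k_le:
  assumes "0 < y" "y \<le> 2"
  shows "y powr (1 / k) \<le> 2"
proof -
  have "y powr (1 / k) \<le> 2 powr (1 / k)"
    using assms by (intro powr_mono2) auto
  also have "\<dots> \<le> 2 powr 1"
    using k by (intro powr_mono) auto
  finally show ?thesis by simp
qed

text \<open>A majorant in product form that does not depend on the direction; it is integrable in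
  \<open>t\<close> and in \<open>y\<close> because \<open>\<bar>p\<bar> < 1\<close>. The exponent
  \<open>-\<bar>p\<bar>\<close> covers both signs of \<open>p\<close>, and \<open>y \<le> 2\<close>
  is the range of all profiles that occur.\<close>

lemma e_dominated:
  obtains C where "0 < C"
    and "\<And>r s t y. \<lbrakk>0 \<le> r; 0 \<le> s; max r s = 1; 0 < t; t \<le> 1; 0 < y; y \<le> 2\<rbrakk>
           \<Longrightarrow> e (y powr (1 / k) * r) (t * s) \<le> C * t powr (-\<bar>p\<bar>) * y powr (-\<bar>p\<bar>)"
proof -
  obtain C where C: "0 < C"
      "\<And>r s. \<lbrakk>0 \<le> r; 0 \<le> s; 0 < r \<or> 0 < s\<rbrakk> \<Longrightarrow> e r s \<le> C * max r s powr p"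
    using e_le_max by blast
  have "e (y powr (1 / k) * r) (t * s) \<le> (4 * C) * t powr (-\<bar>p\<bar>) * y powr (-\<bar>p\<bar>)"
    if *: "0 \<le> r" "0 \<le> s" "max r s = 1" "0 < t" "t \<le> 1" "0 < y" "y \<le> 2" for r s t y
  proof -
    define m where "m = max (y powr (1 / k) * r) (t * s)"
    have rs: "0 < r \<or> 0 < s" "r \<le> 1" "s \<le> 1" using * by (auto simp: max_def split: if_splits)
    have y2: "y powr (1 / k) \<le> 2" using * powr_inverse_k_le by blast
    have m2: "m \<le> 2"
    proof -
      have "y powr (1 / k) * r \<le> 2 * 1" "t * s \<le> 1 * 1"
        using * y2 rs by (intro mult_mono; simp)+
      then show ?thesis by (simp add: m_def)
    qed
    \<comment> \<open>One of \<open>r\<close>, \<open>s\<close> equals 1, so \<open>m\<close> is at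
      least \<open>y powr (1 / k)\<close> or at least \<open>t\<close>. The other factor is at most
      1 or at most 2, which the division by 2 absorbs.\<close>
    have lo: "y powr (1 / k) * t / 2 \<le> m"
    proof (cases "r = 1")
      case True
      have "y powr (1 / k) * t / 2 \<le> y powr (1 / k) * 1"
        using * by (intro order_trans[OF _ mult_left_mono[of t 1]]) auto
      then show ?thesis using True by (simp add: m_def)
    next
      case False
      then have "s = 1" using * by (auto simp: max_def split: if_splits)
      moreover have "y powr (1 / k) * t \<le> 2 * t"
        using y2 * by (intro mult_right_mono) auto
      ultimately show ?thesis by (simp add: m_def)
    qed
    have "0 < y powr (1 / k) * t / 2" using * by simp
    then have m0: "0 < m" using lo by linarith
    have tp: "1 \<le> t powr (-\<bar>p\<bar>)"
      using * powr_mono'[of "-\<bar>p\<bar>" 0 t] by simp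
    have yp: "1 / 2 \<le> y powr (-\<bar>p\<bar>)"
    proof -
      have "2 powr (- 1) \<le> (2::real) powr (-\<bar>p\<bar>)" using p by (intro powr_mono) auto
      also have "\<dots> \<le> y powr (-\<bar>p\<bar>)" using * by (intro powr_mono2') auto
      finally show ?thesis by (simp add: powr_minus_divide)
    qed
    have "m powr p \<le> 4 * (t powr (-\<bar>p\<bar>) * y powr (-\<bar>p\<bar>))"
    proof (cases "0 < p")
      case True
      have "m powr p \<le> 2 powr p" using m2 m0 True by (intro powr_mono2) auto
      also have "\<dots> \<le> 2 powr 1" using p by (intro powr_mono) auto
      also have "\<dots> \<le> 4 * (1 * (1 / 2))" by simp
      also have "\<dots> \<le> 4 * (t powr (-\<bar>p\<bar>) * y powr (-\<bar>p\<bar>))"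
        using tp yp by (intro mult_left_mono mult_mono) auto
      finally show ?thesis .
    next
      case False
      have "m powr p \<le> (y powr (1 / k) * t / 2) powr p"
        using lo False p * by (intro powr_mono2') auto
      also have "\<dots> = y powr (p / k) * t powr p * 2 powr (- p)"
        using * by (simp add: powr_mult powr_divide powr_powr powr_minus_divide)
      also have "\<dots> \<le> (2 * y powr (-\<bar>p\<bar>)) * t powr (-\<bar>p\<bar>) * 2"
      proof (intro mult_mono)
        show "(2::real) powr (- p) \<le> 2"
          using powr_mono[of "- p" 1 2] p by auto
        show "y powr (p / k) \<le> 2 * y powr (-\<bar>p\<bar>)"
        proof (cases "y \<le> 1")
          case True
          have "y powr (p / k) \<le> y powr (-\<bar>p\<bar>)"
            using True * False k p by (intro powr_mono') (auto simp: field_simps)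
          then show ?thesis by (smt (verit) powr_ge_zero)
        next
          case y1: False
          have "y powr (p / k) \<le> y powr 0"
            using y1 * False k by (intro powr_mono) (auto simp: field_simps)
          then show ?thesis using yp y1 by auto
        qed
      qed (use False p in auto)
      finally show ?thesis by (simp add: algebra_simps)
    qed
    moreover have "e (y powr (1 / k) * r) (t * s) \<le> C * m powr p"
      unfolding m_def using * rs by (intro C) auto
    moreover have "C * m powr p \<le> C * (4 * (t powr (-\<bar>p\<bar>) * y powr (-\<bar>p\<bar>)))"
      using C(1) calculation(1) by (intro mult_left_mono) auto
    ultimately show ?thesis
      by (simp add: mult_ac)
  qed
  with C(1) that[of "4 * C"] show ?thesis
    by simp
qed

lemma shell_integrable:
  assumes "0 \<le> r" "0 \<le> s" "max r s = 1" "0 < t" "t \<le> 1" "0 \<le> Y" "Y \<le> 2"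
  shows "set_integrable lborel {0<..Y} (\<lambda>y. e (y powr (1 / k) * r) (t * s))"
proof -
  obtain C where C: "\<And>y. \<lbrakk>0 < y; y \<le> 2\<rbrakk>
      \<Longrightarrow> e (y powr (1 / k) * r) (t * s) \<le> C * t powr (-\<bar>p\<bar>) * y powr (-\<bar>p\<bar>)"
    using e_dominated assms by metis
  show ?thesis
  proof (rule set_integrable_bounded_by)
    show "set_integrable lborel {0<..Y} (\<lambda>y. C * t powr (-\<bar>p\<bar>) * y powr (-\<bar>p\<bar>))"
      using assms p by (intro set_integrable_mult_right set_integrable_powr_from_0) auto
    show "\<bar>e (y powr (1 / k) * r) (t * s)\<bar> \<le> C * t powr (-\<bar>p\<bar>) * y powr (-\<bar>p\<bar>)"
      if "y \<in> {0<..Y}" for y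
      using C[of y] e_nonneg that assms by auto
  qed auto
qed

lemma shell_nonneg: "0 \<le> shell Y r s"
  unfolding shell_def by (rule set_integral_nonneg_real) (rule e_nonneg)

lemma shell_dominated:
  obtains C where "0 < C"
    and "\<And>r s t Y. \<lbrakk>0 \<le> r; 0 \<le> s; max r s = 1; 0 < t; t \<le> 1; 0 \<le> Y; Y \<le> 2\<rbrakk>
           \<Longrightarrow> shell Y r (t * s) \<le> C * t powr (-\<bar>p\<bar>)"
proof -
  obtain C where C: "0 < C" "\<And>r s t y. \<lbrakk>0 \<le> r; 0 \<le> s; max r s = 1; 0 < t; t \<le> 1; 0 < y; y \<le> 2\<rbrakk>
           \<Longrightarrow> e (y powr (1 / k) * r) (t * s) \<le> C * t powr (-\<bar>p\<bar>) * y powr (-\<bar>p\<bar>)"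
    using e_dominated by metis
  define I where "I = (LINT y:{0<..2}|lborel. y powr (-\<bar>p\<bar>))"
  have int: "set_integrable lborel {0<..Y} (\<lambda>y. y powr (-\<bar>p\<bar>))" if "0 \<le> Y" for Y :: real
    using that p by (intro set_integrable_powr_from_0) auto
  have I: "0 \<le> I"
    unfolding I_def by (rule set_integral_nonneg_real) simp
  have "shell Y r (t * s) \<le> (C * (I + 1)) * t powr (-\<bar>p\<bar>)"
    if *: "0 \<le> r" "0 \<le> s" "max r s = 1" "0 < t" "t \<le> 1" "0 \<le> Y" "Y \<le> 2" for r s t Y
  proof -
    have "shell Y r (t * s) \<le> (LINT y:{0<..Y}|lborel. C * t powr (-\<bar>p\<bar>) * y powr (-\<bar>p\<bar>))"
      unfolding shell_def using * C(2)[of r s t] int[of Y]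
      by (intro set_integral_mono shell_integrable) auto
    also have "\<dots> = C * t powr (-\<bar>p\<bar>) * (LINT y:{0<..Y}|lborel. y powr (-\<bar>p\<bar>))"
      by simp
    also have "\<dots> \<le> C * t powr (-\<bar>p\<bar>) * I"
    proof (rule mult_left_mono)
      have "I = (LINT y:{0<..Y}|lborel. y powr (-\<bar>p\<bar>)) + (LINT y:{Y<..2}|lborel. y powr (-\<bar>p\<bar>))"
        unfolding I_def using * int[of 2] by (intro set_integral_Ioc_split) auto
      moreover have "0 \<le> (LINT y:{Y<..2}|lborel. y powr (-\<bar>p\<bar>))"
        by (rule set_integral_nonneg_real) simp
      ultimately show "(LINT y:{0<..Y}|lborel. y powr (-\<bar>p\<bar>)) \<le> I"
        by simp
    qed (use C(1) in auto)
    also have "\<dots> \<le> (C * (I + 1)) * t powr (-\<bar>p\<bar>)"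
      using C(1) by (simp add: algebra_simps)
    finally show ?thesis .
  qed
  with that[of "C * (I + 1)"] C(1) I show ?thesis
    by simp
qed

lemma shell_integrable_outer:
  assumes "0 \<le> r" "0 \<le> s" "max r s = 1"
    and [measurable]: "Y \<in> borel_measurable borel"
    and "\<And>t. 0 < t \<Longrightarrow> t \<le> 1 \<Longrightarrow> 0 \<le> Y t \<and> Y t \<le> 2"
  shows "set_integrable lborel {0<..1} (\<lambda>t. shell (Y t) r (t * s))"
proof -
  obtain C where C: "\<And>t Y. \<lbrakk>0 < t; t \<le> 1; 0 \<le> Y; Y \<le> 2\<rbrakk>
      \<Longrightarrow> shell Y r (t * s) \<le> C * t powr (-\<bar>p\<bar>)"
    using shell_dominated assms(1-3) by metis
  show ?thesis
  proof (rule set_integrable_bounded_by)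
    show "set_integrable lborel {0<..1} (\<lambda>t. C * t powr (-\<bar>p\<bar>))"
      using p by (intro set_integrable_mult_right set_integrable_powr_from_0) auto
    show "\<bar>shell (Y t) r (t * s)\<bar> \<le> C * t powr (-\<bar>p\<bar>)" if "t \<in> {0<..1}" for t
      using C[of t "Y t"] shell_nonneg[of "Y t" r "t * s"] that assms by auto
  qed auto
qed

lemma e_integrable_outer:
  assumes "0 \<le> r" "0 \<le> s" "max r s = 1"
  shows "set_integrable lborel {0<..1} (\<lambda>t. e r (t * s))"
proof -
  obtain C where C: "\<And>t y. \<lbrakk>0 < t; t \<le> 1; 0 < y; y \<le> 2\<rbrakk>
      \<Longrightarrow> e (y powr (1 / k) * r) (t * s) \<le> C * t powr (-\<bar>p\<bar>) * y powr (-\<bar>p\<bar>)"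
    using e_dominated assms by metis
  show ?thesis
  proof (rule set_integrable_bounded_by)
    show "set_integrable lborel {0<..1} (\<lambda>t. C * t powr (-\<bar>p\<bar>))"
      using p by (intro set_integrable_mult_right set_integrable_powr_from_0) auto
    show "\<bar>e r (t * s)\<bar> \<le> C * t powr (-\<bar>p\<bar>)" if "t \<in> {0<..1}" for t
      using C[of t 1] e_nonneg that assms by auto
  qed auto
qed

section \<open>First order effect of moving the lateral surface\<close>

text \<open>Since \<open>\<bar>p / k\<bar> \<le> 1\<close>, the power lies between \<open>y\<close>
  and \<open>1 / y\<close>, and both differ from 1 by at most \<epsilon> in the required
  direction.\<close>

lemma sgn_powr_perturbation:
  assumes "0 < \<epsilon>" "\<epsilon> \<le> 1" "0 < y"
  shows "1 \<le> y \<Longrightarrow> y \<le> 1 + \<epsilon> / 2 \<Longrightarrow> sgn p * y powr (p / k) \<le> sgn p + \<epsilon>"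
    and "y \<le> 1 \<Longrightarrow> 1 - \<epsilon> / 2 \<le> y \<Longrightarrow> sgn p - \<epsilon> \<le> sgn p * y powr (p / k)"
proof -
  have "\<bar>p / k\<bar> \<le> 1"
    using p k by (auto simp: abs_divide divide_le_eq)
  then have pk: "p / k \<le> 1" "- 1 \<le> p / k"
    by (auto simp only: abs_le_iff)
  show "sgn p * y powr (p / k) \<le> sgn p + \<epsilon>" if y: "1 \<le> y" "y \<le> 1 + \<epsilon> / 2"
  proof (cases "0 < p")
    case True
    have "y powr (p / k) \<le> y powr 1"
      using y pk by (intro powr_mono) auto
    then show ?thesis using y True assms by simp
  next
    case False
    have "y powr (- 1) \<le> y powr (p / k)"
      using y pk by (intro powr_mono) auto
    moreover have "1 - \<epsilon> \<le> y powr (- 1)"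
    proof -
      have "(1 - \<epsilon>) * y \<le> (1 - \<epsilon>) * (1 + \<epsilon> / 2)"
        using y assms by (intro mult_left_mono) auto
      also have "\<dots> \<le> 1"
        using assms by (simp add: algebra_simps)
      finally show ?thesis using assms by (simp add: powr_minus_divide field_simps)
    qed
    ultimately show ?thesis using False p by simp
  qed
  show "sgn p - \<epsilon> \<le> sgn p * y powr (p / k)" if y: "y \<le> 1" "1 - \<epsilon> / 2 \<le> y"
  proof (cases "0 < p")
    case True
    have "y powr 1 \<le> y powr (p / k)"
      using y pk assms by (intro powr_mono') auto
    then show ?thesis using y True assms by simp
  next
    case False
    have "y powr (p / k) \<le> y powr (- 1)"
      using y pk assms by (intro powr_mono') auto
    moreover have "y powr (- 1) \<le> 1 + \<epsilon>"
    proof -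
      have "1 \<le> (1 + \<epsilon>) * (1 - \<epsilon> / 2)"
        using assms by (simp add: algebra_simps mult_left_le)
      also have "\<dots> \<le> (1 + \<epsilon>) * y"
        using y assms by (intro mult_left_mono) auto
      finally show ?thesis using assms by (simp add: powr_minus_divide field_simps)
    qed
    ultimately show ?thesis using False p by simp
  qed
qed

text \<open>Homogeneity trades a change of radius by the factor \<open>l\<close> for a factor
  \<open>l powr p\<close> and the new offset \<open>s / l\<close>. Monotonicity in the offset goes
  the favourable way on either side of \<open>y = 1\<close>, so that only the factor has to be
  estimated. The two bounds serve the layers that the tilt adds and removes.\<close>

lemma e_radial_perturbation:
  assumes "0 \<le> r" "0 < r \<or> 0 < s" "0 \<le> s" "0 < \<epsilon>" "\<epsilon> \<le> 1" "0 < y"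
  shows "1 \<le> y \<Longrightarrow> y \<le> 1 + \<epsilon> / 2 \<Longrightarrow>
           sgn p * e (y powr (1 / k) * r) s \<le> (sgn p + \<epsilon>) * e r s"
    and "y \<le> 1 \<Longrightarrow> 1 - \<epsilon> / 2 \<le> y \<Longrightarrow>
           (sgn p - \<epsilon>) * e r s \<le> sgn p * e (y powr (1 / k) * r) s"
proof -
  define l where "l = y powr (1 / k)"
  have l: "0 < l" using assms by (simp add: l_def)
  have lp: "l powr p = y powr (p / k)" by (simp add: l_def powr_powr)
  have e_eq: "e (l * r) s = y powr (p / k) * e r (s / l)"
    using e_hom[of l r "s / l"] l assms by (simp add: lp)
  show "sgn p * e (y powr (1 / k) * r) s \<le> (sgn p + \<epsilon>) * e r s" if y: "1 \<le> y" "y \<le> 1 + \<epsilon> / 2"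
  proof -
    have "1 \<le> l" unfolding l_def using y by (intro ge_one_powr_ge_zero) auto
    then have "sgn p * e r (s / l) \<le> sgn p * e r s"
      using assms l mult_right_mono[of 1 l s] by (intro e_mono) (auto simp: field_simps)
    then have "y powr (p / k) * (sgn p * e r (s / l)) \<le> y powr (p / k) * (sgn p * e r s)"
      by (rule mult_left_mono) simp
    also have "\<dots> = (sgn p * y powr (p / k)) * e r s" by simp
    also have "\<dots> \<le> (sgn p + \<epsilon>) * e r s"
      using sgn_powr_perturbation(1)[of \<epsilon> y] assms y e_nonneg by (intro mult_right_mono) auto
    finally show ?thesis using e_eq by (simp add: l_def mult_ac)
  qed
  show "(sgn p - \<epsilon>) * e r s \<le> sgn p * e (y powr (1 / k) * r) s" if y: "y \<le> 1" "1 - \<epsilon> / 2 \<le> y"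
  proof -
    have "l \<le> 1" unfolding l_def using y assms by (intro powr_le1) auto
    then have "sgn p * e r s \<le> sgn p * e r (s / l)"
      using assms l mult_right_mono[of l 1 s] by (intro e_mono) (auto simp: field_simps)
    then have "y powr (p / k) * (sgn p * e r s) \<le> y powr (p / k) * (sgn p * e r (s / l))"
      by (rule mult_left_mono) simp
    moreover have "(sgn p - \<epsilon>) * e r s \<le> (sgn p * y powr (p / k)) * e r s"
      using sgn_powr_perturbation(2)[of \<epsilon> y] assms y e_nonneg by (intro mult_right_mono) auto
    ultimately show ?thesis using e_eq by (simp add: l_def mult_ac)
  qed
qed

text \<open>At height \<open>t\<close> the tilt adds (\<open>t \<le> 1 / 2\<close>) or removes
  (\<open>t > 1 / 2\<close>) a layer of thickness \<open>\<epsilon> * \<bar>1 / 2 - t\<bar>\<close>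
  in the variable \<open>y\<close>. Replacing the kernel on this layer by its value at
  \<open>y = 1\<close> costs at most a relative \<epsilon>, which is the quadratic term.\<close>

lemma shell_pointwise:
  assumes "0 \<le> r" "0 \<le> s" "max r s = 1" "0 < \<epsilon>" "\<epsilon> \<le> 1" "0 < t" "t \<le> 1"
  shows "sgn p * shell (1 + \<epsilon> * (1 / 2 - t)) r (t * s) \<le>
           sgn p * shell 1 r (t * s) + \<epsilon> * (sgn p * (1 / 2 - t) * e r (t * s))
           + \<epsilon>\<^sup>2 * (\<bar>1 / 2 - t\<bar> * e r (t * s))"
proof -
  define Y where "Y = 1 + \<epsilon> * (1 / 2 - t)"
  have "\<bar>1 / 2 - t\<bar> \<le> 1 / 2"
    unfolding abs_le_iff using assms by linarith
  then have Yb: "\<bar>\<epsilon> * (1 / 2 - t)\<bar> \<le> \<epsilon> * (1 / 2)"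
    unfolding abs_mult using assms by (intro mult_mono) auto
  then have Y: "1 - \<epsilon> / 2 \<le> Y" "Y \<le> 1 + \<epsilon> / 2" "0 < Y" "Y \<le> 2"
    using assms by (auto simp: Y_def abs_le_iff)
  have rs: "0 < r \<or> 0 < t * s" using assms by (auto simp: max_def split: if_splits)
  have pert: "1 \<le> y \<Longrightarrow> y \<le> 1 + \<epsilon> / 2 \<Longrightarrow>
           sgn p * e (y powr (1 / k) * r) (t * s) \<le> (sgn p + \<epsilon>) * e r (t * s)"
       "y \<le> 1 \<Longrightarrow> 1 - \<epsilon> / 2 \<le> y \<Longrightarrow>
           (sgn p - \<epsilon>) * e r (t * s) \<le> sgn p * e (y powr (1 / k) * r) (t * s)" if "0 < y" for y
    using e_radial_perturbation[of r "t * s" \<epsilon> y] assms rs that by auto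
  have int: "set_integrable lborel {0<..a} (\<lambda>y. e (y powr (1 / k) * r) (t * s))"
    if "0 \<le> a" "a \<le> 2" for a
    using assms that by (intro shell_integrable) auto
  have int': "set_integrable lborel {b<..a} (\<lambda>y. e (y powr (1 / k) * r) (t * s))"
    if "0 \<le> b" "0 \<le> a" "a \<le> 2" for a b
    by (rule set_integrable_subset[OF int[of a]]) (use that in auto)
  show ?thesis
  proof (cases "t \<le> 1 / 2")
    case True
    then have Y1: "1 \<le> Y" using assms by (simp add: Y_def)
    have "shell Y r (t * s) = shell 1 r (t * s) + (LINT y:{1<..Y}|lborel. e (y powr (1 / k) * r) (t * s))"
      unfolding shell_def using Y1 Y int by (intro set_integral_Ioc_split) auto
    moreover have "(LINT y:{1<..Y}|lborel. sgn p * e (y powr (1 / k) * r) (t * s))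
        \<le> (LINT y:{1<..Y}|lborel. (sgn p + \<epsilon>) * e r (t * s))"
    proof (rule set_integral_mono)
      show "set_integrable lborel {1<..Y} (\<lambda>y. sgn p * e (y powr (1 / k) * r) (t * s))"
        using Y by (intro set_integrable_mult_right int') auto
    qed (use pert(1) Y in \<open>auto intro: set_integrable_Ioc_const\<close>)
    moreover have "\<dots> = (\<epsilon> * (1 / 2 - t)) * ((sgn p + \<epsilon>) * e r (t * s))"
      using Y1 by (subst set_integral_Ioc_const) (auto simp: Y_def)
    ultimately show ?thesis
      using True by (simp add: Y_def algebra_simps power2_eq_square)
  next
    case False
    then have Y1: "Y \<le> 1" using assms by (simp add: Y_def mult_nonneg_nonpos)
    have "shell 1 r (t * s) = shell Y r (t * s) + (LINT y:{Y<..1}|lborel. e (y powr (1 / k) * r) (t * s))"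
      unfolding shell_def using Y1 Y int by (intro set_integral_Ioc_split) auto
    moreover have "(LINT y:{Y<..1}|lborel. (sgn p - \<epsilon>) * e r (t * s))
        \<le> (LINT y:{Y<..1}|lborel. sgn p * e (y powr (1 / k) * r) (t * s))"
    proof (rule set_integral_mono)
      show "set_integrable lborel {Y<..1} (\<lambda>y. sgn p * e (y powr (1 / k) * r) (t * s))"
        using Y by (intro set_integrable_mult_right int') auto
    qed (use pert(2) Y in \<open>auto intro: set_integrable_Ioc_const\<close>)
    moreover have "(LINT y:{Y<..1}|lborel. (sgn p - \<epsilon>) * e r (t * s))
        = - (\<epsilon> * (1 / 2 - t)) * ((sgn p - \<epsilon>) * e r (t * s))"
      using Y1 by (subst set_integral_Ioc_const) (auto simp: Y_def)
    ultimately show ?thesis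
      using False by (simp add: Y_def algebra_simps power2_eq_square)
  qed
qed

section \<open>Scaling, monotonicity and flattening of cylinders\<close>

lemma shell_hom:
  assumes "0 < c" "0 \<le> r" "0 \<le> s"
  shows "shell Y (c * r) (c * s) = c powr p * shell Y r s"
proof -
  have "e (y powr (1 / k) * (c * r)) (c * s) = c powr p * e (y powr (1 / k) * r) s" for y
    using e_hom[of c "y powr (1 / k) * r" s] assms by (simp add: mult_ac)
  then show ?thesis by (simp add: shell_def)
qed

lemma max_normalize:
  fixes r s :: real
  assumes "0 \<le> r" "0 \<le> s" "0 < r \<or> 0 < s"
  obtains m r' s' where "0 < m" "r = m * r'" "s = m * s'" "0 \<le> r'" "0 \<le> s'" "max r' s' = 1"
proof
  show "0 < max r s" "0 \<le> r / max r s" "0 \<le> s / max r s" using assms by auto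
  then show "r = max r s * (r / max r s)" "s = max r s * (s / max r s)" by auto
  show "max (r / max r s) (s / max r s) = 1"
    using assms by (auto simp: max_def field_simps)
qed

lemma shell_integrable_gen:
  assumes "0 \<le> r" "0 \<le> s" "0 < r \<or> 0 < s" "0 \<le> Y" "Y \<le> 2"
  shows "set_integrable lborel {0<..Y} (\<lambda>y. e (y powr (1 / k) * r) s)"
proof -
  obtain m r' s' where m: "0 < m" "r = m * r'" "s = m * s'" "0 \<le> r'" "0 \<le> s'" "max r' s' = 1"
    using max_normalize assms by metis
  have "set_integrable lborel {0<..Y} (\<lambda>y. m powr p * e (y powr (1 / k) * r') (1 * s'))"
    using m assms by (intro set_integrable_mult_right shell_integrable) auto
  also have "(\<lambda>y. m powr p * e (y powr (1 / k) * r') (1 * s')) = (\<lambda>y. e (y powr (1 / k) * r) s)"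
    using e_hom[of m "_ powr (1 / k) * r'" s'] m by (auto simp: mult_ac)
  finally show ?thesis .
qed

lemma shell_mono:
  assumes "0 \<le> r" "0 \<le> s" "s \<le> s'" "0 < r \<or> 0 < s" "0 \<le> Y" "Y \<le> 2"
  shows "sgn p * shell Y r s \<le> sgn p * shell Y r s'"
proof -
  have "(LINT y:{0<..Y}|lborel. sgn p * e (y powr (1 / k) * r) s)
      \<le> (LINT y:{0<..Y}|lborel. sgn p * e (y powr (1 / k) * r) s')"
    using assms by (intro set_integral_mono set_integrable_mult_right shell_integrable_gen e_mono) auto
  then show ?thesis by (simp add: shell_def)
qed

lemma shell_rescale:
  assumes "0 < R"
  shows "shell (R ^ k) r s = R ^ k * shell 1 (R * r) s"
proof -
  have "(R ^ k * y) powr (1 / k) = R * y powr (1 / k)" if "0 < y" for y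
  proof -
    have "(R ^ k) powr (1 / k) = R"
      using assms k by (simp add: powr_realpow[symmetric] powr_powr)
    then show ?thesis using assms that by (simp add: powr_mult)
  qed
  then have "(LINT y:{0<..1}|lborel. e ((R ^ k * y) powr (1 / k) * r) s)
      = (LINT y:{0<..1}|lborel. e (y powr (1 / k) * (R * r)) s)"
    by (intro set_lebesgue_integral_cong) (auto simp: mult_ac)
  then show ?thesis
    using set_integral_Ioc_scale[of "R ^ k" 1 "\<lambda>y. e (y powr (1 / k) * r) s"] assms
    by (simp add: shell_def)
qed

lemma shell_integrable_outer_gen:
  assumes "0 \<le> r" "0 \<le> s" "0 < r \<or> 0 < s"
    and "Y \<in> borel_measurable borel"
    and "\<And>t. 0 < t \<Longrightarrow> t \<le> 1 \<Longrightarrow> 0 \<le> Y t \<and> Y t \<le> 2"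
  shows "set_integrable lborel {0<..1} (\<lambda>t. shell (Y t) r (t * s))"
proof -
  obtain m r' s' where m: "0 < m" "r = m * r'" "s = m * s'" "0 \<le> r'" "0 \<le> s'" "max r' s' = 1"
    using max_normalize assms(1-3) by metis
  have "set_integrable lborel {0<..1} (\<lambda>t. m powr p * shell (Y t) r' (t * s'))"
    using m assms by (intro set_integrable_mult_right shell_integrable_outer) auto
  also have "?this \<longleftrightarrow> ?thesis"
  proof (rule set_integrable_cong)
    show "m powr p * shell (Y t) r' (t * s') = shell (Y t) r (t * s)" if "t \<in> {0<..1}" for t
      using shell_hom[of m r' "t * s'" "Y t"] m that by (simp add: mult_ac)
  qed auto
  finally show ?thesis .
qed

definition solid :: "real \<Rightarrow> real \<Rightarrow> real" where
  "solid r s = (LINT t:{0<..1}|lborel. shell 1 r (t * s))"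

lemma solid_integrable:
  assumes "0 \<le> r" "0 \<le> s" "0 < r \<or> 0 < s"
  shows "set_integrable lborel {0<..1} (\<lambda>t. shell 1 r (t * s))"
  using assms by (intro shell_integrable_outer_gen) auto

text \<open>Splitting the heights at \<open>j\<close> writes \<open>solid r s\<close> as
  \<open>j * solid r (j * s)\<close> plus an integral over the removed top, where monotonicity
  bounds the shell by its value at height 1. The cost of flattening is thus \<open>1 - j\<close>
  times a difference that is small when the shell hardly varies with its offset.\<close>

lemma solid_contract:
  assumes "0 \<le> r" "0 \<le> s" "0 < r \<or> 0 < s" "0 < j" "j \<le> 1"
  shows "(1 - j) * (sgn p * solid r (j * s) - sgn p * shell 1 r s)
           \<le> sgn p * solid r (j * s) - sgn p * solid r s"
proof -
  have "solid r s = (LINT t:{0<..j}|lborel. shell 1 r (t * s)) + (LINT t:{j<..1}|lborel. shell 1 r (t * s))"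
    unfolding solid_def using assms by (intro set_integral_Ioc_split solid_integrable) auto
  moreover have "(LINT t:{0<..j}|lborel. shell 1 r (t * s)) = j * solid r (j * s)"
    using set_integral_Ioc_scale[of j 1 "\<lambda>t. shell 1 r (t * s)"] assms
    by (simp add: solid_def mult_ac)
  moreover have "(LINT t:{j<..1}|lborel. sgn p * shell 1 r (t * s))
      \<le> (LINT t:{j<..1}|lborel. sgn p * shell 1 r s)"
  proof (rule set_integral_mono)
    have "set_integrable lborel {j<..1} (\<lambda>t. shell 1 r (t * s))"
      by (rule set_integrable_subset[OF solid_integrable[of r s]]) (use assms in auto)
    then show "set_integrable lborel {j<..1} (\<lambda>t. sgn p * shell 1 r (t * s))"
      by simp
    show "sgn p * shell 1 r (t * s) \<le> sgn p * shell 1 r s" if "t \<in> {j<..1}" for t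
      using assms that mult_right_mono[of t 1 s] by (intro shell_mono) auto
  qed (rule set_integrable_Ioc_const)
  moreover have "(LINT t:{j<..1}|lborel. sgn p * shell 1 r s) = (1 - j) * (sgn p * shell 1 r s)"
    using assms by (intro set_integral_Ioc_const) auto
  ultimately show ?thesis
    by (simp add: algebra_simps)
qed

section \<open>The tilting weight \<open>1 / 2 - t\<close> and the gain of tilting\<close>

lemma set_integrable_half_minus: "set_integrable lborel {0<..1} (\<lambda>t::real. 1 / 2 - t)"
  by (rule set_integrable_bounded_by[OF set_integrable_Ioc_const[of 0 1 1]]) (auto simp: abs_le_iff)

text \<open>The vanishing mean is the reason why tilting keeps the volume and why its first order
  effect sees only the variation of the kernel with the height.\<close>

lemma set_integral_half_minus: "(LINT t:{0<..1::real}|lborel. 1 / 2 - t) = 0"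
proof -
  have "AE t in lborel. t \<noteq> (0::real)"
    by (rule AE_lborel_singleton)
  then have "(LINT t:{0<..1::real}|lborel. 1 / 2 - t) = (LINT t:{0..1::real}|lborel. 1 / 2 - t)"
    unfolding set_lebesgue_integral_def
    by (intro integral_cong_AE) (auto elim!: eventually_mono simp: indicator_def)
  also have "\<dots> = (1 / 2 - 1\<^sup>2 / 2) - (0 / 2 - 0\<^sup>2 / 2)"
  proof -
    have "((\<lambda>t. t / 2 - t\<^sup>2 / 2) has_real_derivative 1 / 2 - x) (at x)" for x :: real
      by (auto intro!: derivative_eq_intros)
    then show ?thesis
      using integral_FTC_Icc_real[of 0 1 "\<lambda>t. t / 2 - t\<^sup>2 / 2" "\<lambda>t. 1 / 2 - t"]
      by (auto simp: set_lebesgue_integral_def mult.commute intro!: continuous_intros)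
  qed
  also have "\<dots> = 0" by simp
  finally show ?thesis .
qed

lemma half_weight:
  assumes "t \<in> {0<..1}"
  shows "\<bar>1 / 2 - t\<bar> * e r (t * s) \<le> e r (t * s)"
proof -
  have "\<bar>1 / 2 - t\<bar> \<le> 1" using assms by (auto simp: abs_le_iff)
  from mult_right_mono[OF this e_nonneg[of r "t * s"]] show ?thesis by simp
qed

lemma e_weighted_integrable:
  assumes "0 \<le> r" "0 \<le> s" "max r s = 1"
  shows "set_integrable lborel {0<..1} (\<lambda>t. \<bar>1 / 2 - t\<bar> * e r (t * s))"
    and "set_integrable lborel {0<..1} (\<lambda>t. sgn p * (1 / 2 - t) * e r (t * s))"
  by (rule set_integrable_bounded_by[OF e_integrable_outer[OF assms]];
      use p half_weight[of _ r s] in \<open>auto simp: abs_mult e_nonneg sgn_if\<close>)+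

text \<open>A quantitative Chebyshev inequality: a decreasing weight of mean 0 is integrated against
  an increasing function. Subtracting the value at \<open>1 / 2\<close> makes the integrand
  nonpositive everywhere, and only its contribution from the outer quarters is kept.\<close>

lemma tilt_integral_le:
  assumes "0 \<le> r" "0 \<le> s" "max r s = 1"
  shows "(LINT t:{0<..1}|lborel. sgn p * (1 / 2 - t) * e r (t * s))
           \<le> - (1 / 16) * (sgn p * (e r (3 / 4 * s) - e r (1 / 4 * s)))"
proof -
  let ?f = "\<lambda>t. sgn p * e r (t * s)"
  have rs: "0 < r \<or> 0 < s" using assms by (auto simp: max_def split: if_splits)
  have mono: "?f t \<le> ?f t'" if "0 < t" "t \<le> t'" for t t'
    using that rs assms by (intro e_mono mult_right_mono) auto
  \<comment> \<open>On each outer quarter the weight is at least \<open>1 / 4\<close> in modulus.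
    Together with the length \<open>1 / 4\<close> of the quarter this yields the factor
    \<open>1 / 16\<close>; the two increments telescope to the one between \<open>1 / 4\<close> and
    \<open>3 / 4\<close>.\<close>
  define a where "a = (?f (1 / 2) - ?f (1 / 4)) / 4"
  define b where "b = (?f (3 / 4) - ?f (1 / 2)) / 4"
  let ?g = "\<lambda>t. (1 / 2 - t) * ?f (1 / 2) - (a * indicator {0<..1/4} t + b * indicator {3/4<..1} t)"
  have le: "sgn p * (1 / 2 - t) * e r (t * s) \<le> ?g t" if t: "0 < t" "t \<le> 1" for t
  proof -
    have 1: "(1 / 2 - t) * (?f t - ?f (1 / 2)) \<le> 0"
      using mono[of t "1 / 2"] mono[of "1 / 2" t] t
      by (cases "t \<le> 1 / 2") (auto intro: mult_nonneg_nonpos mult_nonpos_nonneg)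
    have 2: "(1 / 2 - t) * (?f t - ?f (1 / 2)) \<le> - a" if "t \<le> 1 / 4"
    proof -
      have "(1 / 2 - t) * (?f (1 / 2) - ?f t) \<ge> (1 / 4) * (?f (1 / 2) - ?f (1 / 4))"
        using mono[of t "1 / 4"] mono[of "1 / 4" "1 / 2"] t that by (intro mult_mono) auto
      then show ?thesis by (simp add: a_def algebra_simps diff_divide_distrib)
    qed
    have 3: "(1 / 2 - t) * (?f t - ?f (1 / 2)) \<le> - b" if "3 / 4 < t"
    proof -
      have "(t - 1 / 2) * (?f t - ?f (1 / 2)) \<ge> (1 / 4) * (?f (3 / 4) - ?f (1 / 2))"
        using mono[of "3 / 4" t] mono[of "1 / 2" "3 / 4"] t that by (intro mult_mono) auto
      then show ?thesis by (simp add: b_def algebra_simps diff_divide_distrib)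
    qed
    show ?thesis
      using 1 2 3 t by (auto simp: indicator_def algebra_simps)
  qed
  have ia: "set_integrable lborel {0<..1} (indicator {0<..1/4::real} :: real \<Rightarrow> real)"
     and ib: "set_integrable lborel {0<..1} (indicator {3/4<..1::real} :: real \<Rightarrow> real)"
    by (rule set_integrable_bounded_by[OF set_integrable_Ioc_const[of 0 1 1]]; auto simp: indicator_def)+
  have Ia: "(LINT t:{0<..1}|lborel. indicator {0<..1/4::real} t) = (1 / 4 :: real)"
  proof -
    have "indicator {0<..1} t *\<^sub>R (indicator {0<..1/4} t :: real) = indicator {0<..1/4} t" for t :: real
      by (auto simp: indicator_def)
    then show ?thesis unfolding set_lebesgue_integral_def by (simp only:) simp
  qed
  have Ib: "(LINT t:{0<..1}|lborel. indicator {3/4<..1::real} t) = (1 / 4 :: real)"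
  proof -
    have "indicator {0<..1} t *\<^sub>R (indicator {3/4<..1} t :: real) = indicator {3/4<..1} t" for t :: real
      by (auto simp: indicator_def)
    then show ?thesis unfolding set_lebesgue_integral_def by (simp only:) simp
  qed
  have "(LINT t:{0<..1}|lborel. sgn p * (1 / 2 - t) * e r (t * s)) \<le> (LINT t:{0<..1}|lborel. ?g t)"
    using le by (intro set_integral_mono e_weighted_integrable(2)[OF assms] set_integral_diff set_integral_add
                   set_integrable_mult_right set_integrable_mult_left set_integrable_half_minus ia ib) auto
  also have "\<dots> = (LINT t:{0<..1}|lborel. 1 / 2 - t) * ?f (1 / 2) - (a * (1 / 4) + b * (1 / 4))"
    using set_integrable_half_minus ia ib by (simp add: set_integral_diff set_integral_add Ia Ib)
  also have "\<dots> = - (1 / 16) * (sgn p * (e r (3 / 4 * s) - e r (1 / 4 * s)))"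
    unfolding set_integral_half_minus by (simp add: a_def b_def algebra_simps diff_divide_distrib)
  finally show ?thesis .
qed


text \<open>One constant for all normalized directions, so that \<epsilon> can be fixed before the
  direction. Heights shrunk by \<open>j \<ge> 1 / 2\<close> only double the majorant.\<close>

lemma uniform_bounds:
  obtains C where "0 < C"
    and "\<And>r s. \<lbrakk>0 \<le> r; 0 \<le> s; max r s = 1\<rbrakk> \<Longrightarrow> shell 1 r s \<le> C"
    and "\<And>r s j. \<lbrakk>0 \<le> r; 0 \<le> s; max r s = 1; 1 / 2 \<le> j; j \<le> 1\<rbrakk> \<Longrightarrow> solid r (j * s) \<le> C"
    and "\<And>r s. \<lbrakk>0 \<le> r; 0 \<le> s; max r s = 1\<rbrakk>
           \<Longrightarrow> (LINT t:{0<..1}|lborel. \<bar>1 / 2 - t\<bar> * e r (t * s)) \<le> C"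
proof -
  obtain C where C: "0 < C" "\<And>r s t Y. \<lbrakk>0 \<le> r; 0 \<le> s; max r s = 1; 0 < t; t \<le> 1; 0 \<le> Y; Y \<le> 2\<rbrakk>
           \<Longrightarrow> shell Y r (t * s) \<le> C * t powr (-\<bar>p\<bar>)"
    using shell_dominated by metis
  obtain D where D: "0 < D" "\<And>r s t y. \<lbrakk>0 \<le> r; 0 \<le> s; max r s = 1; 0 < t; t \<le> 1; 0 < y; y \<le> 2\<rbrakk>
           \<Longrightarrow> e (y powr (1 / k) * r) (t * s) \<le> D * t powr (-\<bar>p\<bar>) * y powr (-\<bar>p\<bar>)"
    using e_dominated by metis
  define I where "I = (LINT t:{0<..1}|lborel. t powr (-\<bar>p\<bar>))"
  have int: "set_integrable lborel {0<..1} (\<lambda>t::real. t powr (-\<bar>p\<bar>))"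
    using p by (intro set_integrable_powr_from_0) auto
  have I: "0 \<le> I"
    unfolding I_def by (rule set_integral_nonneg_real) simp
  let ?C = "C + (2 * C) * I + D * I"
  have B: "0 \<le> C" "0 \<le> (2 * C) * I" "0 \<le> D * I" using C(1) D(1) I by auto
  show ?thesis
  proof (rule that[of ?C])
    show "0 < ?C" using C(1) B by linarith
    show "shell 1 r s \<le> ?C" if "0 \<le> r" "0 \<le> s" "max r s = 1" for r s
      using C(2)[of r s 1 1] that B by simp
    show "solid r (j * s) \<le> ?C" if *: "0 \<le> r" "0 \<le> s" "max r s = 1" "1 / 2 \<le> j" "j \<le> 1" for r s j
    proof -
      have "solid r (j * s) \<le> (LINT t:{0<..1}|lborel. (2 * C) * t powr (-\<bar>p\<bar>))"
        unfolding solid_def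
      proof (intro set_integral_mono solid_integrable set_integrable_mult_right int)
        show "0 \<le> r" "0 \<le> j * s" "0 < r \<or> 0 < j * s"
          using * by (auto simp: max_def split: if_splits)
        show "shell 1 r (t * (j * s)) \<le> (2 * C) * t powr (-\<bar>p\<bar>)" if t: "t \<in> {0<..1}" for t
        proof -
          have "shell 1 r (t * (j * s)) \<le> C * (t * j) powr (-\<bar>p\<bar>)"
            using C(2)[of r s "t * j" 1] * t by (auto simp: mult_ac mult_le_one)
          also have "\<dots> = C * (t powr (-\<bar>p\<bar>) * j powr (-\<bar>p\<bar>))"
            using t * by (simp add: powr_mult)
          also have "\<dots> \<le> C * (t powr (-\<bar>p\<bar>) * 2)"
          proof (intro mult_left_mono)
            have "j powr (-\<bar>p\<bar>) \<le> j powr (- 1)"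
              using * p by (intro powr_mono') auto
            also have "\<dots> \<le> 2" using * by (simp add: powr_minus_divide field_simps)
            finally show "j powr (-\<bar>p\<bar>) \<le> 2" .
          qed (use C(1) in auto)
          finally show ?thesis by (simp add: mult_ac)
        qed
      qed
      also have "\<dots> = (2 * C) * I" by (simp add: I_def)
      finally show ?thesis using B by linarith
    qed
    show "(LINT t:{0<..1}|lborel. \<bar>1 / 2 - t\<bar> * e r (t * s)) \<le> ?C"
      if *: "0 \<le> r" "0 \<le> s" "max r s = 1" for r s
    proof -
      from e_weighted_integrable(1)[OF *]
      have "(LINT t:{0<..1}|lborel. \<bar>1 / 2 - t\<bar> * e r (t * s)) \<le> (LINT t:{0<..1}|lborel. D * t powr (-\<bar>p\<bar>))"
      proof (rule set_integral_mono)
        show "\<bar>1 / 2 - t\<bar> * e r (t * s) \<le> D * t powr (-\<bar>p\<bar>)" if "t \<in> {0<..1}" for t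
          using half_weight[OF that, of r s] D(2)[of r s t 1] * that by auto
      qed (use int in auto)
      also have "\<dots> = D * I" by (simp add: I_def)
      finally show ?thesis using B by linarith
    qed
  qed
qed

text \<open>The modulus in \<open>e_cont0\<close> degenerates like \<open>1 / r\<close>, but here
  \<open>r\<close> is \<open>y powr (1 / k)\<close>, and \<open>y powr (-(1 / k))\<close> is
  integrable since \<open>k \<ge> 2\<close>. Only one side is estimated; the other is
  monotonicity.\<close>

lemma shell_cont0:
  assumes "0 < \<theta>"
  obtains d where "0 < d" "d \<le> 1"
    and "\<And>s. \<lbrakk>0 \<le> s; s \<le> d\<rbrakk> \<Longrightarrow> sgn p * (shell 1 1 s - shell 1 1 0) \<le> \<theta>"
proof -
  obtain C q where q: "0 < q"
    and C: "\<And>r s. \<lbrakk>0 < r; r \<le> 1; 0 \<le> s\<rbrakk> \<Longrightarrow> sgn p * (e r s - e r 0) \<le> C * s powr q / r"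
    using e_cont0 by blast
  define I where "I = (LINT y:{0<..1}|lborel. y powr (-(1 / k)))"
  have k2: "1 / k \<le> 1 / 2" using k by (simp add: field_simps)
  have int: "set_integrable lborel {0<..1} (\<lambda>y::real. y powr (-(1 / k)))"
    using k2 by (intro set_integrable_powr_from_0) auto
  have I: "0 \<le> I"
    unfolding I_def by (rule set_integral_nonneg_real) simp
  define A where "A = \<bar>C\<bar> * I + 1"
  have A: "0 < A" using I by (simp add: A_def add_nonneg_pos)
  have le: "sgn p * (shell 1 1 s - shell 1 1 0) \<le> A * s powr q" if s: "0 \<le> s" for s
  proof -
    have i: "set_integrable lborel {0<..1} (\<lambda>y. e (y powr (1 / k) * 1) s')" if "0 \<le> s'" for s'
      using that by (intro shell_integrable_gen) auto
    have "sgn p * (shell 1 1 s - shell 1 1 0) =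
        (LINT y:{0<..1}|lborel. sgn p * (e (y powr (1 / k) * 1) s - e (y powr (1 / k) * 1) 0))"
      using i[OF s] i[of 0] by (simp add: shell_def)
    also have "\<dots> \<le> (LINT y:{0<..1}|lborel. (\<bar>C\<bar> * s powr q) * y powr (-(1 / k)))"
    proof (rule set_integral_mono)
      show "set_integrable lborel {0<..1} (\<lambda>y. sgn p * (e (y powr (1 / k) * 1) s - e (y powr (1 / k) * 1) 0))"
        using i[OF s] i[of 0] by (intro set_integrable_mult_right set_integral_diff) auto
      show "sgn p * (e (y powr (1 / k) * 1) s - e (y powr (1 / k) * 1) 0) \<le> \<bar>C\<bar> * s powr q * y powr (-(1 / k))"
        if y: "y \<in> {0<..1}" for y
      proof -
        have "y powr (1 / k) \<le> 1" using y by (intro powr_le1) auto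
        then have "sgn p * (e (y powr (1 / k)) s - e (y powr (1 / k)) 0) \<le> C * s powr q / y powr (1 / k)"
          using C[of "y powr (1 / k)" s] y s by auto
        also have "\<dots> \<le> \<bar>C\<bar> * s powr q / y powr (1 / k)"
          by (intro divide_right_mono mult_right_mono) auto
        finally show ?thesis by (simp add: powr_minus_divide)
      qed
    qed (use int in auto)
    also have "\<dots> = \<bar>C\<bar> * I * s powr q" by (simp add: I_def)
    also have "\<dots> \<le> A * s powr q" by (simp add: A_def algebra_simps)
    finally show ?thesis .
  qed
  define d where "d = min 1 ((\<theta> / A) powr (1 / q))"
  show ?thesis
  proof (rule that[of d])
    show "0 < d" "d \<le> 1" using assms A by (auto simp: d_def)
    show "sgn p * (shell 1 1 s - shell 1 1 0) \<le> \<theta>" if s: "0 \<le> s" "s \<le> d" for s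
    proof -
      have "s powr q \<le> ((\<theta> / A) powr (1 / q)) powr q"
        using s q by (intro powr_mono2) (auto simp: d_def)
      also have "\<dots> = \<theta> / A" using q assms A by (simp add: powr_powr)
      finally have "A * s powr q \<le> A * (\<theta> / A)" using A by (intro mult_left_mono) auto
      with le[OF s(1)] A show ?thesis by simp
    qed
  qed
qed

text \<open>By homogeneity the integrand is \<open>y powr (p / k) * e 1 0\<close>, which is at least
  \<open>y * e 1 0\<close>. This minorant is written as a difference so that its integral can be
  read off from the mean of \<open>1 / 2 - y\<close>.\<close>

lemma shell_pos: "0 < shell 1 1 0"
proof -
  have "(LINT y:{0<..1}|lborel. e 1 0 * 1 - e 1 0 * (1 - y)) \<le> shell 1 1 0"
    unfolding shell_def
  proof (intro set_integral_mono shell_integrable_gen)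
    show "e 1 0 * 1 - e 1 0 * (1 - y) \<le> e (y powr (1 / k) * 1) 0" if y: "y \<in> {0<..1}" for y
    proof -
      have "p / k \<le> 1" using p k by (simp add: divide_le_eq)
      then have "y powr 1 \<le> y powr (p / k)" using y by (intro powr_mono') auto
      then have "y * e 1 0 \<le> y powr (p / k) * e 1 0" using y e_pos by (intro mult_right_mono) auto
      also have "\<dots> = e (y powr (1 / k) * 1) 0"
        using e_hom[of "y powr (1 / k)" 1 0] y by (simp add: powr_powr)
      finally show ?thesis by (simp add: algebra_simps)
    qed
    show "set_integrable lborel {0<..1} (\<lambda>y. e 1 0 * 1 - e 1 0 * (1 - y))"
      by (rule set_integrable_bounded_by[OF set_integrable_Ioc_const[of 0 1 "e 1 0"]])
         (use e_pos in \<open>auto simp: algebra_simps mult_left_le\<close>)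
  qed auto
  moreover have "(LINT y:{0<..1}|lborel. e 1 0 * 1 - e 1 0 * (1 - y)) = e 1 0 * (1 / 2)"
  proof -
    have "(LINT y:{0<..1}|lborel. e 1 0 * 1 - e 1 0 * (1 - y))
       = (LINT y:{0<..1}|lborel. e 1 0 * (1 / 2) - e 1 0 * (1 / 2 - y))"
      by (simp add: algebra_simps)
    also have "\<dots> = (LINT y:{0<..1::real}|lborel. e 1 0 * (1 / 2)) - (LINT y:{0<..1}|lborel. e 1 0 * (1 / 2 - y))"
      by (intro set_integral_diff set_integrable_mult_right set_integrable_half_minus set_integrable_Ioc_const)
    also have "\<dots> = e 1 0 * (1 / 2)"
      by (simp only: set_integral_mult_right set_integral_half_minus) (simp add: set_integral_Ioc_const)
    finally show ?thesis .
  qed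
  ultimately show ?thesis using e_pos by simp
qed

text \<open>The body \<open>\<bar>x\<bar> ^ k \<le> 1 + \<epsilon> * (1 / 2 - \<bar>t\<bar>)\<close>, \<open>\<bar>t\<bar> \<le> 1\<close> has the volume of the cylinder \<open>\<bar>x\<bar> \<le> 1\<close>, \<open>\<bar>t\<bar> \<le> 1\<close>.\<close>

definition tilted :: "real \<Rightarrow> real \<Rightarrow> real \<Rightarrow> real" where
  "tilted \<epsilon> r s = (LINT t:{0<..1}|lborel. shell (1 + \<epsilon> * (1 / 2 - t)) r (t * s))"

lemma tilt_bounds:
  fixes \<epsilon> t :: real
  assumes "0 < \<epsilon>" "\<epsilon> \<le> 1" "0 < t" "t \<le> 1"
  shows "0 \<le> 1 + \<epsilon> * (1 / 2 - t)" "1 + \<epsilon> * (1 / 2 - t) \<le> 2"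
proof -
  have "\<bar>\<epsilon> * (1 / 2 - t)\<bar> \<le> 1 * 1"
    unfolding abs_mult using assms by (intro mult_mono) (auto simp: abs_le_iff)
  then show "0 \<le> 1 + \<epsilon> * (1 / 2 - t)" "1 + \<epsilon> * (1 / 2 - t) \<le> 2"
    by (auto simp: abs_le_iff)
qed

text \<open>A gain of order \<epsilon> against an error of order \<epsilon> squared. The gain
  vanishes at \<open>s = 0\<close>, which forces the later distinction between small and large
  \<open>s\<close>.\<close>

lemma tilted_le:
  assumes "0 \<le> r" "0 \<le> s" "max r s = 1" "0 < \<epsilon>" "\<epsilon> \<le> 1"
  shows "sgn p * tilted \<epsilon> r s \<le> sgn p * solid r s
           - \<epsilon> / 16 * (sgn p * (e r (3 / 4 * s) - e r (1 / 4 * s)))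
           + \<epsilon>\<^sup>2 * (LINT t:{0<..1}|lborel. \<bar>1 / 2 - t\<bar> * e r (t * s))"
proof -
  have rs: "0 < r \<or> 0 < s" using assms by (auto simp: max_def split: if_splits)
  note i1 = e_weighted_integrable(2)[OF assms(1-3)] and i2 = e_weighted_integrable(1)[OF assms(1-3)]
  have i3: "set_integrable lborel {0<..1} (\<lambda>t. shell 1 r (t * s))"
    using assms rs by (intro solid_integrable) auto
  have i4: "set_integrable lborel {0<..1} (\<lambda>t. shell (1 + \<epsilon> * (1 / 2 - t)) r (t * s))"
    using assms rs tilt_bounds by (intro shell_integrable_outer_gen) auto
  have "sgn p * tilted \<epsilon> r s = (LINT t:{0<..1}|lborel. sgn p * shell (1 + \<epsilon> * (1 / 2 - t)) r (t * s))"
    by (simp add: tilted_def)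
  also have "\<dots> \<le> (LINT t:{0<..1}|lborel. sgn p * shell 1 r (t * s) + \<epsilon> * (sgn p * (1 / 2 - t) * e r (t * s))
           + \<epsilon>\<^sup>2 * (\<bar>1 / 2 - t\<bar> * e r (t * s)))"
  proof (rule set_integral_mono)
    show "set_integrable lborel {0<..1} (\<lambda>t. sgn p * shell 1 r (t * s) + \<epsilon> * (sgn p * (1 / 2 - t) * e r (t * s))
           + \<epsilon>\<^sup>2 * (\<bar>1 / 2 - t\<bar> * e r (t * s)))"
      by (intro set_integral_add(1) set_integrable_mult_right i1 i2 i3)
  qed (use shell_pointwise assms i4 in auto)
  also have "\<dots> = sgn p * solid r s + \<epsilon> * (LINT t:{0<..1}|lborel. sgn p * (1 / 2 - t) * e r (t * s))
       + \<epsilon>\<^sup>2 * (LINT t:{0<..1}|lborel. \<bar>1 / 2 - t\<bar> * e r (t * s))"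
  proof -
    have j: "set_integrable lborel {0<..1} (\<lambda>t. sgn p * shell 1 r (t * s))"
         "set_integrable lborel {0<..1} (\<lambda>t. \<epsilon> * (sgn p * (1 / 2 - t) * e r (t * s)))"
         "set_integrable lborel {0<..1} (\<lambda>t. \<epsilon>\<^sup>2 * (\<bar>1 / 2 - t\<bar> * e r (t * s)))"
      by (intro set_integrable_mult_right i1 i2 i3)+
    show ?thesis
      unfolding set_integral_add(2)[OF set_integral_add(1)[OF j(1,2)] j(3)] set_integral_add(2)[OF j(1,2)]
      by (simp only: set_integral_mult_right solid_def)
  qed
  also have "\<epsilon> * (LINT t:{0<..1}|lborel. sgn p * (1 / 2 - t) * e r (t * s))
      \<le> \<epsilon> * (- (1 / 16) * (sgn p * (e r (3 / 4 * s) - e r (1 / 4 * s))))"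
    using assms by (intro mult_left_mono tilt_integral_le) auto
  finally show ?thesis by simp
qed

section \<open>Balancing tilt, radius and height\<close>

text \<open>The linear gain from widening, for both signs of \<open>p\<close> at once. From
  \<open>ln (1 + \<kappa>) \<ge> \<kappa> / 2\<close> the power with exponent
  \<open>\<bar>p\<bar>\<close> gains \<open>\<bar>p\<bar> * \<kappa> / 2\<close>; taking the
  reciprocal for negative \<open>p\<close> loses another factor 2.\<close>

lemma sgn_powr_gain:
  assumes "0 \<le> \<kappa>" "\<kappa> \<le> 1 / 2"
  shows "sgn p + \<bar>p\<bar> / 4 * \<kappa> \<le> sgn p * (1 + \<kappa>) powr p"
proof -
  have "\<kappa> * \<kappa> \<le> \<kappa> * (1 / 2)"
    using assms by (intro mult_left_mono) auto
  then have "\<kappa> / 2 \<le> \<kappa> - \<kappa>\<^sup>2"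
    by (simp add: power2_eq_square)
  also have "\<dots> \<le> ln (1 + \<kappa>)"
    using ln_one_plus_pos_lower_bound[of \<kappa>] assms by simp
  finally have ln: "\<kappa> / 2 \<le> ln (1 + \<kappa>)" .
  have "1 + \<bar>p\<bar> * (\<kappa> / 2) \<le> 1 + \<bar>p\<bar> * ln (1 + \<kappa>)"
    using ln by (intro add_left_mono mult_left_mono) auto
  also have "\<dots> \<le> exp (\<bar>p\<bar> * ln (1 + \<kappa>))" by (rule exp_ge_add_one_self)
  also have "\<dots> = (1 + \<kappa>) powr \<bar>p\<bar>" using assms by (simp add: powr_def)
  finally have up: "1 + \<bar>p\<bar> * (\<kappa> / 2) \<le> (1 + \<kappa>) powr \<bar>p\<bar>" .
  show ?thesis
  proof (cases "0 < p")
    case True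
    have "p * \<kappa> \<ge> 0" using True assms by simp
    with True up show ?thesis by (simp add: field_simps)
  next
    case False
    define x where "x = \<bar>p\<bar> * (\<kappa> / 2)"
    have x: "0 \<le> x" "x \<le> 1"
      using assms p mult_mono[of "\<bar>p\<bar>" 1 "\<kappa> / 2" 1] by (auto simp: x_def)
    have "(1 + \<kappa>) powr p = 1 / (1 + \<kappa>) powr \<bar>p\<bar>"
      using False by (simp add: powr_minus_divide[symmetric])
    also have "\<dots> \<le> 1 / (1 + x)"
      using up x assms by (intro divide_left_mono) (auto simp: x_def intro!: mult_pos_pos add_pos_nonneg)
    also have "\<dots> \<le> 1 - x / 2"
    proof -
      have "1 \<le> (1 - x / 2) * (1 + x)"
        using x mult_left_le[of x x] by (simp add: algebra_simps)
      then show ?thesis using x by (simp add: divide_le_eq)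
    qed
    finally show ?thesis using False p by (simp add: x_def)
  qed
qed

text \<open>
  The cylinder of radius \<open>R = 1 + \<kappa>\<close> and half-height \<open>R * j\<close> with \<open>\<kappa>\<close> of order \<open>\<epsilon>\<^sup>2\<close> is compared with
  the tilted body. For directions close to the base hyperplane (\<open>s\<close> small) the first order gain
  of tilting degenerates, but there the larger radius wins against all terms of order \<open>\<epsilon>\<^sup>2\<close>; for
  the other directions the gain is at least a fixed multiple of \<open>\<epsilon>\<close>.
\<close>

lemma comparison_normalized:
  obtains \<epsilon> R j where "0 < \<epsilon>" "\<epsilon> \<le> 1" "1 \<le> R" "1 / 2 \<le> j" "R ^ Suc k * j < 1"
    and "\<And>r s. \<lbrakk>0 \<le> r; 0 \<le> s; max r s = 1\<rbrakk>
           \<Longrightarrow> sgn p * tilted \<epsilon> r s \<le> sgn p * (R powr p * solid r (j * s))"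
proof -
  obtain C where C: "0 < C"
    and C1: "\<And>r s. \<lbrakk>0 \<le> r; 0 \<le> s; max r s = 1\<rbrakk> \<Longrightarrow> shell 1 r s \<le> C"
    and C2: "\<And>r s j. \<lbrakk>0 \<le> r; 0 \<le> s; max r s = 1; 1 / 2 \<le> j; j \<le> 1\<rbrakk> \<Longrightarrow> solid r (j * s) \<le> C"
    and C3: "\<And>r s. \<lbrakk>0 \<le> r; 0 \<le> s; max r s = 1\<rbrakk>
           \<Longrightarrow> (LINT t:{0<..1}|lborel. \<bar>1 / 2 - t\<bar> * e r (t * s)) \<le> C"
    by (rule uniform_bounds) blast
  define n where "n = real (Suc k)"
  have n: "1 \<le> n" by (simp add: n_def)
  define q where "q = shell 1 1 0"
  have q: "0 < q" using shell_pos by (simp add: q_def)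
  define a where "a = \<bar>p\<bar> / 4"
  have a: "0 < a" using p by (simp add: a_def)
  \<comment> \<open>Tolerance for the variation of the shell near \<open>s = 0\<close>. The first
    bound keeps the loss by flattening, \<open>n * \<kappa> * \<theta>\<close>, below half of the
    gain \<open>a * \<kappa> * (q / 2)\<close> from widening; the second keeps the shells above
    \<open>q / 2\<close> when \<open>p\<close> is negative.\<close>
  define \<theta> where "\<theta> = min (a * q / (4 * n)) (q / 2)"
  have \<theta>: "0 < \<theta>" "n * \<theta> \<le> a * q / 4" "\<theta> \<le> q / 2"
  proof -
    show "0 < \<theta>" "\<theta> \<le> q / 2" using a q n by (auto simp: \<theta>_def)
    have "n * \<theta> \<le> n * (a * q / (4 * n))" using n by (intro mult_left_mono) (auto simp: \<theta>_def)
    then show "n * \<theta> \<le> a * q / 4" using n by simp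
  qed
  obtain d where d: "0 < d" "d \<le> 1"
    and d': "\<And>s. \<lbrakk>0 \<le> s; s \<le> d\<rbrakk> \<Longrightarrow> sgn p * (shell 1 1 s - shell 1 1 0) \<le> \<theta>"
    by (rule shell_cont0[OF \<theta>(1)]) blast
  obtain c where c: "0 < c"
    and c': "\<And>r s. \<lbrakk>0 \<le> r; d \<le> s; max r s = 1\<rbrakk> \<Longrightarrow> c \<le> sgn p * (e r (3 / 4 * s) - e r (1 / 4 * s))"
    using e_gap[OF d(1)] by blast
  \<comment> \<open>With \<open>\<kappa> = M * \<epsilon>\<^sup>2\<close> the quadratic error
    \<open>\<epsilon>\<^sup>2 * C\<close> of tilting equals the other half of the gain from
    widening.\<close>
  define M where "M = 4 * C / (a * q)"
  have M: "0 < M" using C a q by (simp add: M_def)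
  \<comment> \<open>The bound \<open>1 / (2 * n * M)\<close> yields
    \<open>n * \<kappa> \<le> 1 / 2\<close>, hence \<open>j \<ge> 1 / 2\<close>. The last bound
    makes all quadratic terms smaller than the gain \<open>\<epsilon> / 16 * c\<close> for
    directions with \<open>s \<ge> d\<close>.\<close>
  define \<epsilon> where "\<epsilon> = min (min 1 (1 / (2 * n * M))) (c / (16 * (2 * n * M * C + C)))"
  have nMC: "0 < 2 * n * M * C + C" using n M C by (intro add_pos_pos mult_pos_pos) auto
  have \<epsilon>: "0 < \<epsilon>" "\<epsilon> \<le> 1" "\<epsilon> \<le> 1 / (2 * n * M)" "\<epsilon> \<le> c / (16 * (2 * n * M * C + C))"
    using c nMC n M by (auto simp: \<epsilon>_def)
  define \<kappa> where "\<kappa> = M * \<epsilon>\<^sup>2"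
  have \<kappa>0: "0 < \<kappa>" using M \<epsilon> by (simp add: \<kappa>_def)
  have n\<kappa>: "n * \<kappa> \<le> 1 / 2"
  proof -
    have "\<epsilon>\<^sup>2 \<le> \<epsilon>" using \<epsilon> by (simp add: power2_eq_square mult_left_le)
    also have "\<dots> \<le> 1 / (2 * n * M)" by (rule \<epsilon>)
    finally have "(n * M) * \<epsilon>\<^sup>2 \<le> (n * M) * (1 / (2 * n * M))"
      using n M by (intro mult_left_mono) auto
    then show ?thesis using n M by (simp add: \<kappa>_def)
  qed
  have \<kappa>1: "\<kappa> \<le> 1 / 2" using n\<kappa> n \<kappa>0 mult_right_mono[of 1 n \<kappa>] by linarith
  define R where "R = 1 + \<kappa>"
  \<comment> \<open>To first order the reciprocal of \<open>R ^ n\<close>. By Bernoulli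
    \<open>j \<le> (1 - \<kappa>) ^ n\<close>, so \<open>R ^ n * j\<close> is at most
    \<open>(1 - \<kappa>\<^sup>2) ^ n\<close>, which is strictly below 1.\<close>
  define j where "j = 1 - n * \<kappa>"
  have j: "1 / 2 \<le> j" "j \<le> 1" using n\<kappa> n \<kappa>0 by (auto simp: j_def)
  have R: "1 \<le> R" using \<kappa>0 by (simp add: R_def)
  have vol: "R ^ Suc k * j < 1"
  proof -
    have "1 + real (Suc k) * (- \<kappa>) \<le> (1 + - \<kappa>) ^ Suc k"
      using \<kappa>1 by (intro Bernoulli_inequality) auto
    then have "R ^ Suc k * j \<le> R ^ Suc k * (1 - \<kappa>) ^ Suc k"
      using R by (intro mult_left_mono) (auto simp: j_def n_def)
    also have "\<dots> = (1 - \<kappa>\<^sup>2) ^ Suc k"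
    proof -
      have "R * (1 - \<kappa>) = 1 - \<kappa>\<^sup>2"
        by (simp add: R_def algebra_simps power2_eq_square)
      then show ?thesis by (simp only: power_mult_distrib[symmetric])
    qed
    also have "\<dots> < 1"
    proof -
      have "0 < \<kappa>\<^sup>2" "\<kappa>\<^sup>2 \<le> 1" using \<kappa>0 \<kappa>1 by (auto simp: abs_square_le_1)
      then show ?thesis by (intro power_less_one_iff[THEN iffD2]) auto
    qed
    finally show ?thesis .
  qed
  have main: "sgn p * tilted \<epsilon> r s \<le> sgn p * (R powr p * solid r (j * s))"
    if rs: "0 \<le> r" "0 \<le> s" "max r s = 1" for r s
  proof -
    have rs': "0 < r \<or> 0 < s" using rs by (auto simp: max_def split: if_splits)
    define g where "g = sgn p * (e r (3 / 4 * s) - e r (1 / 4 * s))"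
    have g0: "0 \<le> g"
      using e_mono[of r "1 / 4 * s" "3 / 4 * s"] rs rs' by (auto simp: g_def algebra_simps)
    have T: "sgn p * tilted \<epsilon> r s \<le> sgn p * solid r s - \<epsilon> / 16 * g + \<epsilon>\<^sup>2 * C"
    proof -
      have "\<epsilon>\<^sup>2 * (LINT t:{0<..1}|lborel. \<bar>1 / 2 - t\<bar> * e r (t * s)) \<le> \<epsilon>\<^sup>2 * C"
        using C3 rs by (intro mult_left_mono) auto
      with tilted_le[OF rs \<epsilon>(1,2)] show ?thesis unfolding g_def by linarith
    qed
    define G where "G = solid r (j * s)"
    have G0: "0 \<le> G"
      unfolding G_def solid_def by (rule set_integral_nonneg_real) (rule shell_nonneg)
    have gain: "sgn p * G + a * \<kappa> * G \<le> sgn p * (R powr p * G)"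
      using mult_right_mono[OF sgn_powr_gain[of \<kappa>] G0] \<kappa>0 \<kappa>1
      by (simp add: R_def a_def algebra_simps)
    have contract: "(n * \<kappa>) * (sgn p * G - sgn p * shell 1 r s) \<le> sgn p * G - sgn p * solid r s"
      using solid_contract[of r s j] rs rs' j by (simp add: G_def j_def)
    show ?thesis
    proof (cases "s < d")
      case True
      then have r1: "r = 1" using rs d by (auto simp: max_def split: if_splits)
      have near: "q / 2 \<le> shell 1 r (t * (j * s))" "sgn p * q \<le> sgn p * shell 1 r (t * (j * s))"
        if t: "t \<in> {0<..1}" for t
      proof -
        have "t * (j * s) \<le> j * s"
          using mult_right_mono[of t 1 "j * s"] t j rs by simp
        moreover have "j * s \<le> s"
          using mult_right_mono[of j 1 s] j rs by simp
        ultimately have *: "0 \<le> t * (j * s)" "t * (j * s) \<le> s"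
          using t j rs by (simp, linarith)
        show 1: "sgn p * q \<le> sgn p * shell 1 r (t * (j * s))"
          unfolding q_def r1 using * by (intro shell_mono) auto
        have "sgn p * (shell 1 1 (t * (j * s)) - q) \<le> \<theta>"
          unfolding q_def using * True by (intro d') auto
        moreover have "sgn p = 1 \<or> sgn p = - 1" using p by (simp add: sgn_if)
        ultimately show "q / 2 \<le> shell 1 r (t * (j * s))"
          using 1 \<theta>(3) q unfolding r1 by auto
      qed
      have js: "0 \<le> j * s" using j rs by simp
      have int: "set_integrable lborel {0<..1} (\<lambda>t. shell 1 r (t * (j * s)))"
        using js r1 by (intro solid_integrable) auto
      have "(LINT t:{0<..1::real}|lborel. q / 2) \<le> G"
        unfolding G_def solid_def
        by (intro set_integral_mono set_integrable_Ioc_const int near)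
      then have Gq: "q / 2 \<le> G" by (simp add: set_integral_Ioc_const)
      have "(LINT t:{0<..1::real}|lborel. sgn p * q) \<le> (LINT t:{0<..1}|lborel. sgn p * shell 1 r (t * (j * s)))"
        by (intro set_integral_mono set_integrable_Ioc_const set_integrable_mult_right int near)
      then have "sgn p * q \<le> sgn p * G" by (simp add: set_integral_Ioc_const G_def solid_def)
      moreover have "sgn p * shell 1 r s \<le> sgn p * q + \<theta>"
        using d'[of s] rs True by (simp add: q_def r1 algebra_simps)
      ultimately have "- \<theta> \<le> sgn p * G - sgn p * shell 1 r s" by linarith
      then have "(n * \<kappa>) * (- \<theta>) \<le> (n * \<kappa>) * (sgn p * G - sgn p * shell 1 r s)"
        using n \<kappa>0 by (intro mult_left_mono) auto
      then have 1: "- ((n * \<kappa>) * \<theta>) \<le> sgn p * G - sgn p * solid r s"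
        using contract by linarith
      have 2: "a * \<kappa> * (q / 2) \<le> a * \<kappa> * G" using Gq a \<kappa>0 by (intro mult_left_mono) auto
      have 3: "(n * \<kappa>) * \<theta> \<le> \<kappa> * (a * q / 4)"
        using mult_left_mono[OF \<theta>(2), of \<kappa>] \<kappa>0 by (simp add: mult_ac)
      have 4: "\<epsilon>\<^sup>2 * C = \<kappa> * (a * q / 4)"
        using a q by (simp add: \<kappa>_def M_def)
      have 5: "0 \<le> \<epsilon> / 16 * g" using g0 \<epsilon> by simp
      have 6: "a * \<kappa> * (q / 2) = \<kappa> * (a * q / 4) + \<kappa> * (a * q / 4)" by simp
      show ?thesis using T gain 1 2 3 4 5 6 unfolding G_def by linarith
    next
      case False
      have "c \<le> g" using c'[of r s] rs False by (simp add: g_def)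
      then have g1: "\<epsilon> / 16 * c \<le> \<epsilon> / 16 * g" using \<epsilon> by (intro mult_left_mono) auto
      have "sgn p = 1 \<or> sgn p = - 1" using p by (simp add: sgn_if)
      moreover have "G \<le> C" "shell 1 r s \<le> C" "0 \<le> shell 1 r s"
        using C1[OF rs] C2[OF rs j] shell_nonneg unfolding G_def by auto
      ultimately have "- (2 * C) \<le> sgn p * G - sgn p * shell 1 r s"
        using G0 C by (elim disjE; simp; linarith?)
      then have "(n * \<kappa>) * (- (2 * C)) \<le> (n * \<kappa>) * (sgn p * G - sgn p * shell 1 r s)"
        using n \<kappa>0 by (intro mult_left_mono) auto
      moreover have "(n * \<kappa>) * (- (2 * C)) = - (2 * n * \<kappa> * C)" by simp
      ultimately have 1: "- (2 * n * \<kappa> * C) \<le> sgn p * G - sgn p * solid r s"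
        using contract by linarith
      have 2: "0 \<le> a * \<kappa> * G" using a \<kappa>0 G0 by simp
      have 3: "2 * n * \<kappa> * C + \<epsilon>\<^sup>2 * C \<le> \<epsilon> / 16 * c"
      proof -
        define X where "X = 2 * n * M * C + C"
        have "2 * n * \<kappa> * C + \<epsilon>\<^sup>2 * C = \<epsilon> * (\<epsilon> * X)"
          by (simp add: \<kappa>_def X_def power2_eq_square algebra_simps)
        also have "\<epsilon> * X \<le> c / 16"
          using \<epsilon>(4) nMC unfolding X_def[symmetric] by (simp add: pos_le_divide_eq)
        then have "\<epsilon> * (\<epsilon> * X) \<le> \<epsilon> * (c / 16)"
          using \<epsilon>(1) by (intro mult_left_mono) auto
        finally show ?thesis by simp
      qed
      show ?thesis using T gain 1 2 3 g1 unfolding G_def by linarith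
    qed
  qed
  show ?thesis
    by (rule that[OF \<epsilon>(1,2) R j(1) vol main])
qed

text \<open>The final cylinder is the dilation by \<open>R\<close> of the one with radius 1 and
  half-height \<open>j\<close>, so \<open>H = R * j\<close>, and its average carries the factor
  \<open>R powr p\<close>. Dividing by \<open>R ^ k * H\<close> normalizes by the volume;
  \<open>tilted\<close> is already normalized, since tilting keeps the volume of the unit cylinder.
  Homogeneity removes the condition \<open>max r s = 1\<close>.\<close>

theorem comparison:
  obtains \<epsilon> R H where "0 < \<epsilon>" "\<epsilon> \<le> 1" "0 < R" "R ^ k \<le> 2" "0 < H" "H \<le> 1" "R ^ k * H < 1"
    and "\<And>r s. \<lbrakk>0 \<le> r; 0 \<le> s; 0 < r \<or> 0 < s\<rbrakk>
           \<Longrightarrow> sgn p * tilted \<epsilon> r s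
               \<le> sgn p * ((LINT t:{0<..H}|lborel. shell (R ^ k) r (t * s)) / (R ^ k * H))"
proof -
  obtain \<epsilon> R j where \<epsilon>: "0 < \<epsilon>" "\<epsilon> \<le> 1" and Rj: "1 \<le> R" "1 / 2 \<le> j" "R ^ Suc k * j < 1"
    and le: "\<And>r s. \<lbrakk>0 \<le> r; 0 \<le> s; max r s = 1\<rbrakk>
           \<Longrightarrow> sgn p * tilted \<epsilon> r s \<le> sgn p * (R powr p * solid r (j * s))"
    by (rule comparison_normalized) blast
  have *: "0 < R" "0 < j" using Rj by linarith+
  have "sgn p * tilted \<epsilon> r s
           \<le> sgn p * ((LINT t:{0<..R * j}|lborel. shell (R ^ k) r (t * s)) / (R ^ k * (R * j)))"
    if rs: "0 \<le> r" "0 \<le> s" "0 < r \<or> 0 < s" for r s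
  proof -
    have "(LINT t:{0<..R * j}|lborel. shell (R ^ k) r (t * s))
        = R * j * (LINT t:{0<..1}|lborel. shell (R ^ k) r (R * j * t * s))"
      using set_integral_Ioc_scale[of "R * j" 1 "\<lambda>t. shell (R ^ k) r (t * s)"] * by simp
    also have "(LINT t:{0<..1}|lborel. shell (R ^ k) r (R * j * t * s))
        = (LINT t:{0<..1}|lborel. R ^ k * (R powr p * shell 1 r (t * (j * s))))"
    proof (rule set_lebesgue_integral_cong)
      show "\<forall>t. t \<in> {0<..1} \<longrightarrow> shell (R ^ k) r (R * j * t * s) = R ^ k * (R powr p * shell 1 r (t * (j * s)))"
        using shell_rescale[of R r] shell_hom[of R r "_ * (j * s)" 1] * rs by (simp add: mult_ac)
    qed simp
    also have "\<dots> = R ^ k * (R powr p * solid r (j * s))"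
      by (simp add: solid_def)
    finally have K: "(LINT t:{0<..R * j}|lborel. shell (R ^ k) r (t * s)) / (R ^ k * (R * j)) = R powr p * solid r (j * s)"
      using * by simp
    obtain m r' s' where m: "0 < m" "r = m * r'" "s = m * s'" "0 \<le> r'" "0 \<le> s'" "max r' s' = 1"
      using max_normalize rs by metis
    have t: "tilted \<epsilon> r s = m powr p * tilted \<epsilon> r' s'"
    proof -
      have "tilted \<epsilon> r s = (LINT t:{0<..1}|lborel. m powr p * shell (1 + \<epsilon> * (1 / 2 - t)) r' (t * s'))"
        unfolding tilted_def m(2,3)
        using shell_hom[of m r' "_ * s'"] m by (intro set_lebesgue_integral_cong) (auto simp: mult_ac)
      then show ?thesis by (simp add: tilted_def)
    qed
    have g: "solid r (j * s) = m powr p * solid r' (j * s')"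
    proof -
      have "solid r (j * s) = (LINT t:{0<..1}|lborel. m powr p * shell 1 r' (t * (j * s')))"
        unfolding solid_def m(2,3)
        using shell_hom[of m r' "_ * (j * s')" 1] m * by (intro set_lebesgue_integral_cong) (auto simp: mult_ac)
      then show ?thesis by (simp add: solid_def)
    qed
    have "m powr p * (sgn p * tilted \<epsilon> r' s') \<le> m powr p * (sgn p * (R powr p * solid r' (j * s')))"
      using m by (intro mult_left_mono[OF le]) auto
    then show ?thesis unfolding K t g by (simp add: mult_ac)
  qed
  moreover have "R ^ k \<le> 2"
  proof -
    have "R ^ k * (1 / 2) \<le> R ^ Suc k * j"
      using Rj * by (intro mult_mono power_increasing) auto
    then show ?thesis using Rj by linarith
  qed
  moreover have "R * j \<le> 1"
  proof -
    have "R ^ 1 * j \<le> R ^ Suc k * j"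
      using Rj * by (intro mult_right_mono power_increasing) auto
    then show ?thesis using Rj(3) unfolding power_one_right by linarith
  qed
  moreover have "0 < R * j" "R ^ k * (R * j) < 1" using * Rj by (auto simp: mult_ac)
  ultimately show ?thesis
    using that[of \<epsilon> R "R * j"] \<epsilon> *(1) by blast
qed

end

section \<open>The kernel of the circle\<close>

text \<open>After division by \<open>x + y\<close> this is \<open>z \<le> z powr q\<close> on the
  unit interval, applied to two numbers with sum 1.\<close>

lemma powr_subadditive:
  fixes x y q :: real
  assumes "0 < q" "q \<le> 1" "0 \<le> x" "0 \<le> y"
  shows "(x + y) powr q \<le> x powr q + y powr q"
proof (cases "x + y = 0")
  case True
  then show ?thesis using assms by simp
next
  case False
  then have s: "0 < x + y" using assms by simp
  have *: "z / (x + y) \<le> (z / (x + y)) powr q" if "0 \<le> z" "z \<le> x + y" for z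
    using powr_mono'[of q 1 "z / (x + y)"] assms that s by (auto simp: divide_le_eq)
  have "1 = x / (x + y) + y / (x + y)"
    using s by (simp add: add_divide_distrib[symmetric])
  also have "\<dots> \<le> (x / (x + y)) powr q + (y / (x + y)) powr q"
    using assms by (intro add_mono *) auto
  also have "\<dots> = (x powr q + y powr q) / (x + y) powr q"
    using s assms by (simp add: powr_divide add_divide_distrib)
  finally show ?thesis
    using s by (simp add: le_divide_eq)
qed

lemma abs_powr_subadditive:
  fixes x y q :: real
  assumes "0 < q" "q \<le> 1"
  shows "\<bar>x + y\<bar> powr q \<le> \<bar>x\<bar> powr q + \<bar>y\<bar> powr q"
proof -
  have "\<bar>x + y\<bar> powr q \<le> (\<bar>x\<bar> + \<bar>y\<bar>) powr q"
    using assms by (intro powr_mono2) auto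
  also have "\<dots> \<le> \<bar>x\<bar> powr q + \<bar>y\<bar> powr q"
    using assms by (intro powr_subadditive) auto
  finally show ?thesis .
qed

lemma integral_periodic_shift:
  fixes f :: "real \<Rightarrow> real"
  assumes cont: "continuous_on UNIV f" and per: "\<And>x. f (x + T) = f x" and "0 \<le> T"
  shows "integral {a..a + T} f = integral {b..b + T} f"
proof -
  have int: "f integrable_on {u..v}" for u v
    by (intro integrable_continuous_interval continuous_on_subset[OF cont]) auto
  have shift: "integral {u..v} f = integral {u + T..v + T} f" for u v
    using integral_shift_Icc_real[of u v f T] per by (simp add: o_def add.commute)
  have "integral {a..a + T} f = integral {b..b + T} f" if "a \<le> b" for a b
  proof (cases "b \<le> a + T")
    case True
    have "integral {a..b} f + integral {b..a + T} f = integral {a..a + T} f"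
      using that True by (intro Henstock_Kurzweil_Integration.integral_combine int) auto
    moreover have "integral {b..a + T} f + integral {a + T..b + T} f = integral {b..b + T} f"
      using that True by (intro Henstock_Kurzweil_Integration.integral_combine int) auto
    ultimately show ?thesis using shift[of a b] by simp
  next
    case False
    have "integral {a..a + T} f + integral {a + T..b + T} f = integral {a..b + T} f"
      using that False \<open>0 \<le> T\<close> by (intro Henstock_Kurzweil_Integration.integral_combine int) auto
    moreover have "integral {a..b} f + integral {b..b + T} f = integral {a..b + T} f"
      using that False \<open>0 \<le> T\<close> by (intro Henstock_Kurzweil_Integration.integral_combine int) auto
    ultimately show ?thesis using shift[of a b] by simp
  qed
  from this[of a b] this[of b a] show ?thesis by linarith
qed

lemma continuous_on_abs_powr [continuous_intros]:
  fixes f :: "'a::topological_space \<Rightarrow> real"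
  assumes "0 < q" "continuous_on S f"
  shows "continuous_on S (\<lambda>x. \<bar>f x\<bar> powr q)"
  using assms by (intro continuous_on_powr' continuous_intros) auto

text \<open>
  Polarization: with \<open>h x = \<bar>cos (x / 2)\<bar>\<close>, the difference of the two integrals is the integral over a
  half period of a product of two differences that have the same sign, because the reflection
  \<open>x \<mapsto> a + b - x\<close> exchanges \<open>h (x - a)\<close> with \<open>h (x - b)\<close>.
\<close>

lemma half_cos_autocorrelation_strict:
  fixes q :: real
  assumes q: "0 < q" and ab: "0 \<le> a" "a < b" "b \<le> pi"
  defines "h \<equiv> \<lambda>x::real. \<bar>cos (x / 2)\<bar> powr q"
  shows "integral {-pi..pi} (\<lambda>x. h x * h (x - b)) < integral {-pi..pi} (\<lambda>x. h x * h (x - a))"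
proof -
  let ?R = "\<lambda>c. integral {-pi..pi} (\<lambda>x. h x * h (x - c))"
  define m where "m = (a + b) / 2"
  have m: "0 < m" "m < pi" "2 * m = a + b" using ab by (auto simp: m_def)
  have hc: "continuous_on S (\<lambda>x. h (f x))" if "continuous_on S f" for S :: "real set" and f
    unfolding h_def using q that by (intro continuous_intros) auto
  have hper: "h (x + 2 * pi) = h x" for x
  proof -
    have "(x + 2 * pi) / 2 = x / 2 + pi" by simp
    then show ?thesis unfolding h_def by (simp only: cos_periodic_pi abs_minus_cancel)
  qed
  have heven: "h (- x) = h x" for x by (simp add: h_def)
  \<comment> \<open>Periodicity recentres the window at \<open>m\<close>, so that the reflection in
    \<open>m\<close> maps it to itself.\<close>
  have move: "?R c = integral {m - pi..m + pi} (\<lambda>x. h x * h (x - c))" for c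
  proof -
    have "h (x + 2 * pi - c) = h (x - c)" for x
      using hper[of "x - c"] by (simp add: algebra_simps)
    then have "integral {-pi..-pi + 2 * pi} (\<lambda>x. h x * h (x - c))
        = integral {m - pi..m - pi + 2 * pi} (\<lambda>x. h x * h (x - c))"
      using hper by (intro integral_periodic_shift continuous_intros hc) auto
    then show ?thesis by (simp add: algebra_simps)
  qed
  define F where "F = (\<lambda>x. h x * (h (x - a) - h (x - b)))"
  define P where "P = (\<lambda>x. (h x - h (2 * m - x)) * (h (x - a) - h (x - b)))"
  have Fint: "F integrable_on {u..v}" for u v
    unfolding F_def by (intro integrable_continuous_interval continuous_intros hc)
  have Pcont: "continuous_on S P" for S
    unfolding P_def by (intro continuous_intros hc)
  \<comment> \<open>The right half of the window is folded onto the left one; adding the two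
    integrands yields the product \<open>P\<close>.\<close>
  have refl: "integral {m..m + pi} F = integral {m - pi..m} (\<lambda>x. F (2 * m - x))"
  proof -
    have "integral {m - pi..m} (\<lambda>x. F (2 * m - x)) = integral {-(m + pi) + 2 * m.. - m + 2 * m} (\<lambda>x. F (2 * m - x))"
      by (simp add: algebra_simps)
    also have "\<dots> = integral {-(m + pi)..- m} ((\<lambda>x. F (2 * m - x)) \<circ> (+) (2 * m))"
      by (rule integral_shift_Icc_real[symmetric])
    also have "\<dots> = integral {-(m + pi)..- m} (\<lambda>x. F (- x))" by (simp add: o_def)
    also have "\<dots> = integral {m..m + pi} F"
      by (rule Henstock_Kurzweil_Integration.integral_reflect_real)
    finally show ?thesis by simp
  qed
  have FP: "F x + F (2 * m - x) = P x" for x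
  proof -
    have "h (2 * m - x - a) = h (x - b)" "h (2 * m - x - b) = h (x - a)"
      using heven[of "x - b"] heven[of "x - a"] m by (simp_all add: algebra_simps)
    then show ?thesis by (simp add: F_def P_def algebra_simps)
  qed
  have eq: "?R a - ?R b = integral {m - pi..m} P"
  proof -
    have "?R a - ?R b
        = integral {m - pi..m + pi} (\<lambda>x. h x * h (x - a) - h x * h (x - b))"
      unfolding move
      by (rule integral_diff[symmetric]; intro integrable_continuous_interval continuous_intros hc)
    also have "\<dots> = integral {m - pi..m + pi} F" by (simp add: F_def algebra_simps)
    also have "\<dots> = integral {m - pi..m} F + integral {m..m + pi} F"
      by (rule Henstock_Kurzweil_Integration.integral_combine[symmetric]) (auto intro: Fint)
    also have "\<dots> = integral {m - pi..m} (\<lambda>x. F x + F (2 * m - x))"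
      unfolding refl by (rule integral_add[symmetric])
        (auto intro!: Fint integrable_continuous_interval continuous_intros hc simp: F_def)
    finally show ?thesis by (simp add: FP)
  qed
  \<comment> \<open>The factorization turns comparisons of \<open>h\<close> into sign conditions on
    two sines.\<close>
  have cos2: "(cos v)\<^sup>2 - (cos u)\<^sup>2 = sin (u + v) * sin (u - v)" for u v :: real
  proof -
    have "sin (u + v) * sin (u - v) = (sin u)\<^sup>2 * (cos v)\<^sup>2 - (cos u)\<^sup>2 * (sin v)\<^sup>2"
      by (simp add: sin_add sin_diff algebra_simps power2_eq_square)
    then show ?thesis unfolding sin_squared_eq by (simp add: algebra_simps)
  qed
  have h_le: "h u \<le> h v" if "0 \<le> sin ((u + v) / 2) * sin ((u - v) / 2)" for u v
  proof -
    have "\<bar>cos (u / 2)\<bar> \<le> \<bar>cos (v / 2)\<bar>"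
      using that cos2[of "v / 2" "u / 2"]
      by (simp add: abs_le_square_iff add_divide_distrib diff_divide_distrib)
    then show ?thesis unfolding h_def using q by (intro powr_mono2) auto
  qed
  have h_less: "h u < h v" if "0 < sin ((u + v) / 2) * sin ((u - v) / 2)" for u v
  proof -
    have "\<not> (cos (v / 2))\<^sup>2 \<le> (cos (u / 2))\<^sup>2"
      using that cos2[of "v / 2" "u / 2"] by (simp add: add_divide_distrib diff_divide_distrib)
    then have "\<bar>cos (u / 2)\<bar> < \<bar>cos (v / 2)\<bar>"
      unfolding abs_le_square_iff[symmetric] by simp
    then show ?thesis unfolding h_def using q by (intro powr_less_mono2) auto
  qed
  \<comment> \<open>For both factors of \<open>P\<close> one of the two sines is
    \<open>sin (m - x)\<close>, while the other does not depend on \<open>x\<close> and is positive.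
    This is why the factors share their sign.\<close>
  have arg: "(2 * m - x + x) / 2 = m" "(2 * m - x - x) / 2 = m - x"
       "(b - x + (a - x)) / 2 = m - x" "(b - x - (a - x)) / 2 = (b - a) / 2" for x
    by (simp_all add: m_def field_simps)
  have h_minus: "h (x - c) = h (c - x)" for x c
    using heven[of "c - x"] by simp
  have sm: "0 < sin m" "0 < sin ((b - a) / 2)"
    using m ab by (auto intro!: sin_gt_zero)
  have P0: "0 \<le> P x" if "x \<in> {m - pi..m}" for x
  proof -
    have s: "0 \<le> sin (m - x)" using that by (intro sin_ge_zero) auto
    have "h (2 * m - x) \<le> h x"
      by (rule h_le) (simp only: arg s sm less_imp_le zero_le_mult_iff simp_thms)
    moreover have "h (b - x) \<le> h (a - x)"
      by (rule h_le) (simp only: arg s sm less_imp_le zero_le_mult_iff simp_thms)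
    ultimately show ?thesis by (simp add: P_def h_minus)
  qed
  \<comment> \<open>Strict positivity at one interior point suffices, because \<open>P\<close> is
    continuous and nonnegative on the interval of integration.\<close>
  have Ppos: "0 < P (m - pi / 2)"
  proof -
    let ?x = "m - pi / 2"
    have s: "0 < sin (m - ?x)" by simp
    have "h (2 * m - ?x) < h ?x"
      by (rule h_less) (simp only: arg s sm zero_less_mult_iff simp_thms)
    moreover have "h (b - ?x) < h (a - ?x)"
      by (rule h_less) (simp only: arg s sm zero_less_mult_iff simp_thms)
    ultimately show ?thesis unfolding P_def h_minus by (intro mult_pos_pos) auto
  qed
  have "integral {m - pi..m} P \<noteq> 0"
  proof
    assume "integral {m - pi..m} P = 0"
    then have "(P has_integral 0) (cbox (m - pi) m)"
      using integrable_integral[OF integrable_continuous_interval[OF Pcont, of "m - pi" m]] by simp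
    then have "P (m - pi / 2) = 0"
      by (rule has_integral_0_cbox_imp_0[rotated 2]) (auto intro: P0 Pcont simp: not_le[THEN iffD2, OF pi_gt_zero])
    then show False using Ppos by simp
  qed
  moreover have "0 \<le> integral {m - pi..m} P"
    by (intro Henstock_Kurzweil_Integration.integral_nonneg integrable_continuous_interval Pcont P0)
  ultimately show ?thesis using eq by linarith
qed


section \<open>The circle integral satisfies the kernel conditions\<close>

definition circle_kernel :: "real \<Rightarrow> real \<Rightarrow> real \<Rightarrow> real" where
  "circle_kernel q r s = integral {0..pi} (\<lambda>x. \<bar>r * cos x + s\<bar> powr q)"

context
  fixes q :: real
  assumes q: "0 < q" "q < 1"
begin

lemma circle_kernel_integrable: "(\<lambda>x. \<bar>r * cos x + s\<bar> powr q) integrable_on {a..b}"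
  using q by (intro integrable_continuous_interval continuous_intros) auto

lemma circle_kernel_continuous: "continuous_on S (\<lambda>(r, s). circle_kernel q r s)"
proof -
  have "continuous_on (S \<times> cbox 0 pi) (\<lambda>(z, x). \<bar>fst z * cos x + snd z\<bar> powr q)"
    unfolding split_beta using q by (intro continuous_intros) auto
  then have "continuous_on S (\<lambda>z. integral (cbox 0 pi) (\<lambda>x. \<bar>fst z * cos x + snd z\<bar> powr q))"
    by (intro integral_continuous_on_param) auto
  then show ?thesis by (simp add: circle_kernel_def split_beta)
qed

lemma circle_kernel_nonneg: "0 \<le> circle_kernel q r s"
  unfolding circle_kernel_def
  by (intro Henstock_Kurzweil_Integration.integral_nonneg circle_kernel_integrable) auto

lemma circle_kernel_hom:
  assumes "0 < c"
  shows "circle_kernel q (c * r) (c * s) = c powr q * circle_kernel q r s"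
proof -
  have "\<bar>c * r * cos x + c * s\<bar> powr q = c powr q * \<bar>r * cos x + s\<bar> powr q" for x
  proof -
    have "c * r * cos x + c * s = c * (r * cos x + s)"
      by (simp add: algebra_simps)
    then show ?thesis using assms by (simp only: abs_mult) (simp add: powr_mult)
  qed
  then show ?thesis by (simp add: circle_kernel_def)
qed

text \<open>Evenness extends the integral to a full period, the sum-to-product formula factors the
  integrand, and a shift by \<open>a\<close> makes it an autocorrelation at shift
  \<open>2 * a\<close>. As the offset \<open>cos a\<close> grows from 0 to 1, the shift falls from
  \<open>pi\<close> to 0.\<close>

lemma circle_kernel_cos:
  assumes "0 \<le> a" "a \<le> pi / 2"
  shows "2 * circle_kernel q 1 (cos a)
     = 2 powr q * integral {-pi..pi} (\<lambda>x. \<bar>cos (x / 2)\<bar> powr q * \<bar>cos ((x - 2 * a) / 2)\<bar> powr q)"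
proof -
  let ?f = "\<lambda>x. \<bar>cos x + cos a\<bar> powr q"
  let ?g = "\<lambda>x. \<bar>cos (x / 2)\<bar> powr q * \<bar>cos ((x - 2 * a) / 2)\<bar> powr q"
  have fi: "?f integrable_on {u..v}" for u v
    using circle_kernel_integrable[of 1 "cos a"] by simp
  have "integral {-pi..0} ?f = integral {0..pi} ?f"
    using Henstock_Kurzweil_Integration.integral_reflect_real[of pi 0 ?f] by simp
  then have "2 * circle_kernel q 1 (cos a) = integral {-pi..0} ?f + integral {0..pi} ?f"
    by (simp add: circle_kernel_def)
  also have "\<dots> = integral {-pi..pi} ?f"
    by (rule Henstock_Kurzweil_Integration.integral_combine) (auto intro: fi)
  also have "\<dots> = integral {-pi..pi} (\<lambda>x. 2 powr q * ?g (x + a))"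
  proof -
    have "?f x = 2 powr q * ?g (x + a)" for x
    proof -
      have "(x + a - 2 * a) / 2 = (x - a) / 2" by simp
      then have "cos x + cos a = 2 * cos ((x + a) / 2) * cos ((x + a - 2 * a) / 2)"
        by (simp only: cos_plus_cos)
      then show ?thesis by (simp add: abs_mult powr_mult)
    qed
    then show ?thesis by simp
  qed
  also have "\<dots> = 2 powr q * integral {-pi..pi} (?g \<circ> (+) a)"
    by (simp add: o_def add.commute)
  also have "integral {-pi..pi} (?g \<circ> (+) a) = integral {-pi + a..-pi + a + 2 * pi} ?g"
    unfolding integral_shift_Icc_real by (simp add: algebra_simps)
  also have "\<dots> = integral {-pi..-pi + 2 * pi} ?g"
  proof (rule integral_periodic_shift)
    show "continuous_on UNIV ?g" using q by (intro continuous_intros) auto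
    show "?g (x + 2 * pi) = ?g x" for x
    proof -
      have "(x + 2 * pi) / 2 = x / 2 + pi" "(x + 2 * pi - 2 * a) / 2 = (x - 2 * a) / 2 + pi"
        by (simp_all add: field_simps)
      then show ?thesis by (simp only: cos_periodic_pi abs_minus_cancel)
    qed
  qed simp
  finally show ?thesis by simp
qed

text \<open>Two mechanisms meet at offset 1: below it the autocorrelation decides, above it
  \<open>cos x + s\<close> is nonnegative and the integrand itself is monotone, strictly so at
  \<open>x = 0\<close>.\<close>

lemma circle_kernel_strict_mono:
  assumes "0 \<le> s" "s < s'"
  shows "circle_kernel q 1 s < circle_kernel q 1 s'"
proof -
  have small: "circle_kernel q 1 s < circle_kernel q 1 s'" if "0 \<le> s" "s < s'" "s' \<le> 1" for s s'
  proof -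
    define a where "a = arccos s"
    define b where "b = arccos s'"
    have ab: "0 \<le> b" "b < a" "a \<le> pi / 2" "cos a = s" "cos b = s'"
      using that arccos_less_arccos[of s s'] arccos_le_pi2[of s] arccos_lbound[of s']
      by (auto simp: a_def b_def)
    have "integral {-pi..pi} (\<lambda>x. \<bar>cos (x / 2)\<bar> powr q * \<bar>cos ((x - 2 * a) / 2)\<bar> powr q)
        < integral {-pi..pi} (\<lambda>x. \<bar>cos (x / 2)\<bar> powr q * \<bar>cos ((x - 2 * b) / 2)\<bar> powr q)"
      using half_cos_autocorrelation_strict[of q "2 * b" "2 * a"] ab q by simp
    then have "2 * circle_kernel q 1 (cos a) < 2 * circle_kernel q 1 (cos b)"
      using ab by (subst (1 2) circle_kernel_cos) auto
    then show ?thesis using ab by simp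
  qed
  have large: "circle_kernel q 1 s < circle_kernel q 1 s'" if "1 \<le> s" "s < s'" for s s'
  proof -
    have c: "0 \<le> cos x + s" for x using that cos_ge_minus_one[of x] by linarith
    have le: "\<bar>1 * cos x + s\<bar> powr q \<le> \<bar>1 * cos x + s'\<bar> powr q" for x
      using c[of x] that q by (intro powr_mono2) auto
    have "circle_kernel q 1 s \<noteq> circle_kernel q 1 s'"
    proof
      let ?d = "\<lambda>x. \<bar>1 * cos x + s'\<bar> powr q - \<bar>1 * cos x + s\<bar> powr q"
      assume "circle_kernel q 1 s = circle_kernel q 1 s'"
      then have "integral {0..pi} ?d = 0"
        unfolding circle_kernel_def by (subst integral_diff) (auto simp only: circle_kernel_integrable)
      moreover have "?d integrable_on {0..pi}"
        by (intro integrable_diff circle_kernel_integrable)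
      ultimately have "(?d has_integral 0) (cbox 0 pi)"
        using integrable_integral by fastforce
      then have "?d 0 = 0"
        using le q by (intro has_integral_0_cbox_imp_0[of 0 pi ?d])
          (auto intro!: continuous_intros simp: not_le[THEN iffD2, OF pi_gt_zero])
      moreover have "\<bar>1 * cos 0 + s\<bar> powr q < \<bar>1 * cos 0 + s'\<bar> powr q"
        using that q by (intro powr_less_mono2) auto
      ultimately show False by simp
    qed
    moreover have "circle_kernel q 1 s \<le> circle_kernel q 1 s'"
      unfolding circle_kernel_def by (intro integral_le circle_kernel_integrable le)
    ultimately show ?thesis by simp
  qed
  consider "s' \<le> 1" | "1 \<le> s" | "s < 1" "1 < s'" by linarith
  then show ?thesis
  proof cases
    case 3
    then show ?thesis using small[of s 1] large[of 1 s'] assms by simp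
  qed (use small large assms in auto)
qed

lemma circle_kernel_0: "circle_kernel q 0 s = pi * \<bar>s\<bar> powr q"
  by (simp add: circle_kernel_def)

lemma circle_kernel_less:
  assumes "0 \<le> r" "0 \<le> s" "s < s'"
  shows "circle_kernel q r s < circle_kernel q r s'"
proof (cases "r = 0")
  case True
  then show ?thesis using assms q by (auto simp: circle_kernel_0 intro!: powr_less_mono2)
next
  case False
  have "circle_kernel q r t = r powr q * circle_kernel q 1 (t / r)" for t
    using circle_kernel_hom[of r 1 "t / r"] False assms by simp
  moreover have "circle_kernel q 1 (s / r) < circle_kernel q 1 (s' / r)"
    using False assms by (intro circle_kernel_strict_mono) (auto simp: divide_strict_right_mono)
  ultimately show ?thesis using False assms by simp
qed

text \<open>Subadditivity of the power under the integral. This yields both the uniform bound and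
  the modulus of continuity at offset 0.\<close>

lemma circle_kernel_shift_le: "circle_kernel q r s \<le> circle_kernel q r 0 + pi * \<bar>s\<bar> powr q"
proof -
  have "circle_kernel q r s \<le> integral {0..pi} (\<lambda>x. \<bar>r * cos x + 0\<bar> powr q + \<bar>s\<bar> powr q)"
    unfolding circle_kernel_def using q abs_powr_subadditive[of q "r * cos _" s]
    by (intro integral_le integrable_add circle_kernel_integrable) auto
  also have "\<dots> = circle_kernel q r 0 + pi * \<bar>s\<bar> powr q"
    unfolding circle_kernel_def by (subst integral_add) (auto intro: circle_kernel_integrable[of r 0, simplified])
  finally show ?thesis .
qed

lemma shell_kernel_circle: "shell_kernel q 2 (circle_kernel q)"
proof
  show "q \<noteq> 0" "\<bar>q\<bar> < 1" "2 \<le> (2::nat)" using q by auto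
  have "(\<lambda>(r, s). circle_kernel q r s) \<in> borel_measurable borel"
    by (intro borel_measurable_continuous_onI circle_kernel_continuous)
  then show "(\<lambda>(r, s). circle_kernel q r s) \<in> borel_measurable (borel \<Otimes>\<^sub>M borel)"
    by (simp add: borel_prod)
  show "0 \<le> circle_kernel q r s" for r s by (rule circle_kernel_nonneg)
  show "circle_kernel q (c * r) (c * s) = c powr q * circle_kernel q r s" if "0 < c" for c r s
    using that by (rule circle_kernel_hom)
  show "sgn q * circle_kernel q r s \<le> sgn q * circle_kernel q r s'"
    if "0 \<le> r" "0 \<le> s" "s \<le> s'" for r s s'
    using circle_kernel_less[of r s s'] that q by (cases "s = s'") auto
  have upper: "circle_kernel q r s \<le> pi * \<bar>r\<bar> powr q + pi * \<bar>s\<bar> powr q" for r s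
  proof -
    have "circle_kernel q r 0 \<le> integral {0..pi} (\<lambda>x. \<bar>r\<bar> powr q)"
      unfolding circle_kernel_def
    proof (intro integral_le circle_kernel_integrable)
      show "\<bar>r * cos x + 0\<bar> powr q \<le> \<bar>r\<bar> powr q" for x
        using q by (intro powr_mono2) (auto simp: abs_mult mult_left_le)
    qed auto
    then show ?thesis using circle_kernel_shift_le[of r s] by simp
  qed
  show "\<exists>C. \<forall>r s. 0 \<le> r \<and> 0 \<le> s \<and> max r s = 1 \<longrightarrow> circle_kernel q r s \<le> C"
  proof (intro exI allI impI)
    fix r s :: real assume rs: "0 \<le> r \<and> 0 \<le> s \<and> max r s = 1"
    then have "r powr q \<le> 1" "s powr q \<le> 1" using q by (auto intro!: powr_le1)
    then have "pi * \<bar>r\<bar> powr q + pi * \<bar>s\<bar> powr q \<le> pi * 1 + pi * 1"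
      using rs by (intro add_mono mult_left_mono) auto
    then show "circle_kernel q r s \<le> pi * 1 + pi * 1" using upper[of r s] by linarith
  qed
  show "\<exists>c>0. \<forall>r s. 0 \<le> r \<and> d \<le> s \<and> max r s = 1 \<longrightarrow>
      c \<le> sgn q * (circle_kernel q r (3 / 4 * s) - circle_kernel q r (1 / 4 * s))" if d: "0 < d" for d
  proof (cases "d \<le> 1")
    case True
    define \<Delta> where "\<Delta> = (\<lambda>z. circle_kernel q (fst z) (3 / 4 * snd z) - circle_kernel q (fst z) (1 / 4 * snd z))"
    have c: "continuous_on S (\<lambda>z. circle_kernel q (fst z) (a * snd z))" for S a
      by (rule continuous_on_compose2[OF circle_kernel_continuous[of UNIV], of S "\<lambda>z. (fst z, a * snd z)", simplified])
         (intro continuous_intros)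
    \<comment> \<open>The difference is continuous and positive on a compact rectangle containing
      all normalized pairs with \<open>s \<ge> d\<close>, so its minimum is the constant. For
      \<open>d > 1\<close> there are no such pairs.\<close>
    have "continuous_on ({0..1} \<times> {d..1}) \<Delta>"
      unfolding \<Delta>_def by (intro continuous_intros c)
    moreover have "compact ({0..1::real} \<times> {d..1})" "{0..1::real} \<times> {d..1} \<noteq> {}"
      using True by (auto intro: compact_Times)
    ultimately obtain z where z: "z \<in> {0..1} \<times> {d..1}" "\<And>w. w \<in> {0..1} \<times> {d..1} \<Longrightarrow> \<Delta> z \<le> \<Delta> w"
      using continuous_attains_inf by metis
    have "0 < \<Delta> z" using z d circle_kernel_less[of "fst z" "1 / 4 * snd z" "3 / 4 * snd z"]
      by (auto simp: \<Delta>_def)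
    moreover have "\<Delta> z \<le> sgn q * (circle_kernel q r (3 / 4 * s) - circle_kernel q r (1 / 4 * s))"
      if "0 \<le> r \<and> d \<le> s \<and> max r s = 1" for r s
      using z(2)[of "(r, s)"] that q by (auto simp: \<Delta>_def max_def split: if_splits)
    ultimately show ?thesis by blast
  next
    case False
    then show ?thesis by (intro exI[of _ 1]) auto
  qed
  show "\<exists>C p. 0 < p \<and> (\<forall>r s. 0 < r \<and> r \<le> 1 \<and> 0 \<le> s \<longrightarrow>
      sgn q * (circle_kernel q r s - circle_kernel q r 0) \<le> C * s powr p / r)"
  proof (rule exI[of _ pi], rule exI[of _ q], intro conjI allI impI)
    fix r s :: real assume rs: "0 < r \<and> r \<le> 1 \<and> 0 \<le> s"
    have "circle_kernel q r s - circle_kernel q r 0 \<le> pi * s powr q"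
      using circle_kernel_shift_le[of r s] rs by simp
    also have "\<dots> \<le> pi * s powr q / r"
      using rs by (simp add: le_divide_eq mult_left_le)
    finally show "sgn q * (circle_kernel q r s - circle_kernel q r 0) \<le> pi * s powr q / r"
      using q by simp
  qed (use q in auto)
  show "0 < circle_kernel q 1 0"
  proof -
    have "((\<lambda>x. \<bar>1 * cos x + 0\<bar> powr q) has_integral circle_kernel q 1 0) (cbox 0 pi)"
      using integrable_integral[OF circle_kernel_integrable[of 1 0 0 pi]] by (simp add: circle_kernel_def)
    moreover have "continuous_on (cbox 0 pi) (\<lambda>x. \<bar>1 * cos x + 0\<bar> powr q)"
      using q by (intro continuous_intros)
    ultimately have "circle_kernel q 1 0 \<noteq> 0"
      using has_integral_0_cbox_imp_0[of 0 pi "\<lambda>x. \<bar>1 * cos x + 0\<bar> powr q" 0]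
      by (auto simp: not_le[THEN iffD2, OF pi_gt_zero])
    then show ?thesis using circle_kernel_nonneg[of 1 0] by simp
  qed
qed

end

section \<open>The kernel of the two-dimensional sphere\<close>

text \<open>An antiderivative of \<open>\<lambda>x. \<bar>x\<bar> powr p\<close>.\<close>

definition signed_powr :: "real \<Rightarrow> real \<Rightarrow> real" where
  "signed_powr p x = sgn x * \<bar>x\<bar> powr (p + 1) / (p + 1)"

text \<open>The integral of \<open>\<bar>r * v + s\<bar> powr p\<close> over \<open>-1 \<le> v \<le> 1\<close> in closed form.\<close>

definition interval_kernel :: "real \<Rightarrow> real \<Rightarrow> real \<Rightarrow> real" where
  "interval_kernel p r s =
     (if r = 0 then 2 * \<bar>s\<bar> powr p else (signed_powr p (s + r) - signed_powr p (s - r)) / r)"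

context
  fixes p :: real
  assumes p: "- 1 < p" "p < 0"
begin

section \<open>The interval integral satisfies the kernel conditions\<close>

lemma signed_powr_minus: "signed_powr p (- x) = - signed_powr p x"
  by (simp add: signed_powr_def sgn_minus)

lemma signed_powr_nonneg: "0 \<le> x \<Longrightarrow> signed_powr p x = x powr (p + 1) / (p + 1)"
  using p by (cases "x = 0") (auto simp: signed_powr_def)

lemma isCont_signed_powr: "isCont (signed_powr p) x"
proof -
  \<comment> \<open>Written with positive parts the function is a difference of continuous powers,
    since \<open>p + 1\<close> is positive; the jump of \<open>sgn\<close> at 0 disappears.\<close>
  have eq: "signed_powr p = (\<lambda>x. (max x 0 powr (p + 1) - max (- x) 0 powr (p + 1)) / (p + 1))"
  proof
    show "signed_powr p x = (max x 0 powr (p + 1) - max (- x) 0 powr (p + 1)) / (p + 1)" for x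
      using p by (cases "x = 0"; cases "0 < x") (simp_all add: signed_powr_def max_def)
  qed
  have "continuous_on UNIV (signed_powr p)"
    unfolding eq using p by (intro continuous_intros continuous_on_powr') auto
  then show ?thesis by (simp add: continuous_on_eq_continuous_at)
qed

lemma continuous_on_signed_powr:
  assumes "continuous_on S f"
  shows "continuous_on S (\<lambda>x. signed_powr p (f x))"
proof -
  have "continuous_on UNIV (signed_powr p)"
    by (simp add: continuous_on_eq_continuous_at isCont_signed_powr)
  then show ?thesis
    by (rule continuous_on_compose2[OF _ assms]) auto
qed

lemma signed_powr_deriv:
  assumes "x \<noteq> 0"
  shows "(signed_powr p has_real_derivative \<bar>x\<bar> powr p) (at x)"
proof -
  have pos: "(signed_powr p has_real_derivative \<bar>x\<bar> powr p) (at x)" if "0 < x" for x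
  proof -
    have "((\<lambda>x. x powr (p + 1) / (p + 1)) has_real_derivative (p + 1) * x powr (p + 1 - 1) / (p + 1)) (at x)"
      using that by (intro DERIV_cdivide has_real_derivative_powr)
    then have D: "((\<lambda>x. x powr (p + 1) / (p + 1)) has_real_derivative \<bar>x\<bar> powr p) (at x)"
      using p that by simp
    show ?thesis
      by (rule has_field_derivative_transform_within_open[OF D, where S = "{0<..}"])
         (use that in \<open>auto simp: signed_powr_nonneg\<close>)
  qed
  show ?thesis
  proof (cases "0 < x")
    case False
    then have "(signed_powr p has_real_derivative \<bar>x\<bar> powr p) (at (- x))"
      using pos[of "- x"] assms by simp
    then have "((\<lambda>y. signed_powr p (- y)) has_real_derivative - (\<bar>x\<bar> powr p)) (at x)"
      using DERIV_mirror[of "signed_powr p" "\<bar>x\<bar> powr p" x] by simp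
    from DERIV_minus[OF this] have "((\<lambda>y. - signed_powr p (- y)) has_real_derivative \<bar>x\<bar> powr p) (at x)"
      by simp
    then show ?thesis by (simp add: signed_powr_minus)
  qed (use pos in auto)
qed

lemma signed_powr_strict_mono: "x < y \<Longrightarrow> signed_powr p x < signed_powr p y"
proof -
  have pos: "signed_powr p x < signed_powr p y" if "0 \<le> x" "x < y" for x y
    using that p by (simp add: signed_powr_nonneg divide_strict_right_mono powr_less_mono2)
  assume "x < y"
  consider "0 \<le> x" | "y \<le> 0" | "x < 0" "0 < y" by linarith
  then show ?thesis
  proof cases
    case 1 then show ?thesis using pos \<open>x < y\<close> by simp
  next
    case 2 then show ?thesis using pos[of "- y" "- x"] \<open>x < y\<close> by (simp add: signed_powr_minus)
  next
    case 3
    have "signed_powr p 0 = 0" by (simp add: signed_powr_def)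
    then show ?thesis using pos[of 0 "- x"] pos[of 0 y] 3 by (simp add: signed_powr_minus)
  qed
qed

text \<open>The increment is the integral of \<bar>x\<bar> powr p over a window of length
  \<open>2 * r\<close>. For \<open>a \<ge> - r\<close> its centre is at or to the right of the
  singularity, and moving it further right replaces larger values by smaller ones: the right end is
  farther from 0 than the left one. The derivative argument is split at 0, where the left end meets
  the singularity.\<close>

lemma signed_powr_increment_less:
  assumes "0 < r" "- r \<le> a" "a < b"
  shows "signed_powr p (b + 2 * r) - signed_powr p b < signed_powr p (a + 2 * r) - signed_powr p a"
proof -
  let ?g = "\<lambda>x. signed_powr p (x + 2 * r) - signed_powr p x"
  have dec: "?g b < ?g a" if "- r \<le> a" "a < b" "b \<le> 0 \<or> 0 \<le> a" for a b
  proof (rule DERIV_neg_imp_decreasing_open[OF that(2)])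
    show "continuous_on {a..b} ?g"
      by (intro continuous_intros continuous_on_signed_powr)
    fix x assume x: "a < x" "x < b"
    then have *: "x \<noteq> 0" "0 < x + 2 * r" "\<bar>x\<bar> < \<bar>x + 2 * r\<bar>" using that assms by auto
    have "((\<lambda>x. signed_powr p (x + 2 * r)) has_real_derivative \<bar>x + 2 * r\<bar> powr p) (at x)"
      using signed_powr_deriv[of "x + 2 * r"] *(2) by (simp add: DERIV_shift)
    then have "(?g has_real_derivative \<bar>x + 2 * r\<bar> powr p - \<bar>x\<bar> powr p) (at x)"
      by (intro DERIV_diff signed_powr_deriv *)
    moreover have "\<bar>x + 2 * r\<bar> powr p < \<bar>x\<bar> powr p"
      using * p by (intro powr_less_mono2_neg) auto
    ultimately show "\<exists>y. (?g has_real_derivative y) (at x) \<and> y < 0" by auto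
  qed
  consider "b \<le> 0 \<or> 0 \<le> a" | "a < 0" "0 < b" by linarith
  then show ?thesis
  proof cases
    case 2
    then show ?thesis using dec[of a 0] dec[of 0 b] assms by simp
  qed (use dec assms in auto)
qed

lemma interval_kernel_less:
  assumes "0 \<le> r" "0 \<le> s" "s < s'" "0 < r \<or> 0 < s"
  shows "interval_kernel p r s' < interval_kernel p r s"
proof (cases "r = 0")
  case True
  then show ?thesis
    using assms p by (auto simp: interval_kernel_def intro!: powr_less_mono2_neg)
next
  case False
  then have "signed_powr p (s' - r + 2 * r) - signed_powr p (s' - r)
      < signed_powr p (s - r + 2 * r) - signed_powr p (s - r)"
    using assms by (intro signed_powr_increment_less) auto
  then have "signed_powr p (s' + r) - signed_powr p (s' - r) < signed_powr p (s + r) - signed_powr p (s - r)"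
    by (simp add: add.commute)
  then show ?thesis
    using False assms by (simp add: interval_kernel_def divide_strict_right_mono)
qed

lemma interval_kernel_nonneg: "0 \<le> interval_kernel p r s"
proof -
  consider "r = 0" | "0 < r" | "r < 0" by linarith
  then show ?thesis
  proof cases
    case 2
    then show ?thesis
      using signed_powr_strict_mono[of "s - r" "s + r"] by (simp add: interval_kernel_def)
  next
    case 3
    then show ?thesis
      using signed_powr_strict_mono[of "s + r" "s - r"]
      by (simp add: interval_kernel_def divide_nonpos_nonpos)
  qed (simp add: interval_kernel_def)
qed

lemma interval_kernel_hom:
  assumes "0 < c"
  shows "interval_kernel p (c * r) (c * s) = c powr p * interval_kernel p r s"
proof -
  have P: "signed_powr p (c * x) = c * c powr p * signed_powr p x" for x
    using assms by (simp add: signed_powr_def sgn_mult abs_mult powr_mult powr_add)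
  have "c * s + c * r = c * (s + r)" "c * s - c * r = c * (s - r)"
    by (simp_all add: algebra_simps)
  then have "signed_powr p (c * s + c * r) = c * c powr p * signed_powr p (s + r)"
       "signed_powr p (c * s - c * r) = c * c powr p * signed_powr p (s - r)"
    by (simp_all only: P)
  then show ?thesis
    using assms by (simp add: interval_kernel_def powr_mult abs_mult field_simps)
qed

text \<open>The mean value theorem for \<^const>\<open>signed_powr\<close> on an interval that does not contain the origin.\<close>

lemma interval_kernel_bounds:
  assumes "0 \<le> r" "r < s"
  shows "interval_kernel p r s \<le> 2 * (s - r) powr p" and "2 * (s + r) powr p \<le> interval_kernel p r s"
proof -
  consider "r = 0" | "0 < r" using assms by linarith
  then have "interval_kernel p r s \<le> 2 * (s - r) powr p \<and> 2 * (s + r) powr p \<le> interval_kernel p r s"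
  proof cases
    case 2
    have "\<exists>z>s - r. z < s + r \<and>
        signed_powr p (s + r) - signed_powr p (s - r) = (s + r - (s - r)) * \<bar>z\<bar> powr p"
    proof (rule MVT2)
      show "s - r < s + r" using 2 by simp
      show "(signed_powr p has_real_derivative \<bar>x\<bar> powr p) (at x)" if "s - r \<le> x" for x
        using that assms by (intro signed_powr_deriv) auto
    qed
    then obtain z where z: "s - r < z" "z < s + r"
        "signed_powr p (s + r) - signed_powr p (s - r) = (s + r - (s - r)) * \<bar>z\<bar> powr p"
      by blast
    then have "interval_kernel p r s = 2 * z powr p"
      using 2 assms by (simp add: interval_kernel_def)
    moreover have "z powr p \<le> (s - r) powr p" "(s + r) powr p \<le> z powr p"
      using z(1,2) assms p by (auto intro!: powr_mono2')
    ultimately show ?thesis by simp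
  qed (use assms in \<open>simp add: interval_kernel_def\<close>)
  then show "interval_kernel p r s \<le> 2 * (s - r) powr p" "2 * (s + r) powr p \<le> interval_kernel p r s"
    by auto
qed

lemma interval_kernel_0: "interval_kernel p 1 0 = 2 / (p + 1)"
  by (simp add: interval_kernel_def signed_powr_def)

text \<open>For \<open>r \<le> 1 / 2\<close> the offset is 1 and the window stays away from the
  singularity; for larger \<open>r\<close> scaling to \<open>r = 1\<close> and monotonicity give the
  maximum at offset 0.\<close>

lemma interval_kernel_le:
  assumes "0 \<le> r" "0 \<le> s" "max r s = 1"
  shows "interval_kernel p r s \<le> 4 / (p + 1)"
proof (cases "r \<le> 1 / 2")
  case True
  then have s: "s = 1" using assms by (auto simp: max_def split: if_splits)
  have "interval_kernel p r s \<le> 2 * (s - r) powr p"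
    using True s assms by (intro interval_kernel_bounds) auto
  also have "(s - r) powr p \<le> (1 / 2) powr p"
    using True s p by (intro powr_mono2') auto
  also have "(1 / 2) powr p \<le> 1 / (p + 1)"
  proof -
    define t where "t = p + 1"
    have t: "0 < t" "t < 1" using p by (auto simp: t_def)
    \<comment> \<open>The exponential lies above its tangent at \<open>t = 1\<close>, whose slope
      \<open>ln 2\<close> is less than 1.\<close>
    have "t \<le> 2 powr (t - 1)"
    proof -
      have "0 \<le> (1 - t) * (1 - ln 2)"
        using t ln_2_less_1 by (intro mult_nonneg_nonneg) auto
      then have "t \<le> 1 + (t - 1) * ln 2" by (simp only: algebra_simps)
      also have "\<dots> \<le> exp ((t - 1) * ln 2)" by (rule exp_ge_add_one_self)
      finally show ?thesis by (simp add: powr_def)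
    qed
    then have "1 / 2 powr p \<le> 1 / t"
      using t by (intro divide_left_mono) (auto simp: t_def)
    then show ?thesis by (simp add: t_def powr_divide)
  qed
  finally show ?thesis using p by (simp add: field_simps)
next
  case False
  have "interval_kernel p r s = r powr p * interval_kernel p 1 (s / r)"
    using interval_kernel_hom[of r 1 "s / r"] False by simp
  also have "\<dots> \<le> r powr p * interval_kernel p 1 0"
    using interval_kernel_less[of 1 0 "s / r"] assms False
    by (intro mult_left_mono) (cases "s = 0"; auto)+
  also have "\<dots> \<le> 2 * interval_kernel p 1 0"
  proof (rule mult_right_mono)
    have "r powr p \<le> (1 / 2) powr p" using False p by (intro powr_mono2') auto
    also have "\<dots> \<le> (1 / 2) powr (- 1)" using p by (intro powr_mono') auto
    finally show "r powr p \<le> 2" by (simp add: powr_minus_divide)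
  qed (rule interval_kernel_nonneg)
  finally show ?thesis by (simp add: interval_kernel_0)
qed

text \<open>The closed form divides by \<open>r\<close>, so compactness is used only for
  \<open>r \<ge> 1 / 8\<close>. Below this threshold \<open>s = 1\<close>, and the windows around
  \<open>1 / 4\<close> and \<open>3 / 4\<close> are separated: the first ends before
  \<open>3 / 8\<close>, the second begins after \<open>5 / 8\<close>.\<close>

lemma interval_kernel_gap:
  assumes "0 < d" "d \<le> 1"
  shows "\<exists>c>0. \<forall>r s. 0 \<le> r \<and> d \<le> s \<and> max r s = 1 \<longrightarrow>
      c \<le> interval_kernel p r (1 / 4 * s) - interval_kernel p r (3 / 4 * s)"
proof -
  define \<Delta> where "\<Delta> = (\<lambda>z. interval_kernel p (fst z) (1 / 4 * snd z) - interval_kernel p (fst z) (3 / 4 * snd z))"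
  define B where "B = {1 / 8..1::real} \<times> {d..1}"
  have c: "continuous_on B (\<lambda>z. interval_kernel p (fst z) (a * snd z))" for a
  proof -
    have "continuous_on B (\<lambda>z. (signed_powr p (a * snd z + fst z) - signed_powr p (a * snd z - fst z)) / fst z)"
      by (intro continuous_intros continuous_on_signed_powr) (auto simp: B_def)
    moreover have "interval_kernel p (fst z) (a * snd z)
        = (signed_powr p (a * snd z + fst z) - signed_powr p (a * snd z - fst z)) / fst z" if "z \<in> B" for z
      using that by (auto simp: B_def interval_kernel_def)
    ultimately show ?thesis by (simp cong: continuous_on_cong)
  qed
  have "continuous_on B \<Delta>"
    unfolding \<Delta>_def by (intro continuous_intros c)
  moreover have "compact B" "B \<noteq> {}"
    using assms by (auto simp: B_def intro: compact_Times)
  ultimately obtain z where z: "z \<in> B" "\<And>w. w \<in> B \<Longrightarrow> \<Delta> z \<le> \<Delta> w"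
    using continuous_attains_inf[of B \<Delta>] by blast
  have z0: "0 < \<Delta> z"
    using z(1) assms interval_kernel_less[of "fst z" "1 / 4 * snd z" "3 / 4 * snd z"]
    by (auto simp: \<Delta>_def B_def)
  define c' where "c' = 2 * (3 / 8) powr p - 2 * (5 / 8) powr p"
  have c': "0 < c'"
    using p powr_less_mono2_neg[of p "3 / 8" "5 / 8"] by (simp add: c'_def)
  have "min (\<Delta> z) c' \<le> interval_kernel p r (1 / 4 * s) - interval_kernel p r (3 / 4 * s)"
    if rs: "0 \<le> r" "d \<le> s" "max r s = 1" for r s
  proof (cases "1 / 8 \<le> r")
    case True
    then have "(r, s) \<in> B" using rs by (auto simp: B_def max_def split: if_splits)
    from z(2)[OF this] show ?thesis by (simp add: \<Delta>_def)
  next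
    case False
    then have s: "s = 1" using rs by (auto simp: max_def split: if_splits)
    have "2 * (3 / 8) powr p \<le> 2 * (1 / 4 + r) powr p"
      using False rs p by (intro mult_left_mono powr_mono2') auto
    also have "\<dots> \<le> interval_kernel p r (1 / 4)"
      using False rs by (intro interval_kernel_bounds) auto
    finally have 1: "2 * (3 / 8) powr p \<le> interval_kernel p r (1 / 4)" .
    have "interval_kernel p r (3 / 4) \<le> 2 * (3 / 4 - r) powr p"
      using False rs by (intro interval_kernel_bounds) auto
    also have "\<dots> \<le> 2 * (5 / 8) powr p"
      using False rs p by (intro mult_left_mono powr_mono2') auto
    finally show ?thesis using 1 by (simp add: s c'_def)
  qed
  then show ?thesis using z0 c' by (intro exI[of _ "min (\<Delta> z) c'"]) auto
qed

text \<open>The antiderivative is Hoelder continuous with exponent \<open>p + 1\<close>, by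
  subadditivity on one side of 0. The factor 2 covers an interval from \<open>r - s\<close> to
  \<open>r\<close> that straddles 0, and \<open>1 / r\<close> comes from the closed form.\<close>

lemma interval_kernel_cont0:
  assumes "0 < r" "0 \<le> s"
  shows "interval_kernel p r 0 - interval_kernel p r s \<le> (2 / (p + 1)) * s powr (p + 1) / r"
proof -
  let ?P = "signed_powr p"
  have mono: "?P x \<le> ?P y" if "x \<le> y" for x y
    using signed_powr_strict_mono[of x y] that by (cases "x = y") auto
  have "?P r - ?P (r - s) \<le> 2 / (p + 1) * s powr (p + 1)"
  proof (cases "s \<le> r")
    case True
    have "r powr (p + 1) \<le> (r - s) powr (p + 1) + s powr (p + 1)"
      using powr_subadditive[of "p + 1" "r - s" s] True assms p by simp
    then have "?P r - ?P (r - s) \<le> s powr (p + 1) / (p + 1)"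
      using True assms p by (simp add: signed_powr_nonneg diff_divide_distrib[symmetric] divide_right_mono)
    also have "\<dots> \<le> 2 / (p + 1) * s powr (p + 1)"
      using p by (simp add: divide_right_mono)
    finally show ?thesis .
  next
    case False
    have "?P r \<le> ?P s" "?P (s - r) \<le> ?P s" using False assms by (auto intro!: mono)
    moreover have "?P (r - s) = - ?P (s - r)" using signed_powr_minus[of "s - r"] by simp
    ultimately have "?P r - ?P (r - s) \<le> 2 * ?P s" by simp
    then show ?thesis using assms by (simp add: signed_powr_nonneg)
  qed
  moreover have "?P r \<le> ?P (s + r)" using assms by (intro mono) auto
  moreover have "?P (- r) = - ?P r" "?P (s - r) = - ?P (r - s)"
    using signed_powr_minus[of r] signed_powr_minus[of "r - s"] by simp_all
  ultimately have "(?P r - ?P (- r)) - (?P (s + r) - ?P (s - r)) \<le> 2 / (p + 1) * s powr (p + 1)"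
    by linarith
  then have "((?P r - ?P (- r)) - (?P (s + r) - ?P (s - r))) / r \<le> 2 / (p + 1) * s powr (p + 1) / r"
    using assms by (intro divide_right_mono) auto
  then show ?thesis using assms by (simp add: interval_kernel_def diff_divide_distrib)
qed

lemma shell_kernel_interval: "shell_kernel p 3 (interval_kernel p)"
proof
  show "p \<noteq> 0" "\<bar>p\<bar> < 1" "2 \<le> (3::nat)" using p by auto
  have sg: "sgn p = - 1" using p by simp
  show "(\<lambda>(r, s). interval_kernel p r s) \<in> borel_measurable (borel \<Otimes>\<^sub>M borel)"
    unfolding interval_kernel_def signed_powr_def split_beta sgn_if by measurable
  show "0 \<le> interval_kernel p r s" for r s by (rule interval_kernel_nonneg)
  show "interval_kernel p (c * r) (c * s) = c powr p * interval_kernel p r s" if "0 < c" for c r s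
    using that by (rule interval_kernel_hom)
  show "sgn p * interval_kernel p r s \<le> sgn p * interval_kernel p r s'"
    if "0 \<le> r" "0 \<le> s" "s \<le> s'" "0 < r \<or> 0 < s" for r s s'
    using interval_kernel_less[of r s s'] that sg by (cases "s = s'") auto
  show "\<exists>C. \<forall>r s. 0 \<le> r \<and> 0 \<le> s \<and> max r s = 1 \<longrightarrow> interval_kernel p r s \<le> C"
    using interval_kernel_le by blast
  show "\<exists>c>0. \<forall>r s. 0 \<le> r \<and> d \<le> s \<and> max r s = 1 \<longrightarrow>
      c \<le> sgn p * (interval_kernel p r (3 / 4 * s) - interval_kernel p r (1 / 4 * s))" if d: "0 < d" for d
  proof (cases "d \<le> 1")
    case True
    then show ?thesis using interval_kernel_gap[of d] d unfolding sg by simp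
  next
    case False
    then show ?thesis by (intro exI[of _ 1]) auto
  qed
  show "\<exists>C q. 0 < q \<and> (\<forall>r s. 0 < r \<and> r \<le> 1 \<and> 0 \<le> s \<longrightarrow>
      sgn p * (interval_kernel p r s - interval_kernel p r 0) \<le> C * s powr q / r)"
    using interval_kernel_cont0 p unfolding sg
    by (intro exI[of _ "2 / (p + 1)"] exI[of _ "p + 1"]) simp
  show "0 < interval_kernel p 1 0" using p by (simp add: interval_kernel_0)
qed

end

section \<open>Cylindrical coordinates\<close>

lemma prod_Basis_vec:
  fixes f :: "real ^ 'n \<Rightarrow> real"
  shows "(\<Prod>b\<in>Basis. f b) = (\<Prod>i\<in>UNIV. f (axis i 1))"
proof -
  have B: "(Basis :: (real ^ 'n) set) = range (\<lambda>i. axis i 1)"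
    by (auto simp: Basis_vec_def)
  show ?thesis
    unfolding B by (subst prod.reindex) (auto simp: inj_on_def axis_eq_axis)
qed

lemma prod_UNIV_3: "(\<Prod>i\<in>UNIV. f (i::3)) = f 1 * (f 2 * (f 3 :: real))"
  unfolding UNIV_3 by simp

lemma prod_UNIV_4: "(\<Prod>i\<in>UNIV. f (i::4)) = f 1 * (f 2 * (f 3 * (f 4 :: real)))"
  unfolding UNIV_4 by simp

text \<open>The height along the axis is the first argument, hence the outermost variable in the
  iterated integrals, although it is the last coordinate of the vector.\<close>

abbreviation coords3 :: "real \<Rightarrow> real \<Rightarrow> real \<Rightarrow> real ^ 3" where
  "coords3 t u w \<equiv> u *\<^sub>R axis 1 1 + w *\<^sub>R axis 2 1 + t *\<^sub>R axis 3 1"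

abbreviation coords4 :: "real \<Rightarrow> real \<Rightarrow> real \<Rightarrow> real \<Rightarrow> real ^ 4" where
  "coords4 t u v w \<equiv> u *\<^sub>R axis 1 1 + v *\<^sub>R axis 2 1 + w *\<^sub>R axis 3 1 + t *\<^sub>R axis 4 1"

lemma emeasure_lborel_Times:
  fixes A :: "'a::euclidean_space set" and B :: "'b::euclidean_space set"
  assumes "A \<in> sets borel" "B \<in> sets borel"
  shows "emeasure lborel (A \<times> B) = emeasure lborel A * emeasure lborel B"
  unfolding lborel_prod[symmetric] using assms by (intro lborel.emeasure_pair_measure_Times) auto

text \<open>Lebesgue measure is determined by its values on boxes, and the preimage of a box is a
  product of intervals.\<close>

lemma lborel_real3:
  "distr lborel borel (\<lambda>(t, u, w). coords3 t u w) = lborel"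
proof (rule lborel_eqI[symmetric])
  let ?\<phi> = "\<lambda>(t, u, w). coords3 t u w"
  fix l u :: "real ^ 3"
  assume le_Basis: "\<And>b. b \<in> Basis \<Longrightarrow> l \<bullet> b \<le> u \<bullet> b"
  have le: "l $ i \<le> u $ i" for i
    using le_Basis[of "axis i 1"] by (simp add: inner_axis)
  have [measurable]: "?\<phi> \<in> borel_measurable borel"
    by (intro borel_measurable_continuous_onI) (auto simp: split_beta intro!: continuous_intros)
  have "(t, u', w') \<in> ?\<phi> -` box l u \<longleftrightarrow> (t, u', w') \<in> {l $ 3<..<u $ 3} \<times> {l $ 1<..<u $ 1} \<times> {l $ 2<..<u $ 2}" for t u' w'
    by (simp add: mem_box_cart forall_3 axis_def) blast
  then have "?\<phi> -` box l u = {l $ 3<..<u $ 3} \<times> {l $ 1<..<u $ 1} \<times> {l $ 2<..<u $ 2}"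
    unfolding set_eq_iff split_paired_All by blast
  then have "emeasure (distr lborel borel ?\<phi>) (box l u) = emeasure lborel ({l $ 3<..<u $ 3} \<times> {l $ 1<..<u $ 1} \<times> {l $ 2<..<u $ 2})"
    by (subst emeasure_distr) auto
  also have "\<dots> = ennreal (u $ 3 - l $ 3) * (ennreal (u $ 1 - l $ 1) * (ennreal (u $ 2 - l $ 2)))"
    using le by (simp add: emeasure_lborel_Times borel_Times)
  also have "\<dots> = ennreal ((u $ 3 - l $ 3) * ((u $ 1 - l $ 1) * ((u $ 2 - l $ 2))))"
    using le by (simp add: ennreal_mult)
  also have "\<dots> = ennreal (\<Prod>b\<in>Basis. (u - l) \<bullet> b)"
    unfolding prod_Basis_vec prod_UNIV_3 by (simp add: inner_axis mult_ac)
  finally show "emeasure (distr lborel borel ?\<phi>) (box l u) = ennreal (\<Prod>b\<in>Basis. (u - l) \<bullet> b)" .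
qed simp

lemma lborel_real4:
  "distr lborel borel (\<lambda>(t, u, v, w). coords4 t u v w)
     = lborel"
proof (rule lborel_eqI[symmetric])
  let ?\<phi> = "\<lambda>(t, u, v, w). coords4 t u v w"
  fix l u :: "real ^ 4"
  assume le_Basis: "\<And>b. b \<in> Basis \<Longrightarrow> l \<bullet> b \<le> u \<bullet> b"
  have le: "l $ i \<le> u $ i" for i
    using le_Basis[of "axis i 1"] by (simp add: inner_axis)
  have [measurable]: "?\<phi> \<in> borel_measurable borel"
    by (intro borel_measurable_continuous_onI) (auto simp: split_beta intro!: continuous_intros)
  have "(t, u', v', w') \<in> ?\<phi> -` box l u \<longleftrightarrow> (t, u', v', w') \<in> {l $ 4<..<u $ 4} \<times> {l $ 1<..<u $ 1} \<times> {l $ 2<..<u $ 2} \<times> {l $ 3<..<u $ 3}" for t u' v' w'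
    by (simp add: mem_box_cart forall_4 axis_def) blast
  then have "?\<phi> -` box l u = {l $ 4<..<u $ 4} \<times> {l $ 1<..<u $ 1} \<times> {l $ 2<..<u $ 2} \<times> {l $ 3<..<u $ 3}"
    unfolding set_eq_iff split_paired_All by blast
  then have "emeasure (distr lborel borel ?\<phi>) (box l u) = emeasure lborel ({l $ 4<..<u $ 4} \<times> {l $ 1<..<u $ 1} \<times> {l $ 2<..<u $ 2} \<times> {l $ 3<..<u $ 3})"
    by (subst emeasure_distr) auto
  also have "\<dots> = ennreal (u $ 4 - l $ 4) * (ennreal (u $ 1 - l $ 1) * (ennreal (u $ 2 - l $ 2) * (ennreal (u $ 3 - l $ 3))))"
    using le by (simp add: emeasure_lborel_Times borel_Times)
  also have "\<dots> = ennreal ((u $ 4 - l $ 4) * ((u $ 1 - l $ 1) * ((u $ 2 - l $ 2) * ((u $ 3 - l $ 3)))))"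
    using le by (simp add: ennreal_mult)
  also have "\<dots> = ennreal (\<Prod>b\<in>Basis. (u - l) \<bullet> b)"
    unfolding prod_Basis_vec prod_UNIV_4 by (simp add: inner_axis mult_ac)
  finally show "emeasure (distr lborel borel ?\<phi>) (box l u) = ennreal (\<Prod>b\<in>Basis. (u - l) \<bullet> b)" .
qed simp

lemma nn_integral_lborel_pair:
  fixes G :: "'a::euclidean_space \<times> 'b::euclidean_space \<Rightarrow> ennreal"
  assumes "G \<in> borel_measurable borel"
  shows "(\<integral>\<^sup>+z. G z \<partial>lborel) = (\<integral>\<^sup>+x. \<integral>\<^sup>+y. G (x, y) \<partial>lborel \<partial>lborel)"
proof -
  have "G \<in> borel_measurable (lborel \<Otimes>\<^sub>M lborel)"
    using assms by (simp add: lborel_prod)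
  from lborel.nn_integral_fst[OF this] show ?thesis
    by (simp add: lborel_prod)
qed

lemma nn_integral_real3:
  fixes F :: "real ^ 3 \<Rightarrow> ennreal"
  assumes [measurable]: "F \<in> borel_measurable borel"
  shows "(\<integral>\<^sup>+y. F y \<partial>lborel)
     = (\<integral>\<^sup>+t. \<integral>\<^sup>+u. \<integral>\<^sup>+w. F (coords3 t u w) \<partial>lborel \<partial>lborel \<partial>lborel)"
proof -
  let ?\<phi> = "\<lambda>(t, u, w). coords3 t u w"
  have [measurable]: "?\<phi> \<in> borel_measurable borel"
    by (intro borel_measurable_continuous_onI) (auto simp: split_beta intro!: continuous_intros)
  have "(\<integral>\<^sup>+y. F y \<partial>lborel) = (\<integral>\<^sup>+z. F (?\<phi> z) \<partial>lborel)"
    by (subst lborel_real3[symmetric], rule nn_integral_distr) auto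
  also have "\<dots> = (\<integral>\<^sup>+t. \<integral>\<^sup>+z. F (?\<phi> (t, z)) \<partial>lborel \<partial>lborel)"
    by (rule nn_integral_lborel_pair) measurable
  also have "\<dots> = (\<integral>\<^sup>+t. \<integral>\<^sup>+u. \<integral>\<^sup>+w. F (?\<phi> (t, u, w)) \<partial>lborel \<partial>lborel \<partial>lborel)"
    by (intro nn_integral_cong nn_integral_lborel_pair) measurable
  finally show ?thesis by simp
qed

lemma nn_integral_real4:
  fixes F :: "real ^ 4 \<Rightarrow> ennreal"
  assumes [measurable]: "F \<in> borel_measurable borel"
  shows "(\<integral>\<^sup>+y. F y \<partial>lborel)
     = (\<integral>\<^sup>+t. \<integral>\<^sup>+u. \<integral>\<^sup>+v. \<integral>\<^sup>+w. F (coords4 t u v w)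
          \<partial>lborel \<partial>lborel \<partial>lborel \<partial>lborel)"
proof -
  let ?\<phi> = "\<lambda>(t, u, v, w). coords4 t u v w"
  have [measurable]: "?\<phi> \<in> borel_measurable borel"
    by (intro borel_measurable_continuous_onI) (auto simp: split_beta intro!: continuous_intros)
  have "(\<integral>\<^sup>+y. F y \<partial>lborel) = (\<integral>\<^sup>+z. F (?\<phi> z) \<partial>lborel)"
    by (subst lborel_real4[symmetric], rule nn_integral_distr) auto
  also have "\<dots> = (\<integral>\<^sup>+t. \<integral>\<^sup>+z. F (?\<phi> (t, z)) \<partial>lborel \<partial>lborel)"
    by (rule nn_integral_lborel_pair) measurable
  also have "\<dots> = (\<integral>\<^sup>+t. \<integral>\<^sup>+u. \<integral>\<^sup>+z. F (?\<phi> (t, u, z)) \<partial>lborel \<partial>lborel \<partial>lborel)"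
    by (intro nn_integral_cong nn_integral_lborel_pair) measurable
  also have "\<dots> = (\<integral>\<^sup>+t. \<integral>\<^sup>+u. \<integral>\<^sup>+v. \<integral>\<^sup>+w. F (?\<phi> (t, u, v, w)) \<partial>lborel \<partial>lborel \<partial>lborel \<partial>lborel)"
    by (intro nn_integral_cong nn_integral_lborel_pair) measurable
  finally show ?thesis by simp
qed

section \<open>Rotating the direction into a coordinate plane\<close>

lemma lborel_distr_orthogonal:
  fixes T :: "(real, 'n::{finite, wellorder}) vec \<Rightarrow> (real, 'n) vec"
  assumes T: "orthogonal_transformation T"
  shows "distr lborel borel T = lborel"
proof (rule lborel_eqI[symmetric])
  have lin: "linear T" using T by (rule orthogonal_transformation_linear)
  have [measurable]: "T \<in> borel_measurable borel"
    using lin by (intro borel_measurable_continuous_onI linear_continuous_on) (simp add: linear_conv_bounded_linear)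
  fix l u :: "(real, 'n) vec"
  assume le: "\<And>b. b \<in> Basis \<Longrightarrow> l \<bullet> b \<le> u \<bullet> b"
  have inv: "T -` box l u = inv T ` box l u"
    using T by (simp add: bij_vimage_eq_inv_image orthogonal_transformation_bij)
  have box: "box l u \<in> lmeasurable" by simp
  have T': "orthogonal_transformation (inv T)" using T by (rule orthogonal_transformation_inv)
  have "emeasure (distr lborel borel T) (box l u) = emeasure lborel (T -` box l u)"
    by (subst emeasure_distr) auto
  also have "\<dots> = emeasure lebesgue (inv T ` box l u)"
  proof -
    have "T -` box l u \<in> sets borel" using measurable_sets[of T borel borel "box l u"] by simp
    then show ?thesis unfolding inv by simp
  qed
  also have "\<dots> = ennreal (measure lebesgue (box l u))"
    using measurable_orthogonal_image[OF T' box] measure_orthogonal_image[OF T' box]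
    by (simp add: emeasure_eq_measure2 fmeasurableD2)
  also have "\<dots> = ennreal (\<Prod>b\<in>Basis. (u - l) \<bullet> b)"
    using le by (simp add: measure_lborel_box_eq measure_completion)
  finally show "emeasure (distr lborel borel T) (box l u) = ennreal (\<Prod>b\<in>Basis. (u - l) \<bullet> b)" .
qed simp

text \<open>The solid of revolution around the axis spanned by the unit vector \<open>e\<close> with profile \<open>\<bar>x\<bar> ^ k \<le> Y t\<close>, \<open>\<bar>t\<bar> \<le> H\<close>.\<close>

definition rotbody :: "'a::euclidean_space \<Rightarrow> nat \<Rightarrow> (real \<Rightarrow> real) \<Rightarrow> real \<Rightarrow> 'a set" where
  "rotbody e k Y H = {y. norm (y - (y \<bullet> e) *\<^sub>R e) ^ k \<le> Y (y \<bullet> e) \<and> \<bar>y \<bullet> e\<bar> \<le> H}"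

lemma sets_rotbody [measurable]:
  assumes [measurable]: "Y \<in> borel_measurable borel"
  shows "rotbody e k Y H \<in> sets borel"
  unfolding rotbody_def by measurable

lemma norm_diff_projection:
  fixes e y :: "'a::real_inner"
  assumes "norm e = 1"
  shows "(norm (y - (y \<bullet> e) *\<^sub>R e))\<^sup>2 = (norm y)\<^sup>2 - (y \<bullet> e)\<^sup>2"
proof -
  have "e \<bullet> e = 1" using assms by (simp add: norm_eq_1)
  then show ?thesis
    unfolding power2_norm_eq_inner by (simp add: inner_diff inner_commute power2_eq_square)
qed

text \<open>The reflection in the hyperplane orthogonal to \<open>v\<close>; for
  \<open>v = 0\<close> the formula gives the identity.\<close>

definition householder :: "'a::real_inner \<Rightarrow> 'a \<Rightarrow> 'a" where
  "householder v y = y - (2 * (y \<bullet> v) / (v \<bullet> v)) *\<^sub>R v"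

lemma orthogonal_transformation_householder: "orthogonal_transformation (householder v)"
  unfolding orthogonal_transformation_def
proof (intro conjI allI)
  show "linear (householder v)"
    by (rule linearI) (simp_all add: householder_def algebra_simps add_divide_distrib)
  show "householder v x \<bullet> householder v y = x \<bullet> y" for x y
  proof (cases "v = 0")
    case False
    then have "v \<bullet> v \<noteq> 0" by simp
    then show ?thesis
      by (simp add: householder_def inner_diff inner_commute field_simps)
  qed (simp add: householder_def)
qed

text \<open>For vectors of equal norm, the reflection along their difference exchanges them, and a
  reflection is self-adjoint.\<close>

lemma householder_inner:
  assumes "norm z = norm z'"
  shows "householder (z - z') y \<bullet> z = y \<bullet> z'"
proof (cases "z = z'")
  case False
  define v where "v = z - z'"
  have "v \<bullet> v \<noteq> 0" using False by (simp add: v_def)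
  have "z \<bullet> z = z' \<bullet> z'" using assms by (simp add: norm_eq)
  then have "v \<bullet> v = 2 * (v \<bullet> z)"
    by (simp add: v_def inner_diff inner_commute)
  then have "householder v y \<bullet> z = y \<bullet> z - y \<bullet> v"
    using \<open>v \<bullet> v \<noteq> 0\<close> by (simp add: householder_def inner_diff field_simps)
  then show ?thesis by (simp add: v_def inner_diff)
qed (simp add: householder_def)

text \<open>The new direction has the same height and the same radial norm as \<open>z\<close>, with
  its radial part turned to \<open>a\<close>. The difference of the two is orthogonal to the axis,
  so the reflection exchanging them preserves heights and radial norms, and with them the
  solid.\<close>

lemma nn_integral_rotbody_reduce:
  fixes e a z :: "(real, 'n::{finite, wellorder}) vec" and g :: "real \<Rightarrow> ennreal"
  assumes [measurable]: "Y \<in> borel_measurable borel" "g \<in> borel_measurable borel"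
    and e: "norm e = 1" "norm a = 1" "a \<bullet> e = 0"
  shows "(\<integral>\<^sup>+y. g (y \<bullet> z) * indicator (rotbody e k Y H) y \<partial>lborel)
    = (\<integral>\<^sup>+y. g (y \<bullet> (norm (z - (z \<bullet> e) *\<^sub>R e) *\<^sub>R a + (z \<bullet> e) *\<^sub>R e)) * indicator (rotbody e k Y H) y \<partial>lborel)"
proof -
  define r where "r = norm (z - (z \<bullet> e) *\<^sub>R e)"
  define z' where "z' = r *\<^sub>R a + (z \<bullet> e) *\<^sub>R e"
  define T where "T = householder (z - z')"
  have ee: "e \<bullet> e = 1" "a \<bullet> a = 1" using e by (simp_all add: norm_eq_1)
  have T: "orthogonal_transformation T"
    unfolding T_def by (rule orthogonal_transformation_householder)
  have [measurable]: "T \<in> borel_measurable borel"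
    using orthogonal_transformation_linear[OF T]
    by (intro borel_measurable_continuous_onI linear_continuous_on) (simp add: linear_conv_bounded_linear)
  have "(norm z')\<^sup>2 = r\<^sup>2 + (z \<bullet> e)\<^sup>2"
    unfolding power2_norm_eq_inner using ee e(3)
    by (simp add: z'_def inner_add inner_commute[of e a] power2_eq_square)
  also have "\<dots> = (norm z)\<^sup>2"
    using norm_diff_projection[OF e(1), of z] by (simp add: r_def)
  finally have "norm z = norm z'" by simp
  then have Tz: "T y \<bullet> z = y \<bullet> z'" for y
    unfolding T_def by (rule householder_inner)
  have "(z - z') \<bullet> e = 0"
    using ee e(3) by (simp add: z'_def inner_diff inner_add)
  then have Te: "T y \<bullet> e = y \<bullet> e" for y
    by (simp add: T_def householder_def inner_diff)
  have "(norm (T y - (T y \<bullet> e) *\<^sub>R e))\<^sup>2 = (norm (y - (y \<bullet> e) *\<^sub>R e))\<^sup>2" for y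
    using norm_diff_projection[OF e(1), of "T y"] norm_diff_projection[OF e(1), of y]
      orthogonal_transformation_norm[OF T, of y]
    by (simp add: Te)
  then have "norm (T y - (T y \<bullet> e) *\<^sub>R e) = norm (y - (y \<bullet> e) *\<^sub>R e)" for y
    by (simp add: power2_eq_iff_nonneg)
  then have TB: "T y \<in> rotbody e k Y H \<longleftrightarrow> y \<in> rotbody e k Y H" for y
    unfolding rotbody_def by (simp add: Te)
  have "(\<integral>\<^sup>+y. g (y \<bullet> z) * indicator (rotbody e k Y H) y \<partial>lborel)
      = (\<integral>\<^sup>+y. g (T y \<bullet> z) * indicator (rotbody e k Y H) (T y) \<partial>lborel)"
    by (subst lborel_distr_orthogonal[OF T, symmetric], rule nn_integral_distr) measurable
  also have "\<dots> = (\<integral>\<^sup>+y. g (y \<bullet> z') * indicator (rotbody e k Y H) y \<partial>lborel)"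
    by (simp add: Tz TB indicator_def)
  finally show ?thesis by (simp add: z'_def r_def)
qed

section \<open>Discs and balls in the k-th power of the radius\<close>

lemma nn_integral_powr_from_0:
  fixes a c :: real
  assumes "- 1 < a" "0 \<le> c"
  shows "(\<integral>\<^sup>+x. ennreal (x powr a) * indicator {0<..c} x \<partial>lborel) = ennreal (c powr (a + 1) / (a + 1))"
proof -
  have "((\<lambda>x. if x \<in> {0..c} then x powr a else 0) has_integral (c powr (a + 1) / (a + 1))) UNIV"
    using has_integral_powr_from_0[OF assms] by (subst has_integral_restrict_UNIV)
  moreover have "(\<lambda>x. if x \<in> {0..c} then x powr a else 0) = (\<lambda>x. x powr a * indicator {0<..c} x)"
    by (auto simp: fun_eq_iff indicator_def)
  ultimately have "((\<lambda>x. x powr a * indicator {0<..c} x) has_integral (c powr (a + 1) / (a + 1))) UNIV"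
    by simp
  then have "(\<integral>\<^sup>+x. ennreal (x powr a * indicator {0<..c} x) \<partial>lborel) = ennreal (c powr (a + 1) / (a + 1))"
    by (intro nn_integral_has_integral_lborel) auto
  then show ?thesis by (simp add: ennreal_mult ennreal_indicator)
qed

text \<open>The density, up to a constant, of \<open>sqrt y * cos x\<close> for a uniformly distributed angle \<open>x\<close>.\<close>

definition arcsine_density :: "real \<Rightarrow> real \<Rightarrow> ennreal" where
  "arcsine_density y u = (if u\<^sup>2 < y then ennreal (1 / sqrt (y - u\<^sup>2)) else 0)"

lemma arcsine_density_meas [measurable]:
  "(\<lambda>(u, y). arcsine_density y u) \<in> borel_measurable (lborel \<Otimes>\<^sub>M lborel)"
  unfolding arcsine_density_def by measurable

lemma nn_integral_cos_substitution:
  fixes h :: "real \<Rightarrow> real"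
  assumes [measurable]: "h \<in> borel_measurable borel" and h: "\<And>u. 0 \<le> h u" and y: "0 < y"
  shows "(\<integral>\<^sup>+x. indicator {0..pi} x * ennreal (h (sqrt y * cos x)) \<partial>lborel)
     = (\<integral>\<^sup>+u. ennreal (h u) * arcsine_density y u \<partial>lborel)"
proof -
  \<comment> \<open>The reflected \<open>h\<close> makes the substitution increasing; the reflection
    is undone afterwards. At the end points, where the denominator vanishes, the values form a null
    set.\<close>
  define f where "f = (\<lambda>u. h (- u) / sqrt (y - u\<^sup>2))"
  have "(\<integral>\<^sup>+x. ennreal (f x * indicator {- sqrt y * cos 0..- sqrt y * cos pi} x) \<partial>lborel)
     = (\<integral>\<^sup>+x. ennreal (f (- sqrt y * cos x) * (sqrt y * sin x) * indicator {0..pi} x) \<partial>lborel)"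
  proof (rule nn_integral_substitution[where g = "\<lambda>x. - sqrt y * cos x" and g' = "\<lambda>x. sqrt y * sin x"])
    show "set_borel_measurable borel {- sqrt y * cos 0..- sqrt y * cos pi} f"
      unfolding f_def set_borel_measurable_def by measurable
    show "((\<lambda>x. - sqrt y * cos x) has_real_derivative sqrt y * sin x) (at x)" for x
      by (auto intro!: derivative_eq_intros)
    show "0 \<le> sqrt y * sin x" if "x \<in> {0..pi}" for x
      using that y by (auto intro!: mult_nonneg_nonneg sin_ge_zero)
  qed (auto intro!: continuous_intros)
  also have "\<dots> = (\<integral>\<^sup>+x. indicator {0..pi} x * ennreal (h (sqrt y * cos x)) \<partial>lborel)"
  proof (rule nn_integral_cong_AE)
    have "AE x in lborel. x \<noteq> (0::real)" "AE x in lborel. x \<noteq> pi"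
      by (rule AE_lborel_singleton)+
    then show "AE x in lborel. ennreal (f (- sqrt y * cos x) * (sqrt y * sin x) * indicator {0..pi} x)
        = indicator {0..pi} x * ennreal (h (sqrt y * cos x))"
    proof eventually_elim
      case (elim x)
      show ?case
      proof (cases "x \<in> {0..pi}")
        case True
        with elim have s: "0 < sin x" by (intro sin_gt_zero) auto
        have "y - (- sqrt y * cos x)\<^sup>2 = y * (sin x)\<^sup>2"
          using y by (simp add: power_mult_distrib sin_squared_eq algebra_simps)
        then have "sqrt (y - (- sqrt y * cos x)\<^sup>2) = sqrt y * sin x"
          using s by (simp add: real_sqrt_mult)
        then have "f (- sqrt y * cos x) * (sqrt y * sin x) = h (sqrt y * cos x)"
          unfolding f_def using s y by simp
        then show ?thesis using True by (simp only: indicator_simps mult_1 mult_1_right)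
      qed simp
    qed
  qed
  finally have 1: "(\<integral>\<^sup>+x. indicator {0..pi} x * ennreal (h (sqrt y * cos x)) \<partial>lborel)
     = (\<integral>\<^sup>+x. ennreal (f x * indicator {- sqrt y..sqrt y} x) \<partial>lborel)" by simp
  also have "\<dots> = (\<integral>\<^sup>+u. ennreal (f (- u) * indicator {- sqrt y..sqrt y} (- u)) \<partial>lborel)"
    by (subst nn_integral_real_affine[where c = "-1" and t = 0]) (auto simp: f_def)
  also have "\<dots> = (\<integral>\<^sup>+u. ennreal (h u) * arcsine_density y u \<partial>lborel)"
  proof (rule nn_integral_cong)
    fix u :: real
    have "u\<^sup>2 \<le> y \<longleftrightarrow> \<bar>u\<bar> \<le> sqrt y"
      using real_sqrt_le_iff[of "u\<^sup>2" y] by simp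
    then have iff: "u\<^sup>2 \<le> y \<longleftrightarrow> - u \<in> {- sqrt y..sqrt y}"
      by (auto simp: abs_le_iff)
    show "ennreal (f (- u) * indicator {- sqrt y..sqrt y} (- u))
        = ennreal (h u) * arcsine_density y u"
    proof (cases "u\<^sup>2 < y")
      case True
      then have "- u \<in> {- sqrt y..sqrt y}" using iff by simp
      then have "ennreal (f (- u) * indicator {- sqrt y..sqrt y} (- u)) = ennreal (h u * (1 / sqrt (y - u\<^sup>2)))"
        by (simp only: indicator_simps f_def) simp
      also have "\<dots> = ennreal (h u) * ennreal (1 / sqrt (y - u\<^sup>2))"
        using h True by (intro ennreal_mult) auto
      finally show ?thesis using True by (simp add: arcsine_density_def)
    next
      case False
      then consider "u\<^sup>2 = y" | "- u \<notin> {- sqrt y..sqrt y}" using iff by linarith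
      then have Z: "f (- u) * indicator {- sqrt y..sqrt y} (- u) = 0"
        by cases (simp_all only: f_def indicator_simps, simp_all)
      show ?thesis unfolding Z using False by (simp add: arcsine_density_def)
    qed
  qed
  finally show ?thesis .
qed

text \<open>The slice length \<open>2 * sqrt (Y - u\<^sup>2)\<close> is the integral of the arcsine
  density from \<open>u\<^sup>2\<close> to \<open>Y\<close>, and exchanging the order of integration
  gives polar coordinates with \<open>y\<close> as squared radius. The factor 1/2 from dy = 2 r dr
  cancels against the two half circles.\<close>

lemma nn_integral_disc:
  fixes h :: "real \<Rightarrow> real"
  assumes [measurable]: "h \<in> borel_measurable borel" and h: "\<And>u. 0 \<le> h u"
  shows "(\<integral>\<^sup>+u. \<integral>\<^sup>+w. ennreal (h u) * indicator {w. u\<^sup>2 + w\<^sup>2 \<le> Y} w \<partial>lborel \<partial>lborel)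
     = (\<integral>\<^sup>+y. indicator {0<..Y} y * (\<integral>\<^sup>+x. indicator {0..pi} x * ennreal (h (sqrt y * cos x)) \<partial>lborel) \<partial>lborel)"
proof -
  have slice: "(\<integral>\<^sup>+w. indicator {w. u\<^sup>2 + w\<^sup>2 \<le> Y} w \<partial>lborel)
      = (\<integral>\<^sup>+y. indicator {0<..Y} y * arcsine_density y u \<partial>lborel)"
    for u :: real
  proof (cases "u\<^sup>2 \<le> Y")
    case True
    define c where "c = Y - u\<^sup>2"
    have c: "0 \<le> c" using True by (simp add: c_def)
    have "{w. u\<^sup>2 + w\<^sup>2 \<le> Y} = {- sqrt c..sqrt c}"
    proof -
      have "w\<^sup>2 \<le> c \<longleftrightarrow> w \<in> {- sqrt c..sqrt c}" for w
        using real_sqrt_le_iff[of "w\<^sup>2" c] by (auto simp: abs_le_iff)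
      then have "u\<^sup>2 + w\<^sup>2 \<le> Y \<longleftrightarrow> w \<in> {- sqrt c..sqrt c}" for w
        unfolding c_def by (metis add.commute le_diff_eq)
      then show ?thesis by blast
    qed
    then have "(\<integral>\<^sup>+w. indicator {w. u\<^sup>2 + w\<^sup>2 \<le> Y} w \<partial>lborel) = ennreal (2 * sqrt c)"
      using c by simp
    also have "\<dots> = (\<integral>\<^sup>+x. ennreal (x powr (- 1 / 2)) * indicator {0<..c} x \<partial>lborel)"
    proof -
      have "c powr (- 1 / 2 + 1) / (- 1 / 2 + 1) = 2 * sqrt c"
        using powr_half_sqrt[OF c] by simp
      then show ?thesis using nn_integral_powr_from_0[of "- 1 / 2" c] c by simp
    qed
    also have "\<dots> = (\<integral>\<^sup>+x. indicator {0<..Y} (u\<^sup>2 + 1 * x) *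
        arcsine_density (u\<^sup>2 + 1 * x) u \<partial>lborel)"
    proof (rule nn_integral_cong)
      fix x :: real
      show "ennreal (x powr (- 1 / 2)) * indicator {0<..c} x = indicator {0<..Y} (u\<^sup>2 + 1 * x) *
        arcsine_density (u\<^sup>2 + 1 * x) u"
      proof (cases "0 < x")
        case True
        then have "x powr (- 1 / 2) = 1 / sqrt x"
        proof -
          have "x powr (- (1 / 2)) = 1 / x powr (1 / 2)" by (rule powr_minus_divide)
          then show ?thesis using powr_half_sqrt[of x] True by simp
        qed
        moreover have "x \<in> {0<..c} \<longleftrightarrow> u\<^sup>2 + x \<in> {0<..Y}"
          using True zero_le_power2[of u] unfolding c_def greaterThanAtMost_iff by linarith
        ultimately show ?thesis using True by (simp add: indicator_def arcsine_density_def)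
      qed (simp add: indicator_def arcsine_density_def)
    qed
    also have "\<dots> = (\<integral>\<^sup>+y. indicator {0<..Y} y * arcsine_density y u \<partial>lborel)"
      by (subst (2) nn_integral_real_affine[where c = 1 and t = "u\<^sup>2"]) auto
    finally show ?thesis .
  next
    case False
    have "\<not> u\<^sup>2 + w\<^sup>2 \<le> Y" for w
      using False zero_le_power2[of w] by linarith
    then have E: "{w. u\<^sup>2 + w\<^sup>2 \<le> Y} = {}" by simp
    have Z: "indicator {0<..Y} y * arcsine_density y u = 0" for y
      using False by (auto simp: indicator_def arcsine_density_def)
    show ?thesis unfolding E Z by simp
  qed
  define D where "D = (\<lambda>u y. indicator {0<..Y} y * arcsine_density y u)"
  have D_meas [measurable]: "(\<lambda>(u, y). D u y) \<in> borel_measurable (lborel \<Otimes>\<^sub>M lborel)"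
    unfolding D_def by measurable
  have "(\<integral>\<^sup>+u. \<integral>\<^sup>+w. ennreal (h u) * indicator {w. u\<^sup>2 + w\<^sup>2 \<le> Y} w \<partial>lborel \<partial>lborel)
      = (\<integral>\<^sup>+u. ennreal (h u) * (\<integral>\<^sup>+w. indicator {w. u\<^sup>2 + w\<^sup>2 \<le> Y} w \<partial>lborel) \<partial>lborel)"
    by (intro nn_integral_cong nn_integral_cmult) measurable
  also have "\<dots> = (\<integral>\<^sup>+u. ennreal (h u) * (\<integral>\<^sup>+y. D u y \<partial>lborel) \<partial>lborel)"
    unfolding slice D_def ..
  also have "\<dots> = (\<integral>\<^sup>+u. \<integral>\<^sup>+y. ennreal (h u) * D u y \<partial>lborel \<partial>lborel)"
    by (intro nn_integral_cong nn_integral_cmult[symmetric]) measurable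
  also have "\<dots> = (\<integral>\<^sup>+y. \<integral>\<^sup>+u. ennreal (h u) * D u y \<partial>lborel \<partial>lborel)"
    by (rule lborel_pair.Fubini'[symmetric]) measurable
  also have "\<dots> = (\<integral>\<^sup>+y. indicator {0<..Y} y *
        (\<integral>\<^sup>+x. indicator {0..pi} x * ennreal (h (sqrt y * cos x)) \<partial>lborel) \<partial>lborel)"
  proof (rule nn_integral_cong)
    fix y
    show "(\<integral>\<^sup>+u. ennreal (h u) * D u y \<partial>lborel) = indicator {0<..Y} y *
        (\<integral>\<^sup>+x. indicator {0..pi} x * ennreal (h (sqrt y * cos x)) \<partial>lborel)"
    proof (cases "y \<in> {0<..Y}")
      case True
      then show ?thesis
        unfolding D_def using nn_integral_cos_substitution[OF assms, of y] by simp
    next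
      case False
      have I: "indicator {0<..Y} y = (0::ennreal)" using False by (rule indicator_simps(2))
      show ?thesis unfolding D_def I by simp
    qed
  qed
  finally show ?thesis .
qed

lemma powr_third_cube:
  fixes y :: real
  assumes "0 \<le> y"
  shows "(y powr (1 / 3)) ^ 3 = y"
proof (cases "y = 0")
  case False
  then have "(y powr (1 / 3)) ^ 3 = (y powr (1 / 3)) powr 3" by simp
  then show ?thesis using assms by (simp only: powr_powr) simp
qed simp

text \<open>General \<open>g\<close> serves two purposes: the power function gives the centroid
  integral, the constant 1 gives the volume.\<close>

lemma nn_integral_rotbody3:
  fixes g Y :: "real \<Rightarrow> real" and z :: "real ^ 3"
  assumes [measurable]: "Y \<in> borel_measurable borel" "g \<in> borel_measurable borel" and g: "\<And>x. 0 \<le> g x"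
  defines "\<rho> \<equiv> norm (z - (z \<bullet> axis 3 1) *\<^sub>R axis 3 1)" and "\<eta> \<equiv> z \<bullet> axis 3 1"
  shows "(\<integral>\<^sup>+y. ennreal (g (y \<bullet> z)) * indicator (rotbody (axis 3 1) 2 Y H) y \<partial>lborel)
    = (\<integral>\<^sup>+t. indicator {-H..H} t * (\<integral>\<^sup>+y. indicator {0<..Y t} y *
        (\<integral>\<^sup>+x. indicator {0..pi} x * ennreal (g (sqrt y * \<rho> * cos x + t * \<eta>)) \<partial>lborel) \<partial>lborel) \<partial>lborel)"
proof -
  let ?e = "axis 3 1 :: real ^ 3" and ?a = "axis 1 1 :: real ^ 3" and ?b = "axis 2 1 :: real ^ 3"
  have ye: "coords3 t u w \<bullet> ?e = t" for t u w
    by (simp add: inner_add inner_axis_axis)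
  have yz: "coords3 t u w \<bullet> (\<rho> *\<^sub>R ?a + \<eta> *\<^sub>R ?e) = \<rho> * u + t * \<eta>" for t u w
    by (simp add: inner_add inner_axis_axis)
  have "(norm (u *\<^sub>R ?a + w *\<^sub>R ?b))\<^sup>2 = u\<^sup>2 + w\<^sup>2" for u w
    unfolding power2_norm_eq_inner by (simp add: inner_add inner_axis_axis power2_eq_square)
  then have mem: "coords3 t u w \<in> rotbody ?e 2 Y H \<longleftrightarrow> t \<in> {-H..H} \<and> u\<^sup>2 + w\<^sup>2 \<le> Y t" for t u w
    unfolding rotbody_def mem_Collect_eq ye by (auto simp: abs_le_iff)
  have "(\<integral>\<^sup>+y. ennreal (g (y \<bullet> z)) * indicator (rotbody ?e 2 Y H) y \<partial>lborel)
      = (\<integral>\<^sup>+y. ennreal (g (y \<bullet> (\<rho> *\<^sub>R ?a + \<eta> *\<^sub>R ?e))) * indicator (rotbody ?e 2 Y H) y \<partial>lborel)"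
    unfolding \<rho>_def \<eta>_def
    by (rule nn_integral_rotbody_reduce[where g = "\<lambda>x. ennreal (g x)"]) (simp_all add: inner_axis_axis)
  also have "\<dots> = (\<integral>\<^sup>+t. \<integral>\<^sup>+u. \<integral>\<^sup>+w. ennreal (g (coords3 t u w \<bullet> (\<rho> *\<^sub>R ?a + \<eta> *\<^sub>R ?e)))
      * indicator (rotbody ?e 2 Y H) (coords3 t u w) \<partial>lborel \<partial>lborel \<partial>lborel)"
    by (rule nn_integral_real3) measurable
  also have "\<dots> = (\<integral>\<^sup>+t. indicator {-H..H} t * (\<integral>\<^sup>+y. indicator {0<..Y t} y *
        (\<integral>\<^sup>+x. indicator {0..pi} x * ennreal (g (sqrt y * \<rho> * cos x + t * \<eta>)) \<partial>lborel) \<partial>lborel) \<partial>lborel)"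
  proof (rule nn_integral_cong)
    fix t :: real
    have I: "indicator (rotbody ?e 2 Y H) (coords3 t u w) = (indicator {-H..H} t * indicator {w. u\<^sup>2 + w\<^sup>2 \<le> Y t} w :: ennreal)" for u w
      by (simp add: indicator_def mem)
    let ?R = "indicator {-H..H} t * (\<integral>\<^sup>+y. indicator {0<..Y t} y *
        (\<integral>\<^sup>+x. indicator {0..pi} x * ennreal (g (sqrt y * \<rho> * cos x + t * \<eta>)) \<partial>lborel) \<partial>lborel)"
    show "(\<integral>\<^sup>+u. \<integral>\<^sup>+w. ennreal (g (coords3 t u w \<bullet> (\<rho> *\<^sub>R ?a + \<eta> *\<^sub>R ?e)))
        * indicator (rotbody ?e 2 Y H) (coords3 t u w) \<partial>lborel \<partial>lborel) = ?R"
    proof (cases "t \<in> {-H..H}")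
      case True
      then show ?thesis
        unfolding I yz using g nn_integral_disc[where h = "\<lambda>u. g (\<rho> * u + t * \<eta>)" and Y = "Y t"]
        by (simp add: mult.left_commute[of \<rho>] mult.assoc)
    next
      case False
      have J: "indicator {-H..H} t = (0::ennreal)" using False by (rule indicator_simps(2))
      show ?thesis unfolding I J by simp
    qed
  qed
  finally show ?thesis .
qed

text \<open>The slice at \<open>u\<close> is a disc of squared radius
  \<open>q\<^sup>2 - u\<^sup>2\<close>. Beyond the ball both sides vanish, because
  \<open>ennreal\<close> sends negative numbers to 0.\<close>

lemma nn_integral_ball_slices:
  fixes h :: "real \<Rightarrow> real"
  assumes [measurable]: "h \<in> borel_measurable borel" and h: "\<And>u. 0 \<le> h u" and q: "0 \<le> q"
  shows "(\<integral>\<^sup>+u. \<integral>\<^sup>+v. \<integral>\<^sup>+w. ennreal (h u) * indicator {w. u\<^sup>2 + v\<^sup>2 + w\<^sup>2 \<le> q\<^sup>2} w \<partial>lborel \<partial>lborel \<partial>lborel)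
     = (\<integral>\<^sup>+u. ennreal (h u) * ennreal (pi * (q\<^sup>2 - u\<^sup>2)) \<partial>lborel)"
proof (rule nn_integral_cong)
  fix u :: real
  have disc: "(\<integral>\<^sup>+v. \<integral>\<^sup>+w. ennreal 1 * indicator {w. v\<^sup>2 + w\<^sup>2 \<le> q\<^sup>2 - u\<^sup>2} w \<partial>lborel \<partial>lborel)
      = (\<integral>\<^sup>+y. indicator {0<..q\<^sup>2 - u\<^sup>2} y * (\<integral>\<^sup>+x. indicator {0..pi} x * ennreal 1 \<partial>lborel) \<partial>lborel)"
    by (rule nn_integral_disc[where h = "\<lambda>_. 1"]) auto
  have set: "{w. u\<^sup>2 + v\<^sup>2 + w\<^sup>2 \<le> q\<^sup>2} = {w. v\<^sup>2 + w\<^sup>2 \<le> q\<^sup>2 - u\<^sup>2}" for v by auto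
  have "(\<integral>\<^sup>+v. \<integral>\<^sup>+w. ennreal (h u) * indicator {w. u\<^sup>2 + v\<^sup>2 + w\<^sup>2 \<le> q\<^sup>2} w \<partial>lborel \<partial>lborel)
      = (\<integral>\<^sup>+v. ennreal (h u) * (\<integral>\<^sup>+w. ennreal 1 * indicator {w. v\<^sup>2 + w\<^sup>2 \<le> q\<^sup>2 - u\<^sup>2} w \<partial>lborel) \<partial>lborel)"
    unfolding set ennreal_1 mult_1 by (intro nn_integral_cong nn_integral_cmult) measurable
  also have "\<dots> = ennreal (h u) * (\<integral>\<^sup>+v. \<integral>\<^sup>+w. ennreal 1 * indicator {w. v\<^sup>2 + w\<^sup>2 \<le> q\<^sup>2 - u\<^sup>2} w \<partial>lborel \<partial>lborel)"
    unfolding ennreal_1 mult_1 by (intro nn_integral_cmult) measurable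
  also have "(\<integral>\<^sup>+v. \<integral>\<^sup>+w. ennreal 1 * indicator {w. v\<^sup>2 + w\<^sup>2 \<le> q\<^sup>2 - u\<^sup>2} w \<partial>lborel \<partial>lborel)
      = ennreal (pi * (q\<^sup>2 - u\<^sup>2))"
  proof -
    have X: "(\<integral>\<^sup>+x. indicator {0..pi} x * ennreal 1 \<partial>lborel) = ennreal pi"
      by simp
    have E: "emeasure lborel {0<..q\<^sup>2 - u\<^sup>2} = ennreal (q\<^sup>2 - u\<^sup>2)"
      by (cases "0 \<le> q\<^sup>2 - u\<^sup>2") (simp_all add: ennreal_neg)
    have "(\<integral>\<^sup>+y. indicator {0<..q\<^sup>2 - u\<^sup>2} y * ennreal pi \<partial>lborel)
        = (\<integral>\<^sup>+y. indicator {0<..q\<^sup>2 - u\<^sup>2} y \<partial>lborel) * ennreal pi"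
      by (rule nn_integral_multc) measurable
    also have "(\<integral>\<^sup>+y. indicator {0<..q\<^sup>2 - u\<^sup>2} y \<partial>lborel) = ennreal (q\<^sup>2 - u\<^sup>2)"
      using E by (subst nn_integral_indicator) auto
    also have "ennreal (q\<^sup>2 - u\<^sup>2) * ennreal pi = ennreal ((q\<^sup>2 - u\<^sup>2) * pi)"
      by (rule ennreal_mult''[symmetric]) simp
    also have "(q\<^sup>2 - u\<^sup>2) * pi = pi * (q\<^sup>2 - u\<^sup>2)" by (rule mult.commute)
    finally show ?thesis unfolding disc X .
  qed
  finally show "(\<integral>\<^sup>+v. \<integral>\<^sup>+w. ennreal (h u) * indicator {w. u\<^sup>2 + v\<^sup>2 + w\<^sup>2 \<le> q\<^sup>2} w \<partial>lborel \<partial>lborel)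
      = ennreal (h u) * ennreal (pi * (q\<^sup>2 - u\<^sup>2))" .
qed

text \<open>For a sphere of radius \<open>y powr (1 / 3)\<close> the projection onto a line is
  uniform, with density proportional to \<open>y powr (- (1 / 3))\<close>. Integrating over
  \<open>y\<close> from \<open>\<bar>u\<bar> ^ 3\<close> to \<open>Y\<close> produces the area of
  the slice at \<open>u\<close>. The factor \<open>2 * pi / 3\<close> comes from the spherical
  volume element 2 pi r^2 dr dv with y = r^3.\<close>

lemma nn_integral_ball_radial:
  fixes h :: "real \<Rightarrow> real"
  assumes [measurable]: "h \<in> borel_measurable borel" and h: "\<And>u. 0 \<le> h u" and Y: "0 \<le> Y"
  shows "ennreal (2 * pi / 3) * (\<integral>\<^sup>+y. indicator {0<..Y} y *
        (\<integral>\<^sup>+x. indicator {-1..1} x * ennreal (h (y powr (1 / 3) * x)) \<partial>lborel) \<partial>lborel)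
     = (\<integral>\<^sup>+u. ennreal (h u) * ennreal (pi * ((Y powr (1 / 3))\<^sup>2 - u\<^sup>2)) \<partial>lborel)"
proof -
  let ?X = "\<lambda>y. \<integral>\<^sup>+x. indicator {-1..1} x * ennreal (h (y powr (1 / 3) * x)) \<partial>lborel"
  let ?q = "Y powr (1 / 3)"
  define D where "D = (\<lambda>u y. if 0 < y \<and> y \<le> Y \<and> \<bar>u\<bar> \<le> y powr (1 / 3) then ennreal (y powr (- (1 / 3))) else 0)"
  have D_meas [measurable]: "(\<lambda>(u, y). D u y) \<in> borel_measurable (lborel \<Otimes>\<^sub>M lborel)"
    unfolding D_def by measurable
  have inner: "indicator {0<..Y} y * ?X y
      = (\<integral>\<^sup>+u. ennreal (h u) * D u y \<partial>lborel)" for y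
  proof (cases "y \<in> {0<..Y}")
    case True
    define c where "c = y powr (1 / 3)"
    have c: "0 < c" using True by (simp add: c_def)
    have ci: "y powr (- (1 / 3)) = 1 / c"
      using powr_minus_divide[of y "1 / 3"] by (simp add: c_def)
    have "(\<integral>\<^sup>+u. ennreal (h u) * D u y \<partial>lborel) = c * (\<integral>\<^sup>+x. ennreal (h (0 + c * x)) * D (0 + c * x) y \<partial>lborel)"
      using c by (subst nn_integral_real_affine[where c = c and t = 0]) auto
    also have "\<dots> = (\<integral>\<^sup>+x. ennreal c * (ennreal (h (0 + c * x)) * D (0 + c * x) y) \<partial>lborel)"
      by (rule nn_integral_cmult[symmetric]) measurable
    also have "\<dots> = ?X y"
    proof (rule nn_integral_cong)
      fix x :: real
      have m: "\<bar>c * x\<bar> \<le> c \<longleftrightarrow> x \<in> {-1..1}"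
        using c by (simp add: abs_mult abs_le_iff) linarith
      show "ennreal c * (ennreal (h (0 + c * x)) * D (0 + c * x) y) = indicator {-1..1} x * ennreal (h (y powr (1 / 3) * x))"
      proof (cases "x \<in> {-1..1}")
        case xT: True
        then have d: "D (0 + c * x) y = ennreal (1 / c)"
          using m True by (simp add: D_def c_def[symmetric] ci)
        have "ennreal (h (c * x)) * ennreal (1 / c) = ennreal (h (c * x) * (1 / c))"
          using c h by (intro ennreal_mult[symmetric]) auto
        moreover have "ennreal c * ennreal (h (c * x) * (1 / c)) = ennreal (c * (h (c * x) * (1 / c)))"
          using c h by (intro ennreal_mult[symmetric]) auto
        ultimately have "ennreal c * (ennreal (h (c * x)) * ennreal (1 / c)) = ennreal (c * (h (c * x) * (1 / c)))"
          by (simp only:)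
        also have "c * (h (c * x) * (1 / c)) = h (c * x)" using c by simp
        finally show ?thesis unfolding d using xT by (simp add: c_def)
      next
        case xF: False
        then have d: "D (0 + c * x) y = 0"
          using m by (simp add: D_def c_def[symmetric])
        have I: "indicator {-1..1} x = (0::ennreal)" using xF by (rule indicator_simps(2))
        show ?thesis unfolding d I by simp
      qed
    qed
    finally show ?thesis using True by (simp only: indicator_simps mult_1)
  next
    case False
    then have d: "D u y = 0" for u by (auto simp: D_def)
    have I: "indicator {0<..Y} y = (0::ennreal)" using False by (rule indicator_simps(2))
    show ?thesis unfolding d I by simp
  qed
  \<comment> \<open>The point \<open>u = 0\<close> is left out so that the antiderivative is used
    only at positive \<open>y\<close>; it is a null set for the integral in
    \<open>u\<close>.\<close>
  have outer: "(\<integral>\<^sup>+y. D u y \<partial>lborel) = ennreal (3 / 2 * (?q\<^sup>2 - u\<^sup>2))" if u: "u \<noteq> 0" for u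
  proof -
    have cube: "\<bar>u\<bar> ^ 3 \<le> y \<longleftrightarrow> \<bar>u\<bar> \<le> y powr (1 / 3)" if "0 \<le> y" for y
    proof -
      show ?thesis
        using power_mono_iff[of "\<bar>u\<bar>" "y powr (1 / 3)" 3] powr_third_cube[OF that] by simp
    qed
    have u3: "0 < \<bar>u\<bar> ^ 3" using u by simp
    have Deq: "D u y = ennreal (y powr (- (1 / 3))) * indicator {\<bar>u\<bar> ^ 3..Y} y" for y
    proof (cases "0 < y")
      case True
      then show ?thesis using cube[of y] by (auto simp: D_def)
    next
      case False
      then have "y \<notin> {\<bar>u\<bar> ^ 3..Y}" using u3 unfolding atLeastAtMost_iff by linarith
      then show ?thesis using False by (simp add: D_def)
    qed
    have F: "(\<bar>u\<bar> ^ 3) powr (2 / 3) = u\<^sup>2" "Y powr (2 / 3) = ?q\<^sup>2"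
    proof -
      have "\<bar>u\<bar> ^ 3 = \<bar>u\<bar> powr 3" using u by simp
      then have "(\<bar>u\<bar> ^ 3) powr (2 / 3) = \<bar>u\<bar> powr 2" by (simp only: powr_powr) simp
      then show "(\<bar>u\<bar> ^ 3) powr (2 / 3) = u\<^sup>2" using u by simp
      show "Y powr (2 / 3) = ?q\<^sup>2"
      proof (cases "Y = 0")
        case False
        then have "?q\<^sup>2 = (?q) powr 2" by simp
        then show ?thesis by (simp only: powr_powr) simp
      qed simp
    qed
    show ?thesis
    proof (cases "\<bar>u\<bar> ^ 3 \<le> Y")
      case True
      have "(\<integral>\<^sup>+y. ennreal (y powr (- (1 / 3))) * indicator {\<bar>u\<bar> ^ 3..Y} y \<partial>lborel)
          = 3 / 2 * Y powr (2 / 3) - 3 / 2 * (\<bar>u\<bar> ^ 3) powr (2 / 3)"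
      proof (rule nn_integral_FTC_Icc)
        fix y assume "y \<in> {\<bar>u\<bar> ^ 3..Y}"
        then have "0 < y" using u3 unfolding atLeastAtMost_iff by linarith
        then have "((\<lambda>y. 3 / 2 * y powr (2 / 3)) has_real_derivative 3 / 2 * (2 / 3 * y powr (2 / 3 - 1))) (at y)"
          by (intro DERIV_cmult has_real_derivative_powr)
        then show "((\<lambda>y. 3 / 2 * y powr (2 / 3)) has_real_derivative y powr (- (1 / 3))) (at y)"
          by simp
      qed (use True in auto)
      then show ?thesis unfolding Deq F by (simp add: algebra_simps)
    next
      case False
      then have E: "indicator {\<bar>u\<bar> ^ 3..Y} y = (0::ennreal)" for y by simp
      have "\<not> \<bar>u\<bar> \<le> ?q" using False cube[OF Y] by simp
      then have "?q\<^sup>2 \<le> \<bar>u\<bar>\<^sup>2" by (intro power_mono) auto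
      then have "3 / 2 * (?q\<^sup>2 - u\<^sup>2) \<le> 0" by simp
      then have "ennreal (3 / 2 * (?q\<^sup>2 - u\<^sup>2)) = 0" by (rule ennreal_neg)
      then show ?thesis unfolding Deq E by simp
    qed
  qed
  have "(\<integral>\<^sup>+y. indicator {0<..Y} y * ?X y \<partial>lborel)
      = (\<integral>\<^sup>+y. \<integral>\<^sup>+u. ennreal (h u) * D u y \<partial>lborel \<partial>lborel)"
    unfolding inner ..
  also have "\<dots> = (\<integral>\<^sup>+u. \<integral>\<^sup>+y. ennreal (h u) * D u y \<partial>lborel \<partial>lborel)"
    by (rule lborel_pair.Fubini') measurable
  also have "\<dots> = (\<integral>\<^sup>+u. ennreal (h u) * (\<integral>\<^sup>+y. D u y \<partial>lborel) \<partial>lborel)"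
    by (intro nn_integral_cong nn_integral_cmult) measurable
  also have "\<dots> = (\<integral>\<^sup>+u. ennreal (h u) * ennreal (3 / 2 * (?q\<^sup>2 - u\<^sup>2)) \<partial>lborel)"
  proof (rule nn_integral_cong_AE)
    have "AE u in lborel. u \<noteq> (0::real)" by (rule AE_lborel_singleton)
    then show "AE u in lborel. ennreal (h u) * (\<integral>\<^sup>+y. D u y \<partial>lborel)
        = ennreal (h u) * ennreal (3 / 2 * (?q\<^sup>2 - u\<^sup>2))"
    proof eventually_elim
      case (elim u)
      show ?case unfolding outer[OF elim] ..
    qed
  qed
  finally have "ennreal (2 * pi / 3) * (\<integral>\<^sup>+y. indicator {0<..Y} y * ?X y \<partial>lborel)
      = ennreal (2 * pi / 3) * (\<integral>\<^sup>+u. ennreal (h u) * ennreal (3 / 2 * (?q\<^sup>2 - u\<^sup>2)) \<partial>lborel)"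
    by simp
  also have "\<dots> = (\<integral>\<^sup>+u. ennreal (2 * pi / 3) * (ennreal (h u) * ennreal (3 / 2 * (?q\<^sup>2 - u\<^sup>2))) \<partial>lborel)"
    by (rule nn_integral_cmult[symmetric]) measurable
  also have "\<dots> = (\<integral>\<^sup>+u. ennreal (h u) * ennreal (pi * (?q\<^sup>2 - u\<^sup>2)) \<partial>lborel)"
  proof (rule nn_integral_cong)
    fix u :: real
    have "ennreal (2 * pi / 3) * ennreal (3 / 2 * (?q\<^sup>2 - u\<^sup>2))
        = ennreal (2 * pi / 3 * (3 / 2 * (?q\<^sup>2 - u\<^sup>2)))"
      by (rule ennreal_mult'[symmetric]) simp
    also have "2 * pi / 3 * (3 / 2 * (?q\<^sup>2 - u\<^sup>2)) = pi * (?q\<^sup>2 - u\<^sup>2)"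
      by simp
    finally show "ennreal (2 * pi / 3) * (ennreal (h u) * ennreal (3 / 2 * (?q\<^sup>2 - u\<^sup>2)))
        = ennreal (h u) * ennreal (pi * (?q\<^sup>2 - u\<^sup>2))"
      by (simp only: mult.left_commute)
  qed
  finally show ?thesis .
qed


lemma nn_integral_rotbody4:
  fixes g Y :: "real \<Rightarrow> real" and z :: "real ^ 4"
  assumes [measurable]: "Y \<in> borel_measurable borel" "g \<in> borel_measurable borel" and g: "\<And>x. 0 \<le> g x"
  defines "\<rho> \<equiv> norm (z - (z \<bullet> axis 4 1) *\<^sub>R axis 4 1)" and "\<eta> \<equiv> z \<bullet> axis 4 1"
  shows "(\<integral>\<^sup>+y. ennreal (g (y \<bullet> z)) * indicator (rotbody (axis 4 1) 3 Y H) y \<partial>lborel)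
    = (\<integral>\<^sup>+t. indicator {-H..H} t * (ennreal (2 * pi / 3) * (\<integral>\<^sup>+y. indicator {0<..Y t} y *
        (\<integral>\<^sup>+x. indicator {-1..1} x * ennreal (g (y powr (1 / 3) * \<rho> * x + t * \<eta>)) \<partial>lborel) \<partial>lborel)) \<partial>lborel)"
proof -
  let ?e = "axis 4 1 :: real ^ 4" and ?a = "axis 1 1 :: real ^ 4" and ?b = "axis 2 1 :: real ^ 4" and ?c = "axis 3 1 :: real ^ 4"
  have ye: "coords4 t u v w \<bullet> ?e = t" for t u v w
    by (simp add: inner_add inner_axis_axis)
  have yz: "coords4 t u v w \<bullet> (\<rho> *\<^sub>R ?a + \<eta> *\<^sub>R ?e) = \<rho> * u + t * \<eta>" for t u v w
    by (simp add: inner_add inner_axis_axis)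
  have nrm: "(norm (u *\<^sub>R ?a + v *\<^sub>R ?b + w *\<^sub>R ?c))\<^sup>2 = u\<^sup>2 + v\<^sup>2 + w\<^sup>2" for u v w
    unfolding power2_norm_eq_inner by (simp add: inner_add inner_axis_axis power2_eq_square)
  \<comment> \<open>The squared cube root is nonnegative whatever the sign of \<open>Y t\<close>, so
    negative profile values are excluded separately.\<close>
  have mem: "coords4 t u v w \<in> rotbody ?e 3 Y H
      \<longleftrightarrow> t \<in> {-H..H} \<and> 0 \<le> Y t \<and> u\<^sup>2 + v\<^sup>2 + w\<^sup>2 \<le> (Y t powr (1 / 3))\<^sup>2" for t u v w
  proof -
    define n where "n = norm (u *\<^sub>R ?a + v *\<^sub>R ?b + w *\<^sub>R ?c)"
    have n: "0 \<le> n" by (simp add: n_def)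
    have "n ^ 3 \<le> Y t \<longleftrightarrow> 0 \<le> Y t \<and> n\<^sup>2 \<le> (Y t powr (1 / 3))\<^sup>2"
    proof (cases "0 \<le> Y t")
      case True
      have "n ^ 3 \<le> Y t \<longleftrightarrow> n \<le> Y t powr (1 / 3)"
        using power_mono_iff[of n "Y t powr (1 / 3)" 3] powr_third_cube[OF True] n by simp
      also have "\<dots> \<longleftrightarrow> n\<^sup>2 \<le> (Y t powr (1 / 3))\<^sup>2"
        using power_mono_iff[of n "Y t powr (1 / 3)" 2] n by simp
      finally show ?thesis using True by simp
    next
      case False
      then show ?thesis using zero_le_power[OF n, of 3] by linarith
    qed
    moreover have "coords4 t u v w - t *\<^sub>R ?e = u *\<^sub>R ?a + v *\<^sub>R ?b + w *\<^sub>R ?c" by simp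
    ultimately show ?thesis
      unfolding rotbody_def mem_Collect_eq ye n_def nrm by (simp add: abs_le_iff) argo
  qed
  have "(\<integral>\<^sup>+y. ennreal (g (y \<bullet> z)) * indicator (rotbody ?e 3 Y H) y \<partial>lborel)
      = (\<integral>\<^sup>+y. ennreal (g (y \<bullet> (\<rho> *\<^sub>R ?a + \<eta> *\<^sub>R ?e))) * indicator (rotbody ?e 3 Y H) y \<partial>lborel)"
    unfolding \<rho>_def \<eta>_def
    by (rule nn_integral_rotbody_reduce[where g = "\<lambda>x. ennreal (g x)"]) (simp_all add: inner_axis_axis)
  also have "\<dots> = (\<integral>\<^sup>+t. \<integral>\<^sup>+u. \<integral>\<^sup>+v. \<integral>\<^sup>+w. ennreal (g (coords4 t u v w \<bullet> (\<rho> *\<^sub>R ?a + \<eta> *\<^sub>R ?e)))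
      * indicator (rotbody ?e 3 Y H) (coords4 t u v w) \<partial>lborel \<partial>lborel \<partial>lborel \<partial>lborel)"
    by (rule nn_integral_real4) measurable
  also have "\<dots> = (\<integral>\<^sup>+t. indicator {-H..H} t * (ennreal (2 * pi / 3) * (\<integral>\<^sup>+y. indicator {0<..Y t} y *
        (\<integral>\<^sup>+x. indicator {-1..1} x * ennreal (g (y powr (1 / 3) * \<rho> * x + t * \<eta>)) \<partial>lborel) \<partial>lborel)) \<partial>lborel)"
  proof (rule nn_integral_cong)
    fix t :: real
    let ?R = "indicator {-H..H} t * (ennreal (2 * pi / 3) * (\<integral>\<^sup>+y. indicator {0<..Y t} y *
        (\<integral>\<^sup>+x. indicator {-1..1} x * ennreal (g (y powr (1 / 3) * \<rho> * x + t * \<eta>)) \<partial>lborel) \<partial>lborel))"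
    show "(\<integral>\<^sup>+u. \<integral>\<^sup>+v. \<integral>\<^sup>+w. ennreal (g (coords4 t u v w \<bullet> (\<rho> *\<^sub>R ?a + \<eta> *\<^sub>R ?e)))
        * indicator (rotbody ?e 3 Y H) (coords4 t u v w) \<partial>lborel \<partial>lborel \<partial>lborel) = ?R"
    proof (cases "t \<in> {-H..H} \<and> 0 \<le> Y t")
      case True
      then have I: "indicator (rotbody ?e 3 Y H) (coords4 t u v w)
          = (indicator {w. u\<^sup>2 + v\<^sup>2 + w\<^sup>2 \<le> (Y t powr (1 / 3))\<^sup>2} w :: ennreal)" for u v w
        by (simp add: indicator_def mem)
      have "(\<integral>\<^sup>+u. \<integral>\<^sup>+v. \<integral>\<^sup>+w. ennreal (g (\<rho> * u + t * \<eta>))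
          * indicator {w. u\<^sup>2 + v\<^sup>2 + w\<^sup>2 \<le> (Y t powr (1 / 3))\<^sup>2} w \<partial>lborel \<partial>lborel \<partial>lborel)
        = (\<integral>\<^sup>+u. ennreal (g (\<rho> * u + t * \<eta>)) * ennreal (pi * ((Y t powr (1 / 3))\<^sup>2 - u\<^sup>2)) \<partial>lborel)"
        by (rule nn_integral_ball_slices[where h = "\<lambda>u. g (\<rho> * u + t * \<eta>)"]) (auto simp: g)
      also have "\<dots> = ennreal (2 * pi / 3) * (\<integral>\<^sup>+y. indicator {0<..Y t} y *
          (\<integral>\<^sup>+x. indicator {-1..1} x * ennreal (g (\<rho> * (y powr (1 / 3) * x) + t * \<eta>)) \<partial>lborel) \<partial>lborel)"
        using True by (intro nn_integral_ball_radial[where h = "\<lambda>u. g (\<rho> * u + t * \<eta>)", symmetric]) (auto simp: g)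
      finally show ?thesis
        unfolding I yz using True by (simp only: indicator_simps mult_1 mult.left_commute[of \<rho>] mult.assoc)
    next
      case False
      then have "coords4 t u v w \<notin> rotbody ?e 3 Y H" for u v w
        unfolding mem by blast
      then have I: "indicator (rotbody ?e 3 Y H) (coords4 t u v w) = (0 :: ennreal)" for u v w
        by simp
      have "?R = 0"
      proof (cases "t \<in> {-H..H}")
        case True
        then have J: "indicator {0<..Y t} y = (0::ennreal)" for y using False by simp
        show ?thesis unfolding J by simp
      next
        case False
        then have J: "indicator {-H..H} t = (0::ennreal)" by (rule indicator_simps(2))
        show ?thesis unfolding J by simp
      qed
      then show ?thesis unfolding I by simp
    qed
  qed
  finally show ?thesis .
qed

section \<open>The counterexamples\<close>

lemma nn_integral_indicator_eq_set_integral: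
  fixes f :: "'a \<Rightarrow> real"
  assumes "set_integrable M A f" "\<And>x. x \<in> A \<Longrightarrow> 0 \<le> f x"
  shows "(\<integral>\<^sup>+x. indicator A x * ennreal (f x) \<partial>M) = ennreal (LINT x:A|M. f x)"
proof -
  have "(\<integral>\<^sup>+x. ennreal (indicator A x *\<^sub>R f x) \<partial>M) = ennreal (\<integral>x. indicator A x *\<^sub>R f x \<partial>M)"
    using assms unfolding set_integrable_def
    by (intro nn_integral_eq_integral) (auto simp: indicator_def)
  moreover have "ennreal (indicator A x *\<^sub>R f x) = indicator A x * ennreal (f x)" for x
    by (simp add: indicator_def)
  ultimately show ?thesis
    by (simp add: set_lebesgue_integral_def)
qed

lemma nn_integral_has_integral_Icc:
  fixes f :: "real \<Rightarrow> real"
  assumes [measurable]: "f \<in> borel_measurable borel" and "\<And>x. 0 \<le> f x" and "(f has_integral I) {a..b}"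
  shows "(\<integral>\<^sup>+x. indicator {a..b} x * ennreal (f x) \<partial>lborel) = ennreal I"
proof -
  have "((\<lambda>x. if x \<in> {a..b} then f x else 0) has_integral I) UNIV"
    using assms(3) by (subst has_integral_restrict_UNIV)
  moreover have "(\<lambda>x. if x \<in> {a..b} then f x else 0) = (\<lambda>x. indicator {a..b} x * f x)"
    by (auto simp: fun_eq_iff indicator_def)
  ultimately have "((\<lambda>x. indicator {a..b} x * f x) has_integral I) UNIV" by simp
  then have "(\<integral>\<^sup>+x. ennreal (indicator {a..b} x * f x) \<partial>lborel) = ennreal I"
    using assms(2) by (intro nn_integral_has_integral_lborel) auto
  moreover have "ennreal (indicator {a..b} x * f x) = indicator {a..b} x * ennreal (f x)" for x
    by (simp add: indicator_def)
  ultimately show ?thesis by simp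
qed

lemma nn_integral_circle_kernel:
  assumes "0 < q" "q < 1"
  shows "(\<integral>\<^sup>+x. indicator {0..pi} x * ennreal (\<bar>r * cos x + s\<bar> powr q) \<partial>lborel) = ennreal (circle_kernel q r s)"
  using integrable_integral[OF circle_kernel_integrable[OF assms, of r s 0 pi]]
  by (intro nn_integral_has_integral_Icc) (auto simp: circle_kernel_def)

text \<open>The substitution of \<open>pi - x\<close> for \<open>x\<close> changes the sign of the
  cosine. Evenness folds negative heights onto the nonnegative offsets for which the kernel
  conditions are formulated.\<close>

lemma circle_kernel_abs:
  assumes "0 < q" "q < 1"
  shows "circle_kernel q r \<bar>s\<bar> = circle_kernel q r s"
proof -
  have "circle_kernel q r (- s) = circle_kernel q r s" for s
  proof -
    have "circle_kernel q r (- s) = integral {0..pi} (\<lambda>x. \<bar>r * cos (pi - x) + s\<bar> powr q)"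
    proof -
      have "\<bar>r * cos x + - s\<bar> = \<bar>r * cos (pi - x) + s\<bar>" for x
        using abs_minus_cancel[of "r * cos x - s"] by simp
      then show ?thesis by (simp only: circle_kernel_def)
    qed
    also have "\<dots> = integral {- pi + pi..0 + pi} (\<lambda>x. \<bar>r * cos (pi - x) + s\<bar> powr q)" by simp
    also have "\<dots> = integral {- pi..0} ((\<lambda>x. \<bar>r * cos (pi - x) + s\<bar> powr q) \<circ> (+) pi)"
      by (rule integral_shift_Icc_real[symmetric])
    also have "\<dots> = integral {- pi..- 0} (\<lambda>x. \<bar>r * cos (- x) + s\<bar> powr q)"
      by (simp add: o_def add.commute)
    also have "\<dots> = integral {0..pi} (\<lambda>x. \<bar>r * cos x + s\<bar> powr q)"
      by (rule Henstock_Kurzweil_Integration.integral_reflect_real)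
    finally show ?thesis by (simp add: circle_kernel_def)
  qed
  then show ?thesis by (cases "0 \<le> s") (auto simp: abs_if)
qed

lemma interval_kernel_abs: "interval_kernel p r \<bar>s\<bar> = interval_kernel p r s"
proof -
  have P: "signed_powr p (- x) = - signed_powr p x" for x
    by (simp add: signed_powr_def sgn_minus)
  have "interval_kernel p r (- s) = interval_kernel p r s" for s
    using P[of "s - r"] P[of "s + r"] by (simp add: interval_kernel_def)
  then show ?thesis by (cases "0 \<le> s") (auto simp: abs_if)
qed

text \<open>The fundamental theorem with one exceptional point: at \<open>- s / r\<close> the
  integrand is singular, but the antiderivative stays continuous.\<close>

lemma nn_integral_interval_kernel:
  assumes p: "- 1 < p" "p < 0" and "0 \<le> r"
  shows "(\<integral>\<^sup>+x. indicator {-1..1} x * ennreal (\<bar>r * x + s\<bar> powr p) \<partial>lborel) = ennreal (interval_kernel p r s)"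
proof (rule nn_integral_has_integral_Icc)
  show "((\<lambda>x. \<bar>r * x + s\<bar> powr p) has_integral interval_kernel p r s) {-1..1}"
  proof (cases "r = 0")
    case True
    then show ?thesis
      using has_integral_const_real[of "\<bar>s\<bar> powr p" "-1" 1] by (simp add: interval_kernel_def)
  next
    case False
    then have r: "0 < r" using assms by simp
    have "((\<lambda>x. \<bar>r * x + s\<bar> powr p) has_integral signed_powr p (r * 1 + s) / r - signed_powr p (r * (-1) + s) / r) {-1..1}"
    proof (rule fundamental_theorem_of_calculus_strong[where S = "{- s / r}" and f = "\<lambda>x. signed_powr p (r * x + s) / r"])
      show "((\<lambda>x. signed_powr p (r * x + s) / r) has_vector_derivative \<bar>r * x + s\<bar> powr p) (at x)"
        if "x \<in> {-1..1} - {- s / r}" for x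
      proof -
        have "r * x + s \<noteq> 0" using that r by (auto simp: field_simps add_eq_0_iff)
        then have "(signed_powr p has_real_derivative \<bar>r * x + s\<bar> powr p) (at (r * x + s))"
          using signed_powr_deriv[OF p] by blast
        moreover have "((\<lambda>x. r * x + s) has_real_derivative r) (at x)"
          by (auto intro!: derivative_eq_intros)
        ultimately have "((\<lambda>x. signed_powr p (r * x + s)) has_real_derivative \<bar>r * x + s\<bar> powr p * r) (at x)"
          by (rule DERIV_chain2)
        then have "((\<lambda>x. signed_powr p (r * x + s) / r) has_real_derivative \<bar>r * x + s\<bar> powr p * r / r) (at x)"
          by (rule DERIV_cdivide)
        then show ?thesis using r by (simp add: has_real_derivative_iff_has_vector_derivative)
      qed
      show "continuous_on {-1..1} (\<lambda>x. signed_powr p (r * x + s) / r)"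
        using r by (intro continuous_intros continuous_on_signed_powr[OF p]) auto
    qed auto
    then show ?thesis using r by (simp add: interval_kernel_def diff_divide_distrib add.commute)
  qed
qed auto

section \<open>Geometry of the solids and positivity of their moments\<close>

lemma rotbody_origin_symmetric:
  assumes "\<And>t. Y (- t) = Y t"
  shows "origin_symmetric (rotbody e k Y H)"
proof -
  have "norm (- y - (- y \<bullet> e) *\<^sub>R e) = norm (y - (y \<bullet> e) *\<^sub>R e)" for y
    using norm_minus_cancel[of "y - (y \<bullet> e) *\<^sub>R e"] by simp
  then have "- y \<in> rotbody e k Y H \<longleftrightarrow> y \<in> rotbody e k Y H" for y
    using assms by (simp add: rotbody_def)
  then show ?thesis
    unfolding origin_symmetric_def by (force simp: image_iff)
qed

text \<open>The distance \<open>N\<close> from the axis is a seminorm, its k-th power is convex, and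
  the profile is concave because \<open>d \<ge> 0\<close>; the interior contains 0. Boundedness uses
  that \<open>N y > 1\<close> implies \<open>N y \<le> N y ^ k \<le> c\<close>.\<close>

lemma rotbody_convex_body:
  fixes e :: "'a::euclidean_space" and c d H :: real
  assumes e: "norm e = 1" and "0 < c" "0 \<le> d" "0 < H" "0 < k"
  shows "convex_body (rotbody e k (\<lambda>t. c - d * \<bar>t\<bar>) H)"
proof -
  define N where "N = (\<lambda>y. norm (y - (y \<bullet> e) *\<^sub>R e))"
  let ?B = "rotbody e k (\<lambda>t. c - d * \<bar>t\<bar>) H"
  have B: "?B = {y. N y ^ k \<le> c - d * \<bar>y \<bullet> e\<bar> \<and> \<bar>y \<bullet> e\<bar> \<le> H}"
    by (simp add: rotbody_def N_def)
  have N0: "0 \<le> N y" for y by (simp add: N_def)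
  have Nc: "continuous_on UNIV N" unfolding N_def by (intro continuous_intros)
  have "closed ?B"
  proof -
    have "closed {y. N y ^ k \<le> c - d * \<bar>y \<bullet> e\<bar>}" "closed {y. \<bar>y \<bullet> e\<bar> \<le> H}"
      by (intro closed_Collect_le continuous_intros Nc)+
    moreover have "?B = {y. N y ^ k \<le> c - d * \<bar>y \<bullet> e\<bar>} \<inter> {y. \<bar>y \<bullet> e\<bar> \<le> H}"
      unfolding B by blast
    ultimately show ?thesis by (simp only: closed_Int)
  qed
  moreover have "bounded ?B"
  proof (rule boundedI)
    fix y assume "y \<in> ?B"
    then have y: "N y ^ k \<le> c - d * \<bar>y \<bullet> e\<bar>" "\<bar>y \<bullet> e\<bar> \<le> H" unfolding B by auto
    have "N y \<le> 1 + c"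
    proof (cases "N y \<le> 1")
      case True then show ?thesis using \<open>0 < c\<close> by linarith
    next
      case False
      then have "N y ^ 1 \<le> N y ^ k" using \<open>0 < k\<close> by (intro power_increasing) auto
      moreover have "0 \<le> d * \<bar>y \<bullet> e\<bar>" using \<open>0 \<le> d\<close> by simp
      ultimately show ?thesis using y unfolding power_one_right by linarith
    qed
    moreover have "norm y \<le> N y + norm ((y \<bullet> e) *\<^sub>R e)"
      using norm_triangle_ineq[of "y - (y \<bullet> e) *\<^sub>R e" "(y \<bullet> e) *\<^sub>R e"] by (simp add: N_def)
    ultimately show "norm y \<le> 1 + c + H" using y e by simp
  qed
  ultimately have "compact ?B" by (simp add: compact_eq_bounded_closed)
  moreover have "convex ?B"
  proof (rule convexI)
    fix x y and u v :: real
    assume xy: "x \<in> ?B" "y \<in> ?B" and uv: "0 \<le> u" "0 \<le> v" "u + v = 1"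
    let ?z = "u *\<^sub>R x + v *\<^sub>R y"
    have "?z - (?z \<bullet> e) *\<^sub>R e = u *\<^sub>R (x - (x \<bullet> e) *\<^sub>R e) + v *\<^sub>R (y - (y \<bullet> e) *\<^sub>R e)"
      by (simp add: algebra_simps)
    then have "N ?z \<le> norm (u *\<^sub>R (x - (x \<bullet> e) *\<^sub>R e)) + norm (v *\<^sub>R (y - (y \<bullet> e) *\<^sub>R e))"
      unfolding N_def by (simp only: norm_triangle_ineq)
    then have "N ?z \<le> u * N x + v * N y" using uv by (simp add: N_def)
    then have "N ?z ^ k \<le> (u * N x + v * N y) ^ k" using N0 by (intro power_mono) auto
    also have "\<dots> \<le> u * N x ^ k + v * N y ^ k"
    proof -
      have "convex_on {0..} (\<lambda>x::real. x ^ k)"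
        using convex_power_even[of k] convex_power_odd[of k]
        by (cases "even k") (auto intro: convex_on_subset)
      moreover have u: "u = 1 - v" using uv by simp
      ultimately show ?thesis
        using convex_onD[of "{0..}" "\<lambda>x::real. x ^ k" v "N x" "N y"] uv N0 unfolding u by simp
    qed
    finally have 1: "N ?z ^ k \<le> u * N x ^ k + v * N y ^ k" .
    have 2: "\<bar>?z \<bullet> e\<bar> \<le> u * \<bar>x \<bullet> e\<bar> + v * \<bar>y \<bullet> e\<bar>"
      using abs_triangle_ineq[of "u * (x \<bullet> e)" "v * (y \<bullet> e)"] uv by (simp add: inner_add_left abs_mult)
    have x: "N x ^ k \<le> c - d * \<bar>x \<bullet> e\<bar>" "\<bar>x \<bullet> e\<bar> \<le> H" and y: "N y ^ k \<le> c - d * \<bar>y \<bullet> e\<bar>" "\<bar>y \<bullet> e\<bar> \<le> H"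
      using xy unfolding B by auto
    have "u * N x ^ k + v * N y ^ k \<le> u * (c - d * \<bar>x \<bullet> e\<bar>) + v * (c - d * \<bar>y \<bullet> e\<bar>)"
      using x y uv by (intro add_mono mult_left_mono) auto
    also have "\<dots> = (u + v) * c - d * (u * \<bar>x \<bullet> e\<bar> + v * \<bar>y \<bullet> e\<bar>)" by (simp add: algebra_simps)
    also have "\<dots> \<le> c - d * \<bar>?z \<bullet> e\<bar>"
      using mult_left_mono[OF 2 \<open>0 \<le> d\<close>] uv by simp
    finally have 3: "N ?z ^ k \<le> c - d * \<bar>?z \<bullet> e\<bar>" using 1 by linarith
    have "u * \<bar>x \<bullet> e\<bar> + v * \<bar>y \<bullet> e\<bar> \<le> u * H + v * H"
      using x y uv by (intro add_mono mult_left_mono) auto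
    also have "\<dots> = H" using uv by (simp add: distrib_right[symmetric])
    finally show "?z \<in> ?B" using 2 3 unfolding B by simp
  qed
  moreover have "interior ?B \<noteq> {}"
  proof -
    let ?U = "{y. N y ^ k < c - d * \<bar>y \<bullet> e\<bar>} \<inter> {y. \<bar>y \<bullet> e\<bar> < H}"
    have "open ?U"
      by (intro open_Int open_Collect_less continuous_intros Nc)
    moreover have "?U \<subseteq> ?B" unfolding B by auto
    ultimately have "?U \<subseteq> interior ?B" by (simp add: interior_maximal)
    moreover have "0 \<in> ?U" using assms by (simp add: N_def zero_power)
    ultimately show ?thesis by blast
  qed
  ultimately show ?thesis by (simp add: convex_body_def)
qed

text \<open>The integrand vanishes only on a hyperplane. Positivity matters for negative
  \<open>p\<close>: there the outer power \<open>1 / p\<close> is antitone on positive numbers, but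
  0 is sent to 0.\<close>

lemma set_integral_abs_inner_pos:
  fixes K :: "'a::euclidean_space set"
  assumes K: "K \<in> lmeasurable" "0 < vol K" and z: "z \<noteq> 0"
    and int: "set_integrable lebesgue K (\<lambda>x. \<bar>x \<bullet> z\<bar> powr p)"
  shows "0 < (LINT x:K|lebesgue. \<bar>x \<bullet> z\<bar> powr p)"
proof -
  let ?f = "\<lambda>x. indicator K x *\<^sub>R (\<bar>x \<bullet> z\<bar> powr p)"
  have "0 \<le> integral\<^sup>L lebesgue ?f"
    by (intro Bochner_Integration.integral_nonneg) auto
  moreover have "integral\<^sup>L lebesgue ?f \<noteq> 0"
  proof
    assume "integral\<^sup>L lebesgue ?f = 0"
    then have "AE x in lebesgue. ?f x = 0"
      using int unfolding set_integrable_def by (subst (asm) integral_nonneg_eq_0_iff_AE) auto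
    moreover have "AE x in lebesgue. x \<notin> {x. z \<bullet> x = 0}"
      using negligible_hyperplane[of z 0] z
      by (intro AE_not_in) (simp add: negligible_iff_null_sets)
    ultimately have "AE x in lebesgue. x \<notin> K"
      by eventually_elim (auto simp: indicator_def inner_commute split: if_splits)
    then have "K \<in> null_sets lebesgue"
      using K(1) by (subst AE_iff_null_sets) (auto simp: fmeasurableD)
    then show False using K(2) by (simp add: measure_def null_setsD1)
  qed
  ultimately show ?thesis unfolding set_lebesgue_integral_def by linarith
qed

lemma nn_integral_even:
  fixes F :: "real \<Rightarrow> ennreal"
  assumes [measurable]: "F \<in> borel_measurable borel" and even: "\<And>t. F (- t) = F t"
  shows "(\<integral>\<^sup>+t. indicator {-H..H} t * F t \<partial>lborel) = 2 * (\<integral>\<^sup>+t. indicator {0<..H} t * F t \<partial>lborel)"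
proof -
  have "(\<integral>\<^sup>+t. indicator {-H..H} t * F t \<partial>lborel)
      = (\<integral>\<^sup>+t. indicator {0<..H} t * F t + indicator {0<..H} (- t) * F t \<partial>lborel)"
  proof (rule nn_integral_cong_AE)
    have "AE t in lborel. t \<noteq> (0::real)" by (rule AE_lborel_singleton)
    then show "AE t in lborel. indicator {-H..H} t * F t = indicator {0<..H} t * F t + indicator {0<..H} (- t) * F t"
      by eventually_elim (auto simp: indicator_def)
  qed
  also have "\<dots> = (\<integral>\<^sup>+t. indicator {0<..H} t * F t \<partial>lborel) + (\<integral>\<^sup>+t. indicator {0<..H} (- t) * F t \<partial>lborel)"
    by (rule nn_integral_add) measurable
  also have "(\<integral>\<^sup>+t. indicator {0<..H} (- t) * F t \<partial>lborel) = (\<integral>\<^sup>+t. indicator {0<..H} t * F t \<partial>lborel)"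
    by (subst nn_integral_real_affine[where c = "-1" and t = 0]) (auto simp: even)
  finally show ?thesis by (simp add: mult_2)
qed

lemma nn_integral_even_eq_set_integral:
  fixes F :: "real \<Rightarrow> ennreal" and f :: "real \<Rightarrow> real"
  assumes "F \<in> borel_measurable borel" "\<And>t. F (- t) = F t"
    and "\<And>t. t \<in> {0<..H} \<Longrightarrow> F t = ennreal (f t)" "\<And>t. t \<in> {0<..H} \<Longrightarrow> 0 \<le> f t"
    and "set_integrable lborel {0<..H} f"
  shows "(\<integral>\<^sup>+t. indicator {-H..H} t * F t \<partial>lborel) = ennreal (2 * (LINT t:{0<..H}|lborel. f t))"
proof -
  have "indicator {0<..H} t * F t = indicator {0<..H} t * ennreal (f t)" for t
    using assms(3)[of t] by (simp add: indicator_def)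
  then have "(\<integral>\<^sup>+t. indicator {0<..H} t * F t \<partial>lborel) = ennreal (LINT t:{0<..H}|lborel. f t)"
    using nn_integral_indicator_eq_set_integral[OF assms(5,4)] by simp
  then show ?thesis
    using nn_integral_even[OF assms(1,2), of H] by (simp add: ennreal_mult')
qed

lemma set_integral_lebesgue_eq_nn_integral:
  fixes f :: "'a::euclidean_space \<Rightarrow> real"
  assumes [measurable]: "f \<in> borel_measurable borel" "B \<in> sets borel" and f: "\<And>x. 0 \<le> f x" and "0 \<le> I"
    and nn: "(\<integral>\<^sup>+x. ennreal (f x) * indicator B x \<partial>lborel) = ennreal I"
  shows "set_integrable lebesgue B f" and "(LINT x:B|lebesgue. f x) = I"
proof -
  have m [measurable]: "(\<lambda>x. indicator B x *\<^sub>R f x) \<in> borel_measurable lborel" by measurable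
  have eq: "ennreal (indicator B x *\<^sub>R f x) = ennreal (f x) * indicator B x" for x
    by (simp add: indicator_def)
  have nn': "(\<integral>\<^sup>+x. ennreal (indicator B x *\<^sub>R f x) \<partial>lborel) = ennreal I"
    unfolding eq by (rule nn)
  have "integrable lborel (\<lambda>x. indicator B x *\<^sub>R f x)"
    using nn' f by (intro integrableI_nonneg) (auto simp: indicator_def)
  then show "set_integrable lebesgue B f"
    unfolding set_integrable_def by (simp add: integrable_completion)
  have "(LINT x:B|lebesgue. f x) = (\<integral>x. indicator B x *\<^sub>R f x \<partial>lborel)"
    unfolding set_lebesgue_integral_def by (rule integral_completion) simp
  also have "\<dots> = enn2real (\<integral>\<^sup>+x. ennreal (indicator B x *\<^sub>R f x) \<partial>lborel)"
    using f by (intro integral_eq_nn_integral) (auto simp: indicator_def)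
  finally show "(LINT x:B|lebesgue. f x) = I"
    using nn' \<open>0 \<le> I\<close> by simp
qed

section \<open>From shells to centroid bodies\<close>

context shell_kernel
begin

lemma nn_integral_shell:
  assumes "0 \<le> r" "0 \<le> s" "0 < r \<or> 0 < s" "0 \<le> Y" "Y \<le> 2"
  shows "(\<integral>\<^sup>+y. indicator {0<..Y} y * ennreal (e (y powr (1 / k) * r) s) \<partial>lborel) = ennreal (shell Y r s)"
  unfolding shell_def
  using assms by (intro nn_integral_indicator_eq_set_integral shell_integrable_gen e_nonneg) auto

lemma nn_integral_shell_outer:
  assumes [measurable]: "Y \<in> borel_measurable borel"
    and even: "\<And>t. Y (- t) = Y t" and Y: "\<And>t. 0 < t \<Longrightarrow> t \<le> 1 \<Longrightarrow> 0 \<le> Y t \<and> Y t \<le> 2"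
    and H: "0 \<le> H" "H \<le> 1" and r: "0 \<le> r" "0 < r \<or> s \<noteq> 0" and C: "0 \<le> C"
  shows "(\<integral>\<^sup>+t. indicator {-H..H} t * (ennreal C * (\<integral>\<^sup>+y. indicator {0<..Y t} y *
            ennreal (e (y powr (1 / k) * r) \<bar>t * s\<bar>) \<partial>lborel)) \<partial>lborel)
     = ennreal (2 * C * (LINT t:{0<..H}|lborel. shell (Y t) r (t * \<bar>s\<bar>)))"
proof -
  define F where "F = (\<lambda>t. ennreal C * (\<integral>\<^sup>+y. indicator {0<..Y t} y * ennreal (e (y powr (1 / k) * r) \<bar>t * s\<bar>) \<partial>lborel))"
  have "(\<integral>\<^sup>+t. indicator {-H..H} t * F t \<partial>lborel)
      = ennreal (2 * (LINT t:{0<..H}|lborel. C * shell (Y t) r (t * \<bar>s\<bar>)))"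
  proof (rule nn_integral_even_eq_set_integral)
    show "F \<in> borel_measurable borel"
      unfolding F_def indicator_def greaterThanAtMost_iff by measurable
    show "F (- t) = F t" for t
      by (simp add: F_def even)
    show "F t = ennreal (C * shell (Y t) r (t * \<bar>s\<bar>))" if "t \<in> {0<..H}" for t
    proof -
      have t: "0 < t" "t \<le> 1" using that H by auto
      have ts: "\<bar>t * s\<bar> = t * \<bar>s\<bar>" using t by (simp add: abs_mult)
      have "F t = ennreal C * ennreal (shell (Y t) r (t * \<bar>s\<bar>))"
        unfolding F_def ts using t r Y by (subst nn_integral_shell) auto
      also have "\<dots> = ennreal (C * shell (Y t) r (t * \<bar>s\<bar>))"
        using C shell_nonneg by (intro ennreal_mult[symmetric])
      finally show ?thesis .
    qed
    have "set_integrable lborel {0<..1} (\<lambda>t. shell (Y t) r (t * \<bar>s\<bar>))"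
      using r Y by (intro shell_integrable_outer_gen) auto
    then have "set_integrable lborel {0<..H} (\<lambda>t. shell (Y t) r (t * \<bar>s\<bar>))"
      by (rule set_integrable_subset) (use H in auto)
    then show "set_integrable lborel {0<..H} (\<lambda>t. C * shell (Y t) r (t * \<bar>s\<bar>))" by simp
  qed (use C shell_nonneg in auto)
  then show ?thesis unfolding F_def by (simp add: mult.assoc)
qed

lemma nn_integral_volume:
  fixes Y :: "real \<Rightarrow> real" and C H W :: real
  assumes [measurable]: "Y \<in> borel_measurable borel"
    and even: "\<And>t. Y (- t) = Y t" and Y: "\<And>t. 0 < t \<Longrightarrow> t \<le> 1 \<Longrightarrow> 0 \<le> Y t \<and> Y t \<le> 2"
    and H: "0 \<le> H" "H \<le> 1" and C: "0 \<le> C" "0 \<le> W"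
  shows "(\<integral>\<^sup>+t. indicator {-H..H} t * (ennreal C * (\<integral>\<^sup>+y. indicator {0<..Y t} y * ennreal W \<partial>lborel)) \<partial>lborel)
     = ennreal (2 * C * W * (LINT t:{0<..H}|lborel. Y t))"
proof -
  define F where "F = (\<lambda>t. ennreal C * (\<integral>\<^sup>+y. indicator {0<..Y t} y * ennreal W \<partial>lborel))"
  have Y': "0 \<le> Y t" "Y t \<le> 2" if "t \<in> {0<..H}" for t
  proof -
    have "0 < t" "t \<le> 1" using that H by auto
    then show "0 \<le> Y t" "Y t \<le> 2" using Y[of t] by auto
  qed
  have "(\<integral>\<^sup>+t. indicator {-H..H} t * F t \<partial>lborel)
      = ennreal (2 * (LINT t:{0<..H}|lborel. C * W * Y t))"
  proof (rule nn_integral_even_eq_set_integral)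
    show "F \<in> borel_measurable borel"
      unfolding F_def indicator_def greaterThanAtMost_iff by measurable
    show "F (- t) = F t" for t
      by (simp add: F_def even)
    show "F t = ennreal (C * W * Y t)" if "t \<in> {0<..H}" for t
    proof -
      have "(\<integral>\<^sup>+y. indicator {0<..Y t} y * ennreal W \<partial>lborel) = ennreal (Y t) * ennreal W"
        using Y'[OF that] by (subst nn_integral_multc) auto
      then have "F t = ennreal C * (ennreal (Y t) * ennreal W)" by (simp add: F_def)
      also have "\<dots> = ennreal (C * (Y t * W))"
        using Y'[OF that] C by (simp add: ennreal_mult)
      also have "C * (Y t * W) = C * W * Y t" by simp
      finally show ?thesis .
    qed
    have "set_integrable lborel {0<..H} Y"
      by (rule set_integrable_bounded_by[OF set_integrable_Ioc_const[of 0 H 2]]) (use Y' in auto)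
    then show "set_integrable lborel {0<..H} (\<lambda>t. C * W * Y t)" by simp
    show "0 \<le> C * W * Y t" if "t \<in> {0<..H}" for t
      using Y'[OF that] C by simp
  qed
  then show ?thesis unfolding F_def by (simp add: mult.assoc)
qed

text \<open>\<open>C\<close> is the Jacobian constant of the coordinates with the k-th power of the
  radius, and \<open>W\<close> is the total mass of the measure that the kernel integrates against.
  They cancel when the averages are compared, so the two cases can share one argument.\<close>

theorem rotbody_counterexample:
  fixes a :: "'a::euclidean_space"
  assumes a: "norm a = 1" and C: "0 < C" and W: "0 < W"
    and centroid: "\<And>Y H z. Y \<in> borel_measurable borel \<Longrightarrow>
      (\<integral>\<^sup>+y. ennreal (\<bar>y \<bullet> z\<bar> powr p) * indicator (rotbody a k Y H) y \<partial>lborel)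
      = (\<integral>\<^sup>+t. indicator {-H..H} t * (ennreal C * (\<integral>\<^sup>+y. indicator {0<..Y t} y *
            ennreal (e (y powr (1 / k) * norm (z - (z \<bullet> a) *\<^sub>R a)) \<bar>t * (z \<bullet> a)\<bar>) \<partial>lborel)) \<partial>lborel)"
    and volume: "\<And>Y H. Y \<in> borel_measurable borel \<Longrightarrow> emeasure lborel (rotbody a k Y H)
      = (\<integral>\<^sup>+t. indicator {-H..H} t * (ennreal C * (\<integral>\<^sup>+y. indicator {0<..Y t} y * ennreal W \<partial>lborel)) \<partial>lborel)"
  shows "\<exists>K L :: 'a set. convex_body K \<and> origin_symmetric K \<and> convex_body L \<and> origin_symmetric L \<and>
           polar_centroid_body p K \<subseteq> polar_centroid_body p L \<and> vol L > vol K"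
proof -
  obtain \<epsilon> R H where \<epsilon>: "0 < \<epsilon>" "\<epsilon> \<le> 1" and RH: "0 < R" "R ^ k \<le> 2" "0 < H" "H \<le> 1" "R ^ k * H < 1"
    and comp: "\<And>r s. \<lbrakk>0 \<le> r; 0 \<le> s; 0 < r \<or> 0 < s\<rbrakk>
           \<Longrightarrow> sgn p * tilted \<epsilon> r s
               \<le> sgn p * ((LINT t:{0<..H}|lborel. shell (R ^ k) r (t * s)) / (R ^ k * H))"
    by (rule comparison) blast
  define YL where "YL = (\<lambda>t. (1 + \<epsilon> / 2) - \<epsilon> * \<bar>t\<bar>)"
  \<comment> \<open>The vanishing slope puts the constant profile into the form required for
    convexity.\<close>
  define YK where "YK = (\<lambda>t. R ^ k - 0 * \<bar>t\<bar>)"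
  define L where "L = rotbody a k YL 1"
  define K where "K = rotbody a k YK H"
  have Rk: "0 < R ^ k" using RH by simp
  have Y_meas [measurable]: "YL \<in> borel_measurable borel" "YK \<in> borel_measurable borel"
    unfolding YL_def YK_def by measurable
  have Y_even: "YL (- t) = YL t" "YK (- t) = YK t" for t
    by (simp_all add: YL_def YK_def)
  have YL_eq: "YL t = 1 + \<epsilon> * (1 / 2 - t)" if "0 < t" for t
    using that by (simp add: YL_def algebra_simps)
  have YL_bd: "0 \<le> YL t \<and> YL t \<le> 2" if "0 < t" "t \<le> 1" for t
    using tilt_bounds[of \<epsilon> t] \<epsilon> that by (simp add: YL_eq)
  have YK_bd: "0 \<le> YK t \<and> YK t \<le> 2" for t
    using Rk RH by (simp add: YK_def)
  have convex: "convex_body L" "convex_body K"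
    unfolding L_def K_def YL_def YK_def using \<epsilon> Rk RH k a by (intro rotbody_convex_body; simp)+
  have sym: "origin_symmetric L" "origin_symmetric K"
    unfolding L_def K_def using Y_even by (intro rotbody_origin_symmetric; simp)+
  have sets: "L \<in> sets borel" "K \<in> sets borel"
    unfolding L_def K_def by measurable
  have IL: "(LINT t:{0<..1}|lborel. YL t) = 1"
  proof -
    have "(LINT t:{0<..1}|lborel. YL t) = (LINT t:{0<..1}|lborel. 1 + \<epsilon> * (1 / 2 - t))"
      by (intro set_lebesgue_integral_cong) (auto simp: YL_eq)
    also have "\<dots> = (LINT t:{0<..1::real}|lborel. 1) + (LINT t:{0<..1}|lborel. \<epsilon> * (1 / 2 - t))"
      by (intro set_integral_add set_integrable_mult_right set_integrable_half_minus set_integrable_Ioc_const)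
    also have "\<dots> = 1"
      by (simp only: set_integral_mult_right set_integral_half_minus) (simp add: set_integral_Ioc_const)
    finally show ?thesis .
  qed
  have IK: "(LINT t:{0<..H}|lborel. YK t) = R ^ k * H"
    using RH by (simp add: YK_def set_integral_Ioc_const)
  have vol_eq: "vol B = V" if "B \<in> sets borel" "emeasure lborel B = ennreal V" "0 \<le> V" for B :: "'a set" and V
    using that by (simp add: measure_def)
  have vL: "vol L = 2 * C * W"
  proof (rule vol_eq[OF sets(1)])
    show "emeasure lborel L = ennreal (2 * C * W)"
      unfolding L_def volume[OF Y_meas(1)]
      using nn_integral_volume[OF Y_meas(1) Y_even(1) YL_bd, of 1 C W] C W by (simp add: IL)
  qed (use C W in simp)
  have vK: "vol K = 2 * C * W * (R ^ k * H)"
  proof (rule vol_eq[OF sets(2)])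
    show "emeasure lborel K = ennreal (2 * C * W * (R ^ k * H))"
      unfolding K_def volume[OF Y_meas(2)]
      using nn_integral_volume[OF Y_meas(2) Y_even(2) YK_bd, of H C W] C W RH by (simp add: IK)
  qed (use C W Rk RH in simp)
  have CW: "0 < 2 * C * W" using C W by simp
  have vless: "vol K < vol L"
    unfolding vL vK using mult_strict_left_mono[OF RH(5) CW] by simp
  have vpos: "0 < vol K" "0 < vol L"
    unfolding vL vK using CW Rk RH by simp_all
  \<comment> \<open>The smaller functional belongs to the larger body, so this inequality gives the
    inclusion.\<close>
  have sub: "polar_centroid_functional p L z \<le> polar_centroid_functional p K z" for z
  proof (cases "z = 0")
    case False
    define s where "s = z \<bullet> a"
    define r where "r = norm (z - s *\<^sub>R a)"
    have r: "0 \<le> r" by (simp add: r_def)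
    have rs: "0 < r \<or> s \<noteq> 0"
    proof (rule ccontr)
      assume "\<not> ?thesis"
      then have "z - s *\<^sub>R a = 0" "s = 0" by (auto simp: r_def)
      then show False using False by simp
    qed
    define T where "T = (LINT t:{0<..H}|lborel. shell (R ^ k) r (t * \<bar>s\<bar>))"
    have nonneg: "0 \<le> (LINT t:{0<..h}|lborel. shell (Y t) r (t * \<bar>s\<bar>))" for h Y
      by (rule set_integral_nonneg_real) (rule shell_nonneg)
    have nnL: "(\<integral>\<^sup>+y. ennreal (\<bar>y \<bullet> z\<bar> powr p) * indicator L y \<partial>lborel) = ennreal (2 * C * tilted \<epsilon> r \<bar>s\<bar>)"
    proof -
      have "(LINT t:{0<..1}|lborel. shell (YL t) r (t * \<bar>s\<bar>)) = tilted \<epsilon> r \<bar>s\<bar>"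
        unfolding tilted_def by (intro set_lebesgue_integral_cong) (auto simp: YL_eq)
      then show ?thesis
        unfolding L_def centroid[OF Y_meas(1)] r_def[symmetric] s_def[symmetric]
        using nn_integral_shell_outer[OF Y_meas(1) Y_even(1) YL_bd, of 1 r s C] r rs C by simp
    qed
    have nnK: "(\<integral>\<^sup>+y. ennreal (\<bar>y \<bullet> z\<bar> powr p) * indicator K y \<partial>lborel) = ennreal (2 * C * T)"
    proof -
      have "(LINT t:{0<..H}|lborel. shell (YK t) r (t * \<bar>s\<bar>)) = T"
        unfolding T_def YK_def by simp
      then show ?thesis
        unfolding K_def centroid[OF Y_meas(2)] r_def[symmetric] s_def[symmetric]
        using nn_integral_shell_outer[OF Y_meas(2) Y_even(2) YK_bd, of H r s C] r rs C RH by simp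
    qed
    have TL0: "0 \<le> tilted \<epsilon> r \<bar>s\<bar>" unfolding tilted_def by (rule nonneg)
    have T0: "0 \<le> T" unfolding T_def by (rule nonneg)
    have meas: "(\<lambda>y. \<bar>y \<bullet> z\<bar> powr p) \<in> borel_measurable borel" by measurable
    have intL: "(LINT y:L|lebesgue. \<bar>y \<bullet> z\<bar> powr p) = 2 * C * tilted \<epsilon> r \<bar>s\<bar>"
      using TL0 C by (intro set_integral_lebesgue_eq_nn_integral(2)[OF meas sets(1) _ _ nnL]) auto
    have intK: "set_integrable lebesgue K (\<lambda>y. \<bar>y \<bullet> z\<bar> powr p)" "(LINT y:K|lebesgue. \<bar>y \<bullet> z\<bar> powr p) = 2 * C * T"
      using T0 C by (intro set_integral_lebesgue_eq_nn_integral[OF meas sets(2) _ _ nnK]; simp)+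
    define aL where "aL = (1 / vol L) * (LINT y:L|lebesgue. \<bar>y \<bullet> z\<bar> powr p)"
    define aK where "aK = (1 / vol K) * (LINT y:K|lebesgue. \<bar>y \<bullet> z\<bar> powr p)"
    have aL: "aL = tilted \<epsilon> r \<bar>s\<bar> / W"
      unfolding aL_def vL intL using C by simp
    have aK: "aK = T / (R ^ k * H) / W"
      unfolding aK_def vK intK using C by simp
    have "compact K" using convex(2) by (simp add: convex_body_def)
    then have "0 < (LINT y:K|lebesgue. \<bar>y \<bullet> z\<bar> powr p)"
      using vpos False intK(1) by (intro set_integral_abs_inner_pos lmeasurable_compact) auto
    \<comment> \<open>For negative \<open>p\<close> the average over \<open>K\<close> is the smaller
      one and has to be positive before the antitone power \<open>1 / p\<close> is applied.\<close>
    then have aK0: "0 < aK" using vpos by (simp add: aK_def)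
    have aL0: "0 \<le> aL" using TL0 W by (simp add: aL)
    have "sgn p * tilted \<epsilon> r \<bar>s\<bar> \<le> sgn p * (T / (R ^ k * H))"
      unfolding T_def using r rs by (intro comp) auto
    then have "sgn p * tilted \<epsilon> r \<bar>s\<bar> / W \<le> sgn p * (T / (R ^ k * H)) / W"
      using W by (intro divide_right_mono) auto
    then have le: "sgn p * aL \<le> sgn p * aK" by (simp add: aL aK)
    have "aL powr (1 / p) \<le> aK powr (1 / p)"
    proof (cases "0 < p")
      case True
      then show ?thesis using le aL0 by (intro powr_mono2) auto
    next
      case False
      then have "p < 0" using p by simp
      then show ?thesis using le aK0 by (intro powr_mono2') auto
    qed
    then show ?thesis
      using False by (simp add: polar_centroid_functional_def aL_def aK_def)
  qed (simp add: polar_centroid_functional_def)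
  have "polar_centroid_body p K \<subseteq> polar_centroid_body p L"
    unfolding polar_centroid_body_def using sub by (auto intro: order_trans)
  then show ?thesis using convex sym vless by blast
qed

end

theorem corollary2p7:
  shows "(\<forall>p::real. -1 < p \<and> p < 0 \<longrightarrow>
           (\<exists>K L :: (real ^ 4) set.
              convex_body K \<and> origin_symmetric K \<and> convex_body L \<and> origin_symmetric L \<and>
              polar_centroid_body p K \<subseteq> polar_centroid_body p L \<and> vol L > vol K))
       \<and> (\<forall>p::real. 0 < p \<and> p < 1 \<longrightarrow>
           (\<exists>K L :: (real ^ 3) set.
              convex_body K \<and> origin_symmetric K \<and> convex_body L \<and> origin_symmetric L \<and>
              polar_centroid_body p K \<subseteq> polar_centroid_body p L \<and> vol L > vol K))"
proof (intro conjI allI impI)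
  fix p :: real assume "- 1 < p \<and> p < 0"
  then have range: "- 1 < p" "p < 0" by auto
  interpret shell_kernel p 3 "interval_kernel p"
    by (rule shell_kernel_interval[OF range])
  show "\<exists>K L :: (real ^ 4) set. convex_body K \<and> origin_symmetric K \<and> convex_body L \<and> origin_symmetric L \<and>
      polar_centroid_body p K \<subseteq> polar_centroid_body p L \<and> vol L > vol K"
  \<comment> \<open>\<open>W = 2\<close> is the length of the interval from -1 to 1, on which the
    projection of the 2-sphere is uniform.\<close>
  proof (rule rotbody_counterexample[where a = "axis 4 1" and C = "2 * pi / 3" and W = 2])
    fix Y :: "real \<Rightarrow> real" and H :: real and z :: "real ^ 4"
    assume Y: "Y \<in> borel_measurable borel"
    let ?r = "norm (z - (z \<bullet> axis 4 1) *\<^sub>R axis 4 1)" and ?s = "z \<bullet> axis 4 1"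
    have "(\<integral>\<^sup>+x. indicator {-1..1} x * ennreal (\<bar>y powr (1 / 3) * ?r * x + t * ?s\<bar> powr p) \<partial>lborel)
        = ennreal (interval_kernel p (y powr (1 / real 3) * ?r) \<bar>t * ?s\<bar>)" for y t
      using nn_integral_interval_kernel[OF range, of "y powr (1 / 3) * ?r" "t * ?s"]
      by (simp add: interval_kernel_abs)
    then show "(\<integral>\<^sup>+y. ennreal (\<bar>y \<bullet> z\<bar> powr p) * indicator (rotbody (axis 4 1) 3 Y H) y \<partial>lborel)
      = (\<integral>\<^sup>+t. indicator {-H..H} t * (ennreal (2 * pi / 3) * (\<integral>\<^sup>+y. indicator {0<..Y t} y *
            ennreal (interval_kernel p (y powr (1 / real 3) * ?r) \<bar>t * ?s\<bar>) \<partial>lborel)) \<partial>lborel)"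
      using nn_integral_rotbody4[OF Y, of "\<lambda>x. \<bar>x\<bar> powr p" z H] by simp
    show "emeasure lborel (rotbody (axis 4 1 :: real ^ 4) 3 Y H)
      = (\<integral>\<^sup>+t. indicator {-H..H} t * (ennreal (2 * pi / 3) * (\<integral>\<^sup>+y. indicator {0<..Y t} y * ennreal 2 \<partial>lborel)) \<partial>lborel)"
      using nn_integral_rotbody4[OF Y, of "\<lambda>_. 1" 0 H] Y by simp
  qed simp_all
next
  fix p :: real assume "0 < p \<and> p < 1"
  then have range: "0 < p" "p < 1" by auto
  interpret shell_kernel p 2 "circle_kernel p"
    by (rule shell_kernel_circle[OF range])
  show "\<exists>K L :: (real ^ 3) set. convex_body K \<and> origin_symmetric K \<and> convex_body L \<and> origin_symmetric L \<and>
      polar_centroid_body p K \<subseteq> polar_centroid_body p L \<and> vol L > vol K"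
  \<comment> \<open>\<open>W = pi\<close> is the length of the half circle over which
    \<open>circle_kernel\<close> integrates.\<close>
  proof (rule rotbody_counterexample[where a = "axis 3 1" and C = 1 and W = pi])
    fix Y :: "real \<Rightarrow> real" and H :: real and z :: "real ^ 3"
    assume Y: "Y \<in> borel_measurable borel"
    let ?r = "norm (z - (z \<bullet> axis 3 1) *\<^sub>R axis 3 1)" and ?s = "z \<bullet> axis 3 1"
    have inner: "(\<integral>\<^sup>+x. indicator {0..pi} x * ennreal (\<bar>sqrt y * ?r * cos x + t * ?s\<bar> powr p) \<partial>lborel)
        = ennreal (circle_kernel p (sqrt y * ?r) \<bar>t * ?s\<bar>)" for y t
      using nn_integral_circle_kernel[OF range, of "sqrt y * ?r" "t * ?s"]
      by (simp add: circle_kernel_abs[OF range])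
    have root: "indicator {0<..Y t} y * ennreal (circle_kernel p (sqrt y * ?r) \<bar>t * ?s\<bar>)
        = indicator {0<..Y t} y * ennreal (circle_kernel p (y powr (1 / real 2) * ?r) \<bar>t * ?s\<bar>)" for y t
      by (simp add: indicator_def powr_half_sqrt)
    show "(\<integral>\<^sup>+y. ennreal (\<bar>y \<bullet> z\<bar> powr p) * indicator (rotbody (axis 3 1) 2 Y H) y \<partial>lborel)
      = (\<integral>\<^sup>+t. indicator {-H..H} t * (ennreal 1 * (\<integral>\<^sup>+y. indicator {0<..Y t} y *
            ennreal (circle_kernel p (y powr (1 / real 2) * ?r) \<bar>t * ?s\<bar>) \<partial>lborel)) \<partial>lborel)"
      using nn_integral_rotbody3[OF Y, of "\<lambda>x. \<bar>x\<bar> powr p" z H]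
      unfolding inner root by simp
    show "emeasure lborel (rotbody (axis 3 1 :: real ^ 3) 2 Y H)
      = (\<integral>\<^sup>+t. indicator {-H..H} t * (ennreal 1 * (\<integral>\<^sup>+y. indicator {0<..Y t} y * ennreal pi \<partial>lborel)) \<partial>lborel)"
      using nn_integral_rotbody3[OF Y, of "\<lambda>_. 1" 0 H] Y by simp
  qed simp_all
qed

end
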